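(* Let $S$ be a Cohen-Macaulay ring and let $I$ be a proper unmixed ideal of $S$ that is generically a complete intersection, with $\operatorname{ht}(I)=c$. Let $m$ be a positive integer. Then $I^{(m)}=I^m$ if and only if the ideal $\mathbf F_c(I)$ contains an $S/I^m$-regular element.
   Context: All rings are Noetherian, commutative, with identity. An ideal $I$ is unmixed of height $c$ if $\operatorname{ht}(p)=c$ for every $p\in\operatorname{Ass}_S(S/I)$. $I$ is generically a complete intersection if for every $p\in\operatorname{Ass}_S(S/I)$ the localization $I_p$ can be generated by an $S_p$-regular sequence. The $m$-th symbolic power of $I$ is $I^{(m)}=\bigcap_{p\in\operatorname{Ass}_S(S/I)}(I^mS_p\cap S)$, where $I^mS_p\cap S$ denotes the preimage in $S$ of $I^mS_p$ under $S\to S_p$. For a finitely generated $S$-module $M$ with free presentation $S^q\xrightarrow{\varphi}S^{\mu}\to M\to 0$, the $j$-th Fitting ideal is $\mathbf F_j(M)=I_{\mu-j}(\varphi)$, the ideal generated by the $(\mu-j)$-minors of $\varphi$ (with $\mathbf F_j(M)=S$ if $j\ge\mu$); it is independent of the presentation. $\mathbf F_c(I)$ is the $c$-th Fitting ideal of $I$ viewed as an $S$-module. An element of $S$ is $S/I^m$-regular if it is a nonzerodivisor on $S/I^m$. *)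

theory Defs
  imports
    "HOL-Algebra.Ring_Divisibility"
    "HOL-Algebra.Ideal_Product"
    "HOL-Algebra.Module"
    "HOL-Combinatorics.Permutations"
    "HOL-Library.Extended_Nat"
begin

section \<open>Ideals and quotients as modules\<close>

text \<open>
  The module record of HOL-Algebra extends the ring record; its fields \<open>mult\<close> and \<open>one\<close>
  play no role for modules.
\<close>

definition ideal_module :: "('a, 'b) ring_scheme \<Rightarrow> 'a set \<Rightarrow> ('a, 'a) module"
  where "ideal_module R I =
    \<lparr>carrier = I, mult = mult R, one = \<one>\<^bsub>R\<^esub>, zero = \<zero>\<^bsub>R\<^esub>, add = add R, smult = mult R\<rparr>"

definition quot_module :: "('a, 'b) ring_scheme \<Rightarrow> 'a set \<Rightarrow> ('a, 'a set) module"
  where "quot_module R I =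
    \<lparr>carrier = carrier (R Quot I), mult = mult (R Quot I), one = \<one>\<^bsub>R Quot I\<^esub>,
     zero = \<zero>\<^bsub>R Quot I\<^esub>, add = add (R Quot I),
     smult = (\<lambda>r X. (I +>\<^bsub>R\<^esub> r) \<otimes>\<^bsub>R Quot I\<^esub> X)\<rparr>"

definition nonzerodivisor_on :: "('a, 'b, 'c) module_scheme \<Rightarrow> 'a \<Rightarrow> bool"
  where "nonzerodivisor_on M x \<longleftrightarrow>
    (\<forall>v\<in>carrier M. x \<odot>\<^bsub>M\<^esub> v = \<zero>\<^bsub>M\<^esub> \<longrightarrow> v = \<zero>\<^bsub>M\<^esub>)"

definition annihilator :: "('a, 'd) ring_scheme \<Rightarrow> ('a, 'b, 'c) module_scheme \<Rightarrow> 'b \<Rightarrow> 'a set"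
  where "annihilator R M v = {r \<in> carrier R. r \<odot>\<^bsub>M\<^esub> v = \<zero>\<^bsub>M\<^esub>}"

definition Ass :: "('a, 'd) ring_scheme \<Rightarrow> ('a, 'b, 'c) module_scheme \<Rightarrow> 'a set set"
  where "Ass R M = {p. primeideal p R \<and> (\<exists>v\<in>carrier M. p = annihilator R M v)}"


section \<open>Localization\<close>

definition loc_rel :: "('a, 'b) ring_scheme \<Rightarrow> 'a set \<Rightarrow> (('a \<times> 'a) \<times> ('a \<times> 'a)) set"
  where "loc_rel R W = {((a, s), (b, t)).
    a \<in> carrier R \<and> s \<in> W \<and> b \<in> carrier R \<and> t \<in> W \<and>
    (\<exists>u\<in>W. u \<otimes>\<^bsub>R\<^esub> (a \<otimes>\<^bsub>R\<^esub> t) = u \<otimes>\<^bsub>R\<^esub> (b \<otimes>\<^bsub>R\<^esub> s))}"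

definition loc_frac :: "('a, 'b) ring_scheme \<Rightarrow> 'a set \<Rightarrow> 'a \<Rightarrow> 'a \<Rightarrow> ('a \<times> 'a) set"
  where "loc_frac R W a s = loc_rel R W `` {(a, s)}"

text \<open>
  The unions in the following definition range over the representatives of two classes; all
  representatives contribute the same class.
\<close>

definition localization :: "('a, 'b) ring_scheme \<Rightarrow> 'a set \<Rightarrow> ('a \<times> 'a) set ring"
  where "localization R W =
    \<lparr>carrier = (carrier R \<times> W) // loc_rel R W,
     mult = (\<lambda>X Y. \<Union>(a, s)\<in>X. \<Union>(b, t)\<in>Y. loc_frac R W (a \<otimes>\<^bsub>R\<^esub> b) (s \<otimes>\<^bsub>R\<^esub> t)),
     one = loc_frac R W \<one>\<^bsub>R\<^esub> \<one>\<^bsub>R\<^esub>,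
     zero = loc_frac R W \<zero>\<^bsub>R\<^esub> \<one>\<^bsub>R\<^esub>,
     add = (\<lambda>X Y. \<Union>(a, s)\<in>X. \<Union>(b, t)\<in>Y.
       loc_frac R W (a \<otimes>\<^bsub>R\<^esub> t \<oplus>\<^bsub>R\<^esub> b \<otimes>\<^bsub>R\<^esub> s) (s \<otimes>\<^bsub>R\<^esub> t))\<rparr>"

definition loc_at :: "('a, 'b) ring_scheme \<Rightarrow> 'a set \<Rightarrow> ('a \<times> 'a) set ring"
  where "loc_at R p = localization R (carrier R - p)"

definition to_loc_at :: "('a, 'b) ring_scheme \<Rightarrow> 'a set \<Rightarrow> 'a \<Rightarrow> ('a \<times> 'a) set"
  where "to_loc_at R p a = loc_frac R (carrier R - p) a \<one>\<^bsub>R\<^esub>"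

definition ext_at :: "('a, 'b) ring_scheme \<Rightarrow> 'a set \<Rightarrow> 'a set \<Rightarrow> ('a \<times> 'a) set set"
  where "ext_at R p I = Idl\<^bsub>loc_at R p\<^esub> (to_loc_at R p ` I)"


section \<open>Height, dimension, depth, Cohen-Macaulay rings\<close>

definition prime_chain :: "('a, 'b) ring_scheme \<Rightarrow> (nat \<Rightarrow> 'a set) \<Rightarrow> nat \<Rightarrow> bool"
  where "prime_chain R P n \<longleftrightarrow>
    (\<forall>i\<le>n. primeideal (P i) R) \<and> (\<forall>i<n. P i \<subset> P (Suc i))"

definition prime_height :: "('a, 'b) ring_scheme \<Rightarrow> 'a set \<Rightarrow> enat"
  where "prime_height R p = Sup {enat n | n. \<exists>P. prime_chain R P n \<and> P n = p}"

definition ideal_height :: "('a, 'b) ring_scheme \<Rightarrow> 'a set \<Rightarrow> enat"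
  where "ideal_height R I = Inf {prime_height R p | p. primeideal p R \<and> I \<subseteq> p}"

definition krull_dim :: "('a, 'b) ring_scheme \<Rightarrow> enat"
  where "krull_dim R = Sup {enat n | n. \<exists>P. prime_chain R P n}"

definition regular_sequence :: "('a, 'b) ring_scheme \<Rightarrow> 'a list \<Rightarrow> bool"
  where "regular_sequence R xs \<longleftrightarrow>
    set xs \<subseteq> carrier R \<and>
    (\<forall>i<length xs. nonzerodivisor_on (quot_module R (Idl\<^bsub>R\<^esub> (set (take i xs)))) (xs ! i)) \<and>
    Idl\<^bsub>R\<^esub> (set xs) \<noteq> carrier R"

definition depth :: "('a, 'b) ring_scheme \<Rightarrow> 'a set \<Rightarrow> enat"
  where "depth R J = Sup {enat (length xs) | xs. regular_sequence R xs \<and> set xs \<subseteq> J}"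

definition local_cohen_macaulay :: "('a, 'b) ring_scheme \<Rightarrow> bool"
  where "local_cohen_macaulay R \<longleftrightarrow> cring R \<and> noetherian_ring R \<and>
    (\<exists>M. {J. maximalideal J R} = {M} \<and> depth R M = krull_dim R)"

definition cohen_macaulay :: "('a, 'b) ring_scheme \<Rightarrow> bool"
  where "cohen_macaulay R \<longleftrightarrow> cring R \<and> noetherian_ring R \<and>
    (\<forall>M. maximalideal M R \<longrightarrow> local_cohen_macaulay (loc_at R M))"


section \<open>Unmixed ideals and symbolic powers\<close>

definition unmixed_of_height :: "('a, 'b) ring_scheme \<Rightarrow> 'a set \<Rightarrow> nat \<Rightarrow> bool"
  where "unmixed_of_height R I c \<longleftrightarrow>
    (\<forall>p\<in>Ass R (quot_module R I). prime_height R p = enat c)"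

definition generically_complete_intersection :: "('a, 'b) ring_scheme \<Rightarrow> 'a set \<Rightarrow> bool"
  where "generically_complete_intersection R I \<longleftrightarrow>
    (\<forall>p\<in>Ass R (quot_module R I).
       \<exists>xs. regular_sequence (loc_at R p) xs \<and> ext_at R p I = Idl\<^bsub>loc_at R p\<^esub> (set xs))"

definition ideal_power :: "('a, 'b) ring_scheme \<Rightarrow> 'a set \<Rightarrow> nat \<Rightarrow> 'a set"
  where "ideal_power R I m = I [^]\<^bsub>ideals_set R\<^esub> m"

definition symbolic_power :: "('a, 'b) ring_scheme \<Rightarrow> 'a set \<Rightarrow> nat \<Rightarrow> 'a set"
  where "symbolic_power R I m =
    {a \<in> carrier R. \<forall>p\<in>Ass R (quot_module R I).
       to_loc_at R p a \<in> ext_at R p (ideal_power R I m)}"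


section \<open>Fitting ideals\<close>

definition free_vecs :: "('a, 'b) ring_scheme \<Rightarrow> nat \<Rightarrow> (nat \<Rightarrow> 'a) set"
  where "free_vecs R n = {..<n} \<rightarrow>\<^sub>E carrier R"

definition mat_apply ::
    "('a, 'b) ring_scheme \<Rightarrow> nat \<Rightarrow> nat \<Rightarrow> (nat \<Rightarrow> nat \<Rightarrow> 'a) \<Rightarrow> (nat \<Rightarrow> 'a) \<Rightarrow> nat \<Rightarrow> 'a"
  where "mat_apply R \<mu> q A v =
    (\<lambda>i\<in>{..<\<mu>}. \<Oplus>\<^bsub>R\<^esub>j\<in>{..<q}. A i j \<otimes>\<^bsub>R\<^esub> v j)"

definition lin_comb ::
    "('a, 'b, 'c) module_scheme \<Rightarrow> nat \<Rightarrow> (nat \<Rightarrow> 'b) \<Rightarrow> (nat \<Rightarrow> 'a) \<Rightarrow> 'b"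
  where "lin_comb M \<mu> g v = (\<Oplus>\<^bsub>M\<^esub>i\<in>{..<\<mu>}. v i \<odot>\<^bsub>M\<^esub> g i)"

text \<open>
  Exactness of \<open>R\<^sup>q \<rightarrow> R\<^sup>\<mu> \<rightarrow> M \<rightarrow> 0\<close>, where the first map is given by the \<open>\<mu> \<times> q\<close> matrix \<open>A\<close>
  and the second one sends the \<open>i\<close>-th basis vector to \<open>g i\<close>.
\<close>

definition presentation ::
    "('a, 'd) ring_scheme \<Rightarrow> ('a, 'b, 'c) module_scheme \<Rightarrow> nat \<Rightarrow> nat \<Rightarrow>
      (nat \<Rightarrow> nat \<Rightarrow> 'a) \<Rightarrow> (nat \<Rightarrow> 'b) \<Rightarrow> bool"
  where "presentation R M \<mu> q A g \<longleftrightarrow>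
    (\<forall>i<\<mu>. \<forall>j<q. A i j \<in> carrier R) \<and> (\<forall>i<\<mu>. g i \<in> carrier M) \<and>
    lin_comb M \<mu> g ` free_vecs R \<mu> = carrier M \<and>
    {v \<in> free_vecs R \<mu>. lin_comb M \<mu> g v = \<zero>\<^bsub>M\<^esub>} = mat_apply R \<mu> q A ` free_vecs R q"

definition ring_det :: "('a, 'b) ring_scheme \<Rightarrow> nat \<Rightarrow> (nat \<Rightarrow> nat \<Rightarrow> 'a) \<Rightarrow> 'a"
  where "ring_det R k B =
    (\<Oplus>\<^bsub>R\<^esub>\<sigma>\<in>{\<sigma>. \<sigma> permutes {..<k}}.
       let t = (\<Otimes>\<^bsub>R\<^esub>i\<in>{..<k}. B i (\<sigma> i)) in if evenperm \<sigma> then t else \<ominus>\<^bsub>R\<^esub> t)"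

definition minors ::
    "('a, 'b) ring_scheme \<Rightarrow> nat \<Rightarrow> nat \<Rightarrow> (nat \<Rightarrow> nat \<Rightarrow> 'a) \<Rightarrow> nat \<Rightarrow> 'a set"
  where "minors R \<mu> q A k =
    {ring_det R k (\<lambda>i j. A (r i) (s j)) | r s.
       strict_mono_on {..<k} r \<and> r ` {..<k} \<subseteq> {..<\<mu>} \<and>
       strict_mono_on {..<k} s \<and> s ` {..<k} \<subseteq> {..<q}}"

text \<open>
  The Fitting ideal does not depend on the presentation, so it is read off from a chosen one.
  The value is meaningful only if \<open>M\<close> is finitely presented.
\<close>

definition fitting_ideal ::
    "('a, 'd) ring_scheme \<Rightarrow> ('a, 'b, 'c) module_scheme \<Rightarrow> nat \<Rightarrow> 'a set"
  where "fitting_ideal R M j =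
    (SOME F. \<exists>\<mu> q A g. presentation R M \<mu> q A g \<and>
       F = (if \<mu> \<le> j then carrier R else Idl\<^bsub>R\<^esub> (minors R \<mu> q A (\<mu> - j))))"

end

theory Submission
  imports Defs
begin

text \<open>
  Everything happens inside \<open>S\<close>: a statement about an ideal \<open>A\<close> in the localization at a prime \<open>P\<close>
  is a statement about \<open>sat S P A\<close>, the preimage in \<open>S\<close> of the extension of \<open>A\<close>.
  The ideal \<open>F\<^sub>c(I)\<close> is not contained in a prime \<open>P\<close> iff \<open>I\<^sub>P\<close> has \<open>c\<close> generators.

  If \<open>I\<^sup>(\<^sup>m\<^sup>) = I\<^sup>m\<close>: at each associated prime of \<open>I\<close>, of height \<open>c\<close>, the ideal is generated by a
  regular sequence, which has length at most \<open>c\<close>. So prime avoidance yields \<open>x \<in> F\<^sub>c(I)\<close> outside of all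
  these primes, and \<open>x a \<in> I\<^sup>m\<close> then implies \<open>a \<in> I\<^sup>(\<^sup>m\<^sup>)\<close>.

  Conversely, an associated prime \<open>Q\<close> of \<open>I\<^sup>m\<close> does not contain \<open>F\<^sub>c(I)\<close>, so \<open>I\<^sub>Q\<close> has \<open>c\<close> generators.
  As \<open>S\<close> is Cohen-Macaulay and \<open>I\<close> has height \<open>c\<close>, the generators can be changed to a regular
  sequence. An element of \<open>Q\<close> regular modulo \<open>I\<^sub>Q\<close> would be regular modulo all powers of \<open>I\<^sub>Q\<close>, hence
  \<open>Q\<close> is associated to \<open>I\<close>, and no element of \<open>I\<^sup>(\<^sup>m\<^sup>)\<close> outside of \<open>I\<^sup>m\<close> can exist.
\<close>

section \<open>Saturation and associated primes\<close>

text \<open>Several primes are in play at once: an associated prime \<open>p\<close>, the prime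
  \<open>Q\<close> at which a sequence is regular, and a maximal ideal \<open>M\<close> above both.
  Saturations keep them in one ring, where passing to a smaller prime only enlarges
  \<open>sat\<close>. The price is that a unit becomes an explicit multiplier outside the prime,
  which every computation carries along. The Cohen-Macaulay hypothesis speaks about maximal ideals,
  while regular sequences are needed at primes below them. The bridge is an exchange principle: for
  two regular sequences of equal length in \<open>P\<close>, either both generate ideals to which
  \<open>P\<close> is associated or neither does, so a shorter regular sequence can always be
  prolonged to the length of a longer one. Moreover a regular element pushes an associated prime
  into a strictly larger one. Heights are then bounded by counting. The Fitting ideal is read off
  from a chosen presentation, so its local criterion is proved for an arbitrary one: Cramer's rule
  gives generators from a minor, and a diagonal matrix of multipliers gives a minor from
  generators.\<close>

locale noetherian_cring = noetherian_ring R + cring R for R (structure)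

definition colon :: "('a, 'b) ring_scheme \<Rightarrow> 'a set \<Rightarrow> 'a \<Rightarrow> 'a set"
  where "colon R A a = {r \<in> carrier R. r \<otimes>\<^bsub>R\<^esub> a \<in> A}"

text \<open>The associated primes of \<open>R / A\<close>, with the annihilated coset represented by
  an element of \<open>R\<close>; \<open>Ass_quot_module\<close> is the translation.\<close>

definition assprimes :: "('a, 'b) ring_scheme \<Rightarrow> 'a set \<Rightarrow> 'a set set"
  where "assprimes R A = {p. primeideal p R \<and> (\<exists>a\<in>carrier R. p = colon R A a)}"

definition sat :: "('a, 'b) ring_scheme \<Rightarrow> 'a set \<Rightarrow> 'a set \<Rightarrow> 'a set"
  where "sat R P A = {a \<in> carrier R. \<exists>s\<in>carrier R - P. s \<otimes>\<^bsub>R\<^esub> a \<in> A}"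

text \<open>This is a nonzerodivisor on the localization of \<open>R / A\<close> at
  \<open>P\<close>. Units qualify, so sequences that must lie in the maximal ideal carry the
  condition \<open>set xs \<subseteq> P\<close> separately.\<close>

definition regular_at :: "('a, 'b) ring_scheme \<Rightarrow> 'a set \<Rightarrow> 'a set \<Rightarrow> 'a \<Rightarrow> bool"
  where "regular_at R P A w \<longleftrightarrow> (\<forall>a\<in>carrier R. w \<otimes>\<^bsub>R\<^esub> a \<in> sat R P A \<longrightarrow> a \<in> sat R P A)"

text \<open>The sum \<open>A + R w\<close> in explicit form: membership yields a coefficient of
  \<open>w\<close> at once, and \<open>adjs\<close> folds the sum in the order in which
  \<open>regular_seq_at\<close> consumes a sequence.\<close>

definition adjoin :: "('a, 'b) ring_scheme \<Rightarrow> 'a set \<Rightarrow> 'a \<Rightarrow> 'a set"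
  where "adjoin R A w = {a \<oplus>\<^bsub>R\<^esub> r \<otimes>\<^bsub>R\<^esub> w | a r. a \<in> A \<and> r \<in> carrier R}"

abbreviation adjs :: "('a, 'b) ring_scheme \<Rightarrow> 'a set \<Rightarrow> 'a list \<Rightarrow> 'a set"
  where "adjs R \<equiv> foldl (adjoin R)"

text \<open>The recursion absorbs the head into the base ideal, so inductions over sequences
  generalize over \<open>A\<close>.\<close>

fun regular_seq_at :: "('a, 'b) ring_scheme \<Rightarrow> 'a set \<Rightarrow> 'a set \<Rightarrow> 'a list \<Rightarrow> bool"
  where "regular_seq_at R P A [] \<longleftrightarrow> True"
  | "regular_seq_at R P A (x # xs) \<longleftrightarrow> regular_at R P A x \<and> regular_seq_at R P (adjoin R A x) xs"

context ring
begin

lemma ideal_basic: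
  assumes "ideal A R"
  shows "A \<subseteq> carrier R" "\<zero> \<in> A" "\<And>a b. \<lbrakk>a \<in> A; b \<in> A\<rbrakk> \<Longrightarrow> a \<oplus> b \<in> A"
    "\<And>a. a \<in> A \<Longrightarrow> \<ominus> a \<in> A" "\<And>a r. \<lbrakk>a \<in> A; r \<in> carrier R\<rbrakk> \<Longrightarrow> r \<otimes> a \<in> A"
    "\<And>a r. \<lbrakk>a \<in> A; r \<in> carrier R\<rbrakk> \<Longrightarrow> a \<otimes> r \<in> A" "\<And>a. a \<in> A \<Longrightarrow> a \<in> carrier R"
    "\<And>a b. \<lbrakk>a \<in> A; b \<in> A\<rbrakk> \<Longrightarrow> a \<ominus> b \<in> A"
proof -
  interpret ideal A R by fact
  show "A \<subseteq> carrier R" "\<zero> \<in> A" "\<And>a b. \<lbrakk>a \<in> A; b \<in> A\<rbrakk> \<Longrightarrow> a \<oplus> b \<in> A"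
    "\<And>a. a \<in> A \<Longrightarrow> \<ominus> a \<in> A" "\<And>a r. \<lbrakk>a \<in> A; r \<in> carrier R\<rbrakk> \<Longrightarrow> r \<otimes> a \<in> A"
    "\<And>a r. \<lbrakk>a \<in> A; r \<in> carrier R\<rbrakk> \<Longrightarrow> a \<otimes> r \<in> A" "\<And>a. a \<in> A \<Longrightarrow> a \<in> carrier R"
    using I_l_closed I_r_closed by (auto simp: a_subset)
  then show "\<And>a b. \<lbrakk>a \<in> A; b \<in> A\<rbrakk> \<Longrightarrow> a \<ominus> b \<in> A"
    by (simp add: a_minus_def)
qed

end

context cring
begin

text \<open>Additive inverses come from multiplication by \<open>\<ominus> \<one>\<close>.\<close>

lemma ideal_of_closed:
  assumes "A \<subseteq> carrier R" "\<zero> \<in> A" "\<And>a b. \<lbrakk>a \<in> A; b \<in> A\<rbrakk> \<Longrightarrow> a \<oplus> b \<in> A"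
    "\<And>a r. \<lbrakk>a \<in> A; r \<in> carrier R\<rbrakk> \<Longrightarrow> r \<otimes> a \<in> A"
  shows "ideal A R"
proof (rule idealI[OF ring_axioms])
  have "\<ominus> a \<in> A" if "a \<in> A" for a
  proof -
    have "\<ominus> \<one> \<otimes> a = \<ominus> a"
      using that assms(1) by (simp add: l_minus subset_iff)
    then show ?thesis
      using assms(4)[OF that, of "\<ominus> \<one>"] by simp
  qed
  then show "subgroup A (add_monoid R)"
    using assms by (intro add.subgroupI) (auto simp: a_inv_def)
  show "x \<otimes> a \<in> A" if "a \<in> A" "x \<in> carrier R" for a x
    using that assms by blast
  then show "a \<otimes> x \<in> A" if "a \<in> A" "x \<in> carrier R" for a x
    using that assms m_comm by (metis subsetD)
qed

lemma primeideal_basic: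
  assumes "primeideal P R"
  shows "ideal P R" "\<one> \<notin> P" "\<zero> \<in> P" "P \<subseteq> carrier R"
    "\<And>a b. \<lbrakk>a \<in> carrier R; b \<in> carrier R; a \<notin> P; b \<notin> P\<rbrakk> \<Longrightarrow> a \<otimes> b \<notin> P"
proof -
  interpret primeideal P R by fact
  show "ideal P R" "\<zero> \<in> P" "P \<subseteq> carrier R" by (auto simp: is_ideal a_subset)
  show "\<one> \<notin> P" using I_notcarr one_imp_carrier by blast
  show "\<And>a b. \<lbrakk>a \<in> carrier R; b \<in> carrier R; a \<notin> P; b \<notin> P\<rbrakk> \<Longrightarrow> a \<otimes> b \<notin> P"
    using I_prime by blast
qed

lemma primeideal_of_basic:
  assumes "ideal P R" "\<one> \<notin> P"
    "\<And>a b. \<lbrakk>a \<in> carrier R; b \<in> carrier R; a \<otimes> b \<in> P; a \<notin> P\<rbrakk> \<Longrightarrow> b \<in> P"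
  shows "primeideal P R"
proof (rule primeidealI[OF assms(1) is_cring])
  show "carrier R \<noteq> P" using assms(2) one_closed by blast
  show "\<And>a b. \<lbrakk>a \<in> carrier R; b \<in> carrier R; a \<otimes> b \<in> P\<rbrakk> \<Longrightarrow> a \<in> P \<or> b \<in> P"
    using assms(3) by blast
qed

lemma colon_ideal:
  assumes "ideal A R" "a \<in> carrier R"
  shows "ideal (colon R A a) R"
  unfolding colon_def
  by (rule ideal_of_closed)
    (auto simp: assms ideal_basic(2,3,5)[OF assms(1)] l_distr m_assoc)

lemma mem_colon: "r \<in> colon R A a \<longleftrightarrow> r \<in> carrier R \<and> r \<otimes> a \<in> A"
  by (auto simp: colon_def)

lemma satI: "\<lbrakk>a \<in> carrier R; s \<in> carrier R; s \<notin> P; s \<otimes> a \<in> A\<rbrakk> \<Longrightarrow> a \<in> sat R P A"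
  by (auto simp: sat_def)

lemma satE:
  assumes "a \<in> sat R P A"
  obtains s where "a \<in> carrier R" "s \<in> carrier R" "s \<notin> P" "s \<otimes> a \<in> A"
  using assms by (auto simp: sat_def)

lemma sat_mono: "A \<subseteq> B \<Longrightarrow> sat R P A \<subseteq> sat R P B"
  by (auto simp: sat_def)

lemma sat_antimono: "P \<subseteq> M \<Longrightarrow> sat R M A \<subseteq> sat R P A"
  by (auto simp: sat_def)

lemma sat_subset_carrier: "sat R P A \<subseteq> carrier R"
  by (auto simp: sat_def)

lemma subset_sat:
  assumes "primeideal P R" "A \<subseteq> carrier R"
  shows "A \<subseteq> sat R P A"
  using assms primeideal_basic(2)[OF assms(1)] by (auto intro!: satI[of _ \<one>])

lemma sat_ideal:
  assumes P: "primeideal P R" and A: "ideal A R"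
  shows "ideal (sat R P A) R"
proof (rule ideal_of_closed[OF sat_subset_carrier])
  show "\<zero> \<in> sat R P A"
    using subset_sat[OF P] ideal_basic(1,2)[OF A] by blast
next
  fix a b assume "a \<in> sat R P A" "b \<in> sat R P A"
  then obtain s t where s: "a \<in> carrier R" "s \<in> carrier R" "s \<notin> P" "s \<otimes> a \<in> A"
    and t: "b \<in> carrier R" "t \<in> carrier R" "t \<notin> P" "t \<otimes> b \<in> A"
    by (metis satE)
  have "(s \<otimes> t) \<otimes> (a \<oplus> b) = t \<otimes> (s \<otimes> a) \<oplus> s \<otimes> (t \<otimes> b)"
    using s t by algebra
  also have "\<dots> \<in> A"
    using s t ideal_basic(3,5)[OF A] by simp
  finally show "a \<oplus> b \<in> sat R P A"
    using s t primeideal_basic(5)[OF P] by (intro satI[of _ "s \<otimes> t"]) auto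
next
  fix a r assume "a \<in> sat R P A" and r: "r \<in> carrier R"
  then obtain s where s: "a \<in> carrier R" "s \<in> carrier R" "s \<notin> P" "s \<otimes> a \<in> A"
    by (metis satE)
  have "s \<otimes> (r \<otimes> a) = r \<otimes> (s \<otimes> a)"
    using s r by algebra
  also have "\<dots> \<in> A"
    using s r ideal_basic(3,5)[OF A] by simp
  finally show "r \<otimes> a \<in> sat R P A"
    using s r by (intro satI[of _ s]) auto
qed

text \<open>Elements outside \<open>P\<close> become units after localization; the two multipliers
  can be composed because the complement of a prime is multiplicatively closed.\<close>

lemma sat_cancel:
  assumes P: "primeideal P R"
    and "a \<in> carrier R" "s \<in> carrier R" "s \<notin> P" "s \<otimes> a \<in> sat R P A"
  shows "a \<in> sat R P A"
proof -
  obtain t where t: "t \<in> carrier R" "t \<notin> P" "t \<otimes> (s \<otimes> a) \<in> A"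
    using assms by (metis satE)
  have "(t \<otimes> s) \<otimes> a \<in> A" using t assms by (simp add: m_assoc)
  then show ?thesis
    using t assms primeideal_basic(5)[OF P] by (intro satI[of _ "t \<otimes> s"]) auto
qed

lemma sat_idem:
  assumes "primeideal P R" "A \<subseteq> carrier R"
  shows "sat R P (sat R P A) = sat R P A"
  using subset_sat[OF assms(1) sat_subset_carrier]
  by (auto elim: satE intro: sat_cancel[OF assms(1)])

text \<open>A multiplier outside \<open>M\<close> is also outside \<open>P\<close> and is cancelled
  by primality; with \<open>A = P\<close> this says that \<open>P\<close> is recovered from its
  extension to the localization at \<open>M\<close>.\<close>

lemma sat_subset_prime:
  assumes P: "primeideal P R" "P \<subseteq> M" "A \<subseteq> P"
  shows "sat R M A \<subseteq> P"
  using assms primeideal_basic(5)[OF P(1)] by (fastforce elim!: satE)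

lemma sat_zero_proper: "primeideal M R \<Longrightarrow> \<one> \<notin> sat R M {\<zero>}"
  using primeideal_basic(3) by (auto elim!: satE)

lemma mem_adjoin: "x \<in> adjoin R A w \<longleftrightarrow> (\<exists>a\<in>A. \<exists>r\<in>carrier R. x = a \<oplus> r \<otimes> w)"
  by (auto simp: adjoin_def)

lemma adjoin_ideal:
  assumes A: "ideal A R" and w: "w \<in> carrier R"
  shows "ideal (adjoin R A w) R"
proof (rule ideal_of_closed)
  note i = ideal_basic[OF A]
  show "adjoin R A w \<subseteq> carrier R" using i(1) w by (auto simp: adjoin_def)
  have "\<zero> = \<zero> \<oplus> \<zero> \<otimes> w" using w by simp
  then show "\<zero> \<in> adjoin R A w" using i(2) unfolding mem_adjoin by blast
next
  note i = ideal_basic[OF A]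
  fix x y assume "x \<in> adjoin R A w" "y \<in> adjoin R A w"
  then obtain a r b t where *: "a \<in> A" "b \<in> A" "r \<in> carrier R" "t \<in> carrier R"
    "x = a \<oplus> r \<otimes> w" "y = b \<oplus> t \<otimes> w" unfolding mem_adjoin by blast
  have "x \<oplus> y = (a \<oplus> b) \<oplus> (r \<oplus> t) \<otimes> w"
    unfolding * using *(1-4) i(7) w by algebra
  then show "x \<oplus> y \<in> adjoin R A w" using * i(3) unfolding mem_adjoin by blast
next
  note i = ideal_basic[OF A]
  fix x t assume "x \<in> adjoin R A w" and t: "t \<in> carrier R"
  then obtain a r where *: "a \<in> A" "r \<in> carrier R" "x = a \<oplus> r \<otimes> w"
    unfolding mem_adjoin by blast
  have "t \<otimes> x = (t \<otimes> a) \<oplus> (t \<otimes> r) \<otimes> w"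
    unfolding * using *(1-2) t i(7) w by algebra
  then show "t \<otimes> x \<in> adjoin R A w" using * t i(5) unfolding mem_adjoin by blast
qed

lemma adjoin_basic:
  assumes A: "ideal A R" and w: "w \<in> carrier R"
  shows "A \<subseteq> adjoin R A w" "w \<in> adjoin R A w"
    "\<And>B. \<lbrakk>ideal B R; A \<subseteq> B; w \<in> B\<rbrakk> \<Longrightarrow> adjoin R A w \<subseteq> B"
proof -
  note i = ideal_basic[OF A]
  have "a = a \<oplus> \<zero> \<otimes> w" if "a \<in> A" for a using w i(7) that by simp
  then show "A \<subseteq> adjoin R A w" unfolding subset_iff mem_adjoin by blast
  have "w = \<zero> \<oplus> \<one> \<otimes> w" using w by simp
  then show "w \<in> adjoin R A w" using i(2) unfolding mem_adjoin by blast
  show "adjoin R A w \<subseteq> B" if "ideal B R" "A \<subseteq> B" "w \<in> B" for B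
    using that ideal_basic(3,5)[OF that(1)] by (auto simp: adjoin_def)
qed

lemma adjoin_mono: "A \<subseteq> B \<Longrightarrow> adjoin R A w \<subseteq> adjoin R B w"
  unfolding adjoin_def by blast

lemma adjoin_commute:
  assumes "ideal A R" "x \<in> carrier R" "w \<in> carrier R"
  shows "adjoin R (adjoin R A x) w = adjoin R (adjoin R A w) x"
proof -
  have "adjoin R (adjoin R A x) w \<subseteq> adjoin R (adjoin R A w) x"
    if "x \<in> carrier R" "w \<in> carrier R" for x w
  proof (rule adjoin_basic(3))
    note w = adjoin_ideal[OF assms(1) that(2)] adjoin_basic[OF assms(1) that(2)]
    show "ideal (adjoin R A x) R" using adjoin_ideal assms(1) that by blast
    show "ideal (adjoin R (adjoin R A w) x) R" using adjoin_ideal w(1) that by blast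
    show "adjoin R A x \<subseteq> adjoin R (adjoin R A w) x" by (rule adjoin_mono) (rule w(2))
    show "w \<in> adjoin R (adjoin R A w) x" using adjoin_basic(1)[OF w(1) that(1)] w(3) by blast
  qed (rule that)
  then show ?thesis using assms by blast
qed

lemma adjs_ideal: "\<lbrakk>ideal A R; set xs \<subseteq> carrier R\<rbrakk> \<Longrightarrow> ideal (adjs R A xs) R"
  by (induction xs arbitrary: A) (auto simp: adjoin_ideal)

lemma adjs_basic:
  assumes "ideal A R" "set xs \<subseteq> carrier R"
  shows "A \<subseteq> adjs R A xs" "set xs \<subseteq> adjs R A xs"
    "\<And>B. \<lbrakk>ideal B R; A \<subseteq> B; set xs \<subseteq> B\<rbrakk> \<Longrightarrow> adjs R A xs \<subseteq> B"
proof -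
  have "A \<subseteq> adjs R A xs \<and> set xs \<subseteq> adjs R A xs \<and>
    (\<forall>B. ideal B R \<longrightarrow> A \<subseteq> B \<longrightarrow> set xs \<subseteq> B \<longrightarrow> adjs R A xs \<subseteq> B)"
    using assms
  proof (induction xs arbitrary: A)
    case (Cons x xs)
    then show ?case
      using adjoin_basic[of A x] adjoin_ideal[of A x] by simp (meson subset_iff)
  qed auto
  then show "A \<subseteq> adjs R A xs" "set xs \<subseteq> adjs R A xs"
    "\<And>B. \<lbrakk>ideal B R; A \<subseteq> B; set xs \<subseteq> B\<rbrakk> \<Longrightarrow> adjs R A xs \<subseteq> B" by auto
qed

text \<open>Moves the element adjoined first to the last place; the exchange of regular sequences
  replaces a last element but inducts over the base ideal.\<close>

lemma adjs_adjoin: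
  assumes "ideal A R" "set xs \<subseteq> carrier R" "w \<in> carrier R"
  shows "adjs R (adjoin R A w) xs = adjoin R (adjs R A xs) w"
  using assms by (induction xs arbitrary: A) (auto simp: adjoin_commute adjoin_ideal)

lemma adjs_zero_eq_genideal:
  assumes "set xs \<subseteq> carrier R"
  shows "adjs R {\<zero>} xs = Idl (set xs)"
proof (rule antisym)
  show "adjs R {\<zero>} xs \<subseteq> Idl (set xs)"
    using assms genideal_ideal genideal_self[OF assms] ideal_basic(2)[OF genideal_ideal[OF assms]]
    by (intro adjs_basic(3)[OF zeroideal]) auto
  show "Idl (set xs) \<subseteq> adjs R {\<zero>} xs"
    using assms adjs_ideal[OF zeroideal] adjs_basic[OF zeroideal] by (intro genideal_minimal) auto
qed

lemma regs_append: "regular_seq_at R P A (xs @ ys) \<longleftrightarrow> regular_seq_at R P A xs \<and> regular_seq_at R P (adjs R A xs) ys"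
  by (induction xs arbitrary: A) auto

lemma regs_iff_nth:
  "regular_seq_at R P A xs \<longleftrightarrow> (\<forall>i<length xs. regular_at R P (adjs R A (take i xs)) (xs ! i))"
proof (induction xs rule: rev_induct)
  case (snoc x xs)
  then show ?case by (auto simp: regs_append less_Suc_eq nth_append)
qed auto

text \<open>The multiplier \<open>s\<close> outside \<open>P\<close> may well lie in
  \<open>M\<close>, so it is moved onto \<open>a\<close> before regularity at \<open>M\<close> is
  applied, and cancelled at \<open>P\<close> afterwards.\<close>

lemma reg_prime_antimono:
  assumes "primeideal P R" "primeideal M R" "A \<subseteq> carrier R" "P \<subseteq> M" "w \<in> carrier R" "regular_at R M A w"
  shows "regular_at R P A w"
  unfolding regular_at_def
proof (intro ballI impI)
  fix a assume a: "a \<in> carrier R" "w \<otimes> a \<in> sat R P A"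
  then obtain s where s: "s \<in> carrier R" "s \<notin> P" "s \<otimes> (w \<otimes> a) \<in> A" by (metis satE)
  have "w \<otimes> (s \<otimes> a) = s \<otimes> (w \<otimes> a)" using a s assms by algebra
  then have "w \<otimes> (s \<otimes> a) \<in> sat R M A" using s subset_sat[OF assms(2,3)] by auto
  then have "s \<otimes> a \<in> sat R P A"
    using assms a s sat_antimono unfolding regular_at_def by (metis m_closed subsetD)
  then show "a \<in> sat R P A"
    using sat_cancel[OF assms(1)] a s by blast
qed

lemma regs_prime_antimono:
  assumes "primeideal P R" "primeideal M R" "ideal A R" "P \<subseteq> M" "set xs \<subseteq> carrier R"
    "regular_seq_at R M A xs"
  shows "regular_seq_at R P A xs"
  using assms(3,5,6)
proof (induction xs arbitrary: A)
  case (Cons x xs)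
  then show ?case
    using reg_prime_antimono[OF assms(1,2) _ assms(4), of A x] ideal_basic(1)[of A] adjoin_ideal
    by simp
qed simp

end

section \<open>Existence and finiteness of associated primes\<close>

context noetherian_cring
begin

text \<open>Zorn's lemma applies because in a Noetherian ring a nonempty chain of ideals contains
  its own union.\<close>

lemma exists_maximal_ideal_in:
  assumes "C \<noteq> {}" "\<And>A. A \<in> C \<Longrightarrow> ideal A R"
  shows "\<exists>A\<in>C. \<forall>B\<in>C. A \<subseteq> B \<longrightarrow> B = A"
proof (rule subset_Zorn_nonempty[OF assms(1)])
  fix D assume D: "D \<noteq> {}" "subset.chain C D"
  have DC: "D \<subseteq> C" using D(2) by (simp add: pred_on.chain_def)
  have "subset.chain {I. ideal I R} D"
    using D(2) DC assms(2) by (auto simp: pred_on.chain_def)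
  then have "\<Union>D \<in> D" by (rule ideal_chain_is_trivial[OF D(1)])
  then show "\<Union>D \<in> C" using DC by blast
qed

lemma ideal_noetherian_induct [consumes 1, case_names step]:
  assumes "ideal A R"
    and "\<And>A. \<lbrakk>ideal A R; \<And>B. \<lbrakk>ideal B R; A \<subset> B\<rbrakk> \<Longrightarrow> Q B\<rbrakk> \<Longrightarrow> Q A"
  shows "Q A"
proof (rule ccontr)
  assume "\<not> Q A"
  then obtain B where "ideal B R" "\<not> Q B" "\<And>C. \<lbrakk>ideal C R; \<not> Q C; B \<subseteq> C\<rbrakk> \<Longrightarrow> C = B"
    using exists_maximal_ideal_in[of "{A. ideal A R \<and> \<not> Q A}"] assms(1) by blast
  then show False using assms(2)[of B] by blast
qed

text \<open>A maximal element among the proper ideals \<open>colon R A b\<close> is prime: if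
  \<open>x b\<close> is not in \<open>A\<close>, then \<open>colon R A (x \<otimes> b)\<close>
  contains \<open>colon R A b\<close>, equals it by maximality, and contains every \<open>y\<close>
  with \<open>x y\<close> in the latter. Only colon ideals above \<open>colon R A a\<close> compete,
  which places the prime above that ideal.\<close>

lemma ex_assprime:
  assumes A: "ideal A R" and a: "a \<in> carrier R" "a \<notin> A"
  shows "\<exists>p\<in>assprimes R A. colon R A a \<subseteq> p"
proof -
  let ?C = "{colon R A b | b. b \<in> carrier R \<and> b \<notin> A \<and> colon R A a \<subseteq> colon R A b}"
  have "\<exists>p\<in>?C. \<forall>B\<in>?C. p \<subseteq> B \<longrightarrow> B = p"
    by (rule exists_maximal_ideal_in) (use a colon_ideal[OF A] in auto)
  then obtain p where p: "p \<in> ?C" "\<And>B. \<lbrakk>B \<in> ?C; p \<subseteq> B\<rbrakk> \<Longrightarrow> B = p"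
    by meson
  from p(1) obtain b where b: "b \<in> carrier R" "b \<notin> A" "colon R A a \<subseteq> colon R A b" "p = colon R A b"
    by auto
  have max: "colon R A c = colon R A b"
    if c: "c \<in> carrier R" "c \<notin> A" "colon R A b \<subseteq> colon R A c" for c
  proof -
    have "colon R A c \<in> ?C" using c b(3) by auto
    then show ?thesis using p(2) c(3) b(4) by simp
  qed
  note i = ideal_basic[OF A]
  have "primeideal (colon R A b) R"
  proof (rule primeideal_of_basic[OF colon_ideal[OF A b(1)]])
    show "\<one> \<notin> colon R A b" using b by (simp add: mem_colon)
    fix x y assume *: "x \<in> carrier R" "y \<in> carrier R" "x \<otimes> y \<in> colon R A b" "x \<notin> colon R A b"
    then have 1: "x \<otimes> b \<notin> A" "x \<otimes> b \<in> carrier R" using b by (auto simp: mem_colon)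
    have "colon R A b \<subseteq> colon R A (x \<otimes> b)"
    proof
      fix r assume "r \<in> colon R A b"
      then have r: "r \<in> carrier R" "r \<otimes> b \<in> A" by (auto simp: mem_colon)
      then have "x \<otimes> (r \<otimes> b) \<in> A" using i(5) *(1) by blast
      then show "r \<in> colon R A (x \<otimes> b)"
        using m_lcomm[OF r(1) *(1) b(1)] r by (simp add: mem_colon)
    qed
    then have "colon R A (x \<otimes> b) = colon R A b" using max 1 by blast
    moreover have "y \<in> colon R A (x \<otimes> b)"
      using * b(1) m_lcomm[of y x b] m_assoc[of x y b] by (simp add: mem_colon)
    ultimately show "y \<in> colon R A b" by simp
  qed
  then show ?thesis using b unfolding assprimes_def by blast
qed

text \<open>Noetherian induction through one associated prime \<open>p = (A : a)\<close>: every
  other associated prime of \<open>A\<close> is associated to the larger ideal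
  \<open>A + R a\<close>, because \<open>A + R a\<close> modulo \<open>A\<close> is a copy of
  \<open>R / p\<close> and contributes only \<open>p\<close>.\<close>

lemma finite_assprimes:
  assumes "ideal A R"
  shows "finite (assprimes R A)"
  using assms
proof (induction rule: ideal_noetherian_induct)
  case (step A)
  note i = ideal_basic[OF step(1)]
  show ?case
  proof (cases "assprimes R A = {}")
    case False
    then obtain p a where p: "primeideal p R" and a: "a \<in> carrier R" "p = colon R A a"
      unfolding assprimes_def by blast
    let ?B = "adjoin R A a"
    have "a \<notin> A" using primeideal_basic(2)[OF p] a by (auto simp: mem_colon)
    then have "A \<subset> ?B" using adjoin_basic[OF step(1) a(1)] by blast
    then have fin: "finite (assprimes R ?B)"
      using step(2) adjoin_ideal[OF step(1) a(1)] by blast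
    have "assprimes R A \<subseteq> insert p (assprimes R ?B)"
    proof
      fix q assume "q \<in> assprimes R A"
      then obtain y where q: "primeideal q R" and y: "y \<in> carrier R" "q = colon R A y"
        unfolding assprimes_def by blast
      show "q \<in> insert p (assprimes R ?B)"
      proof (cases "\<exists>r\<in>carrier R. r \<otimes> y \<in> ?B \<and> r \<otimes> y \<notin> A")
        case True
        then obtain r b t where r: "r \<in> carrier R" "r \<otimes> y \<notin> A" "b \<in> A" "t \<in> carrier R"
          "r \<otimes> y = b \<oplus> t \<otimes> a" unfolding mem_adjoin by blast
        have rq: "r \<notin> q" using r y by (auto simp: mem_colon)
        have ta: "t \<otimes> a \<notin> A" using r i(3) by auto
        then have tp: "t \<notin> p" using a r by (auto simp: mem_colon)
        \<comment> \<open>Modulo \<open>A\<close>, the multiple \<open>r y\<close> equals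
          \<open>t a\<close>. Since \<open>r\<close> is not in \<open>q\<close> and \<open>t\<close>
          is not in \<open>p\<close>, this common element has annihilator \<open>q\<close> as well
          as \<open>p\<close>.\<close>
        have "u \<in> q \<longleftrightarrow> u \<in> p" if u: "u \<in> carrier R" for u
        proof -
          have "u \<in> q \<longleftrightarrow> u \<otimes> r \<in> q"
            using rq u r(1) primeideal_basic(5)[OF q] ideal_basic(6)[OF primeideal_basic(1)[OF q]] by blast
          also have "\<dots> \<longleftrightarrow> u \<otimes> (r \<otimes> y) \<in> A" using u r y by (simp add: mem_colon m_assoc)
          also have "\<dots> \<longleftrightarrow> u \<otimes> b \<oplus> u \<otimes> (t \<otimes> a) \<in> A"
            using u r y a i(7) by (simp add: r_distr)
          also have "\<dots> \<longleftrightarrow> u \<otimes> (t \<otimes> a) \<in> A"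
          proof
            assume *: "u \<otimes> b \<oplus> u \<otimes> (t \<otimes> a) \<in> A"
            have "u \<otimes> (t \<otimes> a) = (u \<otimes> b \<oplus> u \<otimes> (t \<otimes> a)) \<ominus> u \<otimes> b"
              using u r a i(7) by algebra
            then show "u \<otimes> (t \<otimes> a) \<in> A"
              using i(8)[OF * i(5)[OF r(3) u]] by simp
          next
            show "u \<otimes> (t \<otimes> a) \<in> A \<Longrightarrow> u \<otimes> b \<oplus> u \<otimes> (t \<otimes> a) \<in> A"
              using u r i(3,5) by simp
          qed
          also have "\<dots> \<longleftrightarrow> u \<otimes> t \<in> p" using u r a by (simp add: mem_colon m_assoc)
          also have "\<dots> \<longleftrightarrow> u \<in> p"
            using tp u r(4) primeideal_basic(5)[OF p] ideal_basic(6)[OF primeideal_basic(1)[OF p]] by blast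
          finally show ?thesis .
        qed
        then have "q = p"
          using primeideal_basic(4)[OF p] primeideal_basic(4)[OF q] by blast
        then show ?thesis by simp
      next
        case False
        then have "q = colon R ?B y"
          using y adjoin_basic(1)[OF step(1) a(1)] by (auto simp: mem_colon)
        then show ?thesis using q y unfolding assprimes_def by blast
      qed
    qed
    then show ?thesis using fin finite_subset by blast
  qed auto
qed

end

section \<open>Prime avoidance for ideals and for cosets\<close>

context cring
begin

text \<open>A product of one element of \<open>J\<close> and one of each \<open>p\<close>, all
  chosen outside \<open>Q\<close>, stays outside \<open>Q\<close>.\<close>

lemma prime_prod_notin:
  assumes "primeideal Q R" "finite F" "\<And>p. p \<in> F \<Longrightarrow> ideal p R \<and> \<not> p \<subseteq> Q"
    "ideal J R" "\<not> J \<subseteq> Q"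
  shows "\<exists>t\<in>J. t \<notin> Q \<and> (\<forall>p\<in>F. t \<in> p)"
  using assms(2,3)
proof (induction F)
  case empty
  then show ?case using assms(5) by auto
next
  case (insert p F)
  then obtain t where t: "t \<in> J" "t \<notin> Q" "\<forall>p\<in>F. t \<in> p" by auto
  obtain u where u: "u \<in> p" "u \<notin> Q" using insert by blast
  have uc: "u \<in> carrier R" "t \<in> carrier R" using u t insert.prems ideal_basic(7) assms(4) by blast+
  then have "u \<otimes> t \<notin> Q" using primeideal_basic(5)[OF assms(1)] u t by blast
  moreover have "u \<otimes> t \<in> J" using ideal_basic(5)[OF assms(4)] t uc by blast
  moreover have "\<forall>p'\<in>insert p F. u \<otimes> t \<in> p'"
    using insert.prems t u uc ideal_basic(5,6) by (metis insert_iff)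
  ultimately show ?case by blast
qed

text \<open>The induction removes a minimal member \<open>Q\<close> of \<open>F\<close>. If
  \<open>x + j\<close> avoids the others but lies in \<open>Q\<close>, adding some \<open>t\<close>
  that lies in \<open>J\<close> and in all the others but not in \<open>Q\<close> repairs
  \<open>Q\<close> without harming the rest; minimality of \<open>Q\<close> is what makes such a
  \<open>t\<close> exist.\<close>

lemma coset_prime_avoidance:
  assumes "finite F" "\<And>p. p \<in> F \<Longrightarrow> primeideal p R" "ideal J R" "x \<in> carrier R"
    "\<And>p. \<lbrakk>p \<in> F; x \<in> p\<rbrakk> \<Longrightarrow> \<not> J \<subseteq> p"
  shows "\<exists>j\<in>J. \<forall>p\<in>F. x \<oplus> j \<notin> p"
  using assms(1,2,5)
proof (induction "card F" arbitrary: F)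
  case 0
  then show ?case using ideal_basic(2)[OF assms(3)] by auto
next
  case (Suc n)
  note jj = ideal_basic[OF assms(3)]
  obtain Q where Q: "Q \<in> F" "\<And>p. \<lbrakk>p \<in> F; p \<subseteq> Q\<rbrakk> \<Longrightarrow> p = Q"
    using finite_has_minimal[of F] Suc by fastforce
  let ?G = "F - {Q}"
  obtain j where j: "j \<in> J" "\<forall>p\<in>?G. x \<oplus> j \<notin> p"
    using Suc.hyps(1)[of ?G] Suc.hyps(2) Suc.prems Q by fastforce
  have pQ: "primeideal Q R" using Suc.prems Q by blast
  note iQ = ideal_basic[OF primeideal_basic(1)[OF pQ]]
  have jc: "j \<in> carrier R" using j jj by blast
  show ?case
  proof (cases "x \<oplus> j \<in> Q")
    case False
    then show ?thesis using j by blast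
  next
    case True
    have "\<not> J \<subseteq> Q"
    proof
      assume "J \<subseteq> Q"
      then have "(x \<oplus> j) \<ominus> j \<in> Q" using True j iQ(8) by blast
      moreover have "(x \<oplus> j) \<ominus> j = x" using jc assms(4) by algebra
      ultimately show False using Suc.prems(3)[OF Q(1)] \<open>J \<subseteq> Q\<close> by simp
    qed
    then obtain t where t: "t \<in> J" "t \<notin> Q" "\<forall>p\<in>?G. t \<in> p"
      using prime_prod_notin[OF pQ, of ?G J] Suc.prems Q assms(3) primeideal_basic(1) by blast
    have tc: "t \<in> carrier R" using t jj by blast
    have eq: "x \<oplus> (j \<oplus> t) = (x \<oplus> j) \<oplus> t" "(x \<oplus> j \<oplus> t) \<ominus> t = x \<oplus> j"
      "(x \<oplus> j \<oplus> t) \<ominus> (x \<oplus> j) = t"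
      using jc tc assms(4) by algebra+
    have "x \<oplus> (j \<oplus> t) \<notin> p" if p: "p \<in> F" for p
    proof -
      have pp: "ideal p R" using Suc.prems p primeideal_basic(1) by blast
      note ip = ideal_basic(8)[OF pp]
      show ?thesis
      proof (cases "p = Q")
        case True2: True
        then show ?thesis using ip[of "x \<oplus> j \<oplus> t" "x \<oplus> j"] eq t True by auto
      next
        case False
        then show ?thesis using ip[of "x \<oplus> j \<oplus> t" t] eq t j p by auto
      qed
    qed
    then show ?thesis using jj(3)[OF j(1) t(1)] by auto
  qed
qed

lemma prime_avoidance:
  assumes "finite F" "\<And>p. p \<in> F \<Longrightarrow> primeideal p R" "ideal J R" "\<And>p. p \<in> F \<Longrightarrow> \<not> J \<subseteq> p"
  shows "\<exists>j\<in>J. \<forall>p\<in>F. j \<notin> p"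
  using coset_prime_avoidance[OF assms(1-3) zero_closed] assms(4) ideal_basic(7)[OF assms(3)]
  by fastforce

end

section \<open>Regular sequences in local rings\<close>

context cring
begin

lemma regE:
  assumes "regular_at R P A w" "primeideal P R" "A \<subseteq> carrier R" "a \<in> carrier R" "w \<otimes> a \<in> A"
  obtains v where "v \<in> carrier R" "v \<notin> P" "v \<otimes> a \<in> A"
proof -
  have "a \<in> sat R P A" using assms subset_sat unfolding regular_at_def by blast
  then show thesis using that by (metis satE)
qed

lemma sat_adjoinE:
  assumes "b \<in> sat R P (adjoin R A x)"
  obtains s a r where "s \<in> carrier R" "s \<notin> P" "a \<in> A" "r \<in> carrier R" "s \<otimes> b = a \<oplus> r \<otimes> x"
  using assms by (auto simp: adjoin_def elim!: satE)

lemma sat_adjoinI: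
  assumes "b \<in> carrier R" "s \<in> carrier R" "s \<notin> P" "a \<in> A" "r \<in> carrier R" "s \<otimes> b = a \<oplus> r \<otimes> x"
  shows "b \<in> sat R P (adjoin R A x)"
  using assms by (intro satI[of b s]) (auto simp: adjoin_def)

end

section \<open>Associated primes after localization and the exchange of regular sequences\<close>

context noetherian_cring
begin

lemma mem_if_eq_colon: "p = colon R B b \<Longrightarrow> r \<in> p \<longleftrightarrow> r \<in> carrier R \<and> r \<otimes> b \<in> B"
  by (simp add: mem_colon)

lemma subset_assprime:
  assumes "ideal A R" "p \<in> assprimes R A"
  shows "A \<subseteq> p"
  using assms(2) ideal_basic(6,7)[OF assms(1)] unfolding assprimes_def colon_def by blast

lemma assprime_sat_subset:
  assumes P: "primeideal P R" and p: "p \<in> assprimes R (sat R P A)"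
  shows "p \<subseteq> P"
proof -
  obtain a where a: "primeideal p R" "a \<in> carrier R" "p = colon R (sat R P A) a"
    using p unfolding assprimes_def by blast
  note m = mem_if_eq_colon[OF a(3)]
  have "a \<notin> sat R P A"
    using primeideal_basic(2)[OF a(1)] a(2) m[of \<one>] by simp
  then show ?thesis
    using sat_cancel[OF P a(2)] m by blast
qed

text \<open>Over a local ring, a nonzero element killed by the maximal ideal has exactly this ideal
  as annihilator, since the elements outside \<open>P\<close> act as units.\<close>

lemma assprime_satI:
  assumes P: "primeideal P R" and b: "b \<in> carrier R" "b \<notin> sat R P A"
    "\<And>r. r \<in> P \<Longrightarrow> r \<otimes> b \<in> sat R P A"
  shows "P \<in> assprimes R (sat R P A)"
proof -
  have "colon R (sat R P A) b = P"
    unfolding colon_def using b(3) primeideal_basic(4)[OF P] sat_cancel[OF P b(1)] b(2) by blast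
  then show ?thesis using P b(1) unfolding assprimes_def by blast
qed

lemma assprime_satD:
  assumes "P \<in> assprimes R (sat R P A)"
  obtains b where "b \<in> carrier R" "b \<notin> sat R P A" "\<And>r. r \<in> P \<Longrightarrow> r \<otimes> b \<in> sat R P A"
proof -
  obtain b where b: "primeideal P R" "b \<in> carrier R" "P = colon R (sat R P A) b"
    using assms unfolding assprimes_def by blast
  note m = mem_if_eq_colon[OF b(3)]
  have "b \<notin> sat R P A" using primeideal_basic(2)[OF b(1)] b(2) m[of \<one>] by simp
  then show thesis using that[of b] b(2) m by blast
qed

text \<open>Clearing denominators: each of the finitely many generators of \<open>P\<close> needs
  its own multiplier to push its product with \<open>b\<close> into \<open>A\<close>, and the
  product \<open>s\<close> of these multipliers turns \<open>b\<close> into the witness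
  \<open>s b\<close>.\<close>

lemma assprime_of_sat:
  assumes P: "primeideal P R" and A: "ideal A R" and ass: "P \<in> assprimes R (sat R P A)"
  shows "P \<in> assprimes R A"
proof -
  obtain b where b: "b \<in> carrier R" "b \<notin> sat R P A" "\<And>r. r \<in> P \<Longrightarrow> r \<otimes> b \<in> sat R P A"
    using assprime_satD[OF ass] by metis
  obtain X where X: "X \<subseteq> carrier R" "finite X" "P = Idl X"
    using finetely_gen[OF primeideal_basic(1)[OF P]] by blast
  have "\<exists>s\<in>carrier R. s \<notin> P \<and> (\<forall>x\<in>Y. s \<otimes> (x \<otimes> b) \<in> A)" if "finite Y" "Y \<subseteq> P" for Y
    using that
  proof (induction Y)
    case empty
    then show ?case using primeideal_basic(2)[OF P] by auto
  next
    case (insert x Y)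
    then obtain s where s: "s \<in> carrier R" "s \<notin> P" "\<forall>x\<in>Y. s \<otimes> (x \<otimes> b) \<in> A" by auto
    obtain t where t: "t \<in> carrier R" "t \<notin> P" "t \<otimes> (x \<otimes> b) \<in> A"
      using b(3)[of x] insert.prems by (auto elim: satE)
    have "(t \<otimes> s) \<otimes> (y \<otimes> b) \<in> A" if y: "y \<in> insert x Y" for y
    proof -
      have yc: "y \<in> carrier R" using y insert.prems primeideal_basic(4)[OF P] by blast
      show ?thesis
      proof (cases "y = x")
        case True
        have "(t \<otimes> s) \<otimes> (y \<otimes> b) = s \<otimes> (t \<otimes> (y \<otimes> b))" using t s yc b(1) by algebra
        then show ?thesis using True t(3) s(1) ideal_basic(5)[OF A] by simp
      next
        case False
        have "(t \<otimes> s) \<otimes> (y \<otimes> b) = t \<otimes> (s \<otimes> (y \<otimes> b))" using t s yc b(1) by algebra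
        then show ?thesis using False y s(3) t(1) ideal_basic(5)[OF A] by auto
      qed
    qed
    moreover have "t \<otimes> s \<notin> P" using primeideal_basic(5)[OF P] s t by blast
    ultimately show ?case using s(1) t(1) by blast
  qed
  from this[OF X(2)] X obtain s where s: "s \<in> carrier R" "s \<notin> P" "\<forall>x\<in>X. s \<otimes> (x \<otimes> b) \<in> A"
    using genideal_self[OF X(1)] by auto
  have sb: "s \<otimes> b \<in> carrier R" using s b by simp
  have "X \<subseteq> colon R A (s \<otimes> b)"
    using s X(1) b(1) by (auto simp: mem_colon m_lcomm subset_iff)
  then have "P \<subseteq> colon R A (s \<otimes> b)"
    unfolding X(3) by (rule genideal_minimal[OF colon_ideal[OF A sb]])
  moreover have "r \<in> P" if "r \<in> colon R A (s \<otimes> b)" for r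
  proof (rule ccontr)
    assume "r \<notin> P"
    have r: "r \<in> carrier R" "(r \<otimes> s) \<otimes> b \<in> A" using that s b by (auto simp: mem_colon m_assoc)
    then show False
      using satI[of b "r \<otimes> s" P A] b primeideal_basic(5)[OF P _ s(1) \<open>r \<notin> P\<close> s(2)] s by simp
  qed
  ultimately have "P = colon R A (s \<otimes> b)" by blast
  then show ?thesis using P sb unfolding assprimes_def by blast
qed

lemma assprime_if_not_reg:
  assumes P: "primeideal P R" and A: "ideal A R" and w: "w \<in> carrier R" "\<not> regular_at R P A w"
  shows "\<exists>p\<in>assprimes R (sat R P A). w \<in> p"
proof -
  obtain a where a: "a \<in> carrier R" "w \<otimes> a \<in> sat R P A" "a \<notin> sat R P A"
    using w(2) unfolding regular_at_def by blast
  then have "w \<in> colon R (sat R P A) a" using w by (simp add: mem_colon)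
  then show ?thesis using ex_assprime[OF sat_ideal[OF P A] a(1,3)] by blast
qed

lemma reg_notin_assprime:
  assumes "p \<in> assprimes R (sat R P A)" "regular_at R P A w"
  shows "w \<notin> p"
proof -
  obtain a where a: "primeideal p R" "a \<in> carrier R" "p = colon R (sat R P A) a"
    using assms unfolding assprimes_def by blast
  note m = mem_if_eq_colon[OF a(3)]
  have "a \<notin> sat R P A" using primeideal_basic(2)[OF a(1)] a(2) m[of \<one>] by simp
  then show ?thesis using assms(2) a(2) m unfolding regular_at_def by blast
qed

text \<open>Avoids the finitely many associated primes of all these ideals at once. They lie inside
  \<open>P\<close>, so one containing \<open>P\<close> would be \<open>P\<close> itself, which is
  excluded.\<close>

lemma ex_common_reg:
  assumes P: "primeideal P R" and fin: "finite \<A>"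
    and \<A>: "\<And>A. A \<in> \<A> \<Longrightarrow> ideal A R" "\<And>A. A \<in> \<A> \<Longrightarrow> P \<notin> assprimes R (sat R P A)"
  shows "\<exists>w\<in>P. \<forall>A\<in>\<A>. regular_at R P A w"
proof -
  let ?F = "\<Union>A\<in>\<A>. assprimes R (sat R P A)"
  have "\<exists>w\<in>P. \<forall>p\<in>?F. w \<notin> p"
  proof (rule prime_avoidance)
    show "finite ?F" using fin \<A>(1) finite_assprimes[OF sat_ideal[OF P]] by blast
    show "primeideal p R" if "p \<in> ?F" for p using that unfolding assprimes_def by blast
    show "ideal P R" by (rule primeideal_basic(1)[OF P])
    show "\<not> P \<subseteq> p" if "p \<in> ?F" for p
      using that \<A>(2) assprime_sat_subset[OF P] by (metis UN_E subset_antisym)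
  qed
  then obtain w where w: "w \<in> P" "\<And>p A. \<lbrakk>A \<in> \<A>; p \<in> assprimes R (sat R P A)\<rbrakk> \<Longrightarrow> w \<notin> p"
    by auto
  have wc: "w \<in> carrier R" using w(1) primeideal_basic(4)[OF P] by blast
  have "regular_at R P A w" if "A \<in> \<A>" for A
    using assprime_if_not_reg[OF P \<A>(1)[OF that] wc] w(2)[OF that] by blast
  then show ?thesis using w(1) by blast
qed

text \<open>An elementary form of the isomorphism between the socles of \<open>R / (A, x)\<close>
  and \<open>R / (A, z)\<close> in the local ring. A socle element \<open>b\<close> satisfies
  \<open>z b = b' x\<close> modulo \<open>A\<close> up to a multiplier, and \<open>b'\<close> is its
  partner: cancelling \<open>z\<close> shows that \<open>b'\<close> is nonzero modulo
  \<open>A\<close> and \<open>z\<close>, cancelling \<open>x\<close> shows that \<open>P\<close>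
  kills it there.\<close>

lemma assprime_adjoin_exchange:
  assumes P: "primeideal P R" and A: "ideal A R" and xz: "x \<in> P" "z \<in> P"
    and reg: "regular_at R P A x" "regular_at R P A z"
    and ass: "P \<in> assprimes R (sat R P (adjoin R A x))"
  shows "P \<in> assprimes R (sat R P (adjoin R A z))"
proof -
  note c = subsetD[OF primeideal_basic(4)[OF P]] ideal_basic(7)[OF A]
  note i = ideal_basic[OF A]
  have x: "x \<in> carrier R" and z: "z \<in> carrier R" using xz c by auto
  obtain b where b: "b \<in> carrier R" "b \<notin> sat R P (adjoin R A x)"
    "\<And>r. r \<in> P \<Longrightarrow> r \<otimes> b \<in> sat R P (adjoin R A x)"
    using assprime_satD[OF ass] by metis
  obtain s a b' where s: "s \<in> carrier R" "s \<notin> P" "a \<in> A" "b' \<in> carrier R"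
    "s \<otimes> (z \<otimes> b) = a \<oplus> b' \<otimes> x"
    using b(3)[OF xz(2)] by (rule sat_adjoinE)
  have ac: "a \<in> carrier R" using s c by blast
  show ?thesis
  proof (rule assprime_satI[OF P s(4)])
    show "b' \<notin> sat R P (adjoin R A z)"
    proof
      assume "b' \<in> sat R P (adjoin R A z)"
      then obtain t a' n where t: "t \<in> carrier R" "t \<notin> P" "a' \<in> A" "n \<in> carrier R"
        "t \<otimes> b' = a' \<oplus> n \<otimes> z" by (rule sat_adjoinE)
      have ac': "a' \<in> carrier R" using t c by blast
      have "z \<otimes> (t \<otimes> s \<otimes> b \<ominus> n \<otimes> x) = t \<otimes> (s \<otimes> (z \<otimes> b)) \<ominus> (n \<otimes> z) \<otimes> x"
        using s(1) t(1,4) b(1) x z by algebra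
      also have "\<dots> = t \<otimes> a \<oplus> (t \<otimes> b') \<otimes> x \<ominus> (n \<otimes> z) \<otimes> x"
        unfolding s(5) using s(1,4) t(1,4) b(1) x z ac by algebra
      also have "\<dots> = t \<otimes> a \<oplus> a' \<otimes> x"
        unfolding t(5) using s(1) t(1,4) b(1) x z ac ac' by algebra
      also have "\<dots> \<in> A" using i(3,5,6) s t x by simp
      finally obtain v where v: "v \<in> carrier R" "v \<notin> P" "v \<otimes> (t \<otimes> s \<otimes> b \<ominus> n \<otimes> x) \<in> A"
        using regE[OF reg(2) P i(1)] s t b x by (metis m_closed minus_closed)
      have eq: "(v \<otimes> t \<otimes> s) \<otimes> b = v \<otimes> (t \<otimes> s \<otimes> b \<ominus> n \<otimes> x) \<oplus> (v \<otimes> n) \<otimes> x"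
        using v(1) s(1) t(1,4) b(1) x by algebra
      have nP: "v \<otimes> t \<otimes> s \<notin> P" using v s t primeideal_basic(5)[OF P] by simp
      have "b \<in> sat R P (adjoin R A x)"
        by (rule sat_adjoinI[OF b(1) _ nP v(3) _ eq]) (use v(1) s(1) t(1,4) in simp_all)
      then show False using b(2) by blast
    qed
    show "r \<otimes> b' \<in> sat R P (adjoin R A z)" if r: "r \<in> P" for r
    proof -
      have rc: "r \<in> carrier R" using r c by blast
      obtain u d n where u: "u \<in> carrier R" "u \<notin> P" "d \<in> A" "n \<in> carrier R"
        "u \<otimes> (r \<otimes> b) = d \<oplus> n \<otimes> x"
        using b(3)[OF r] by (rule sat_adjoinE)
      have dc: "d \<in> carrier R" using u c by blast
      have "x \<otimes> (u \<otimes> r \<otimes> b' \<ominus> s \<otimes> z \<otimes> n) =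
          u \<otimes> r \<otimes> (a \<oplus> b' \<otimes> x) \<ominus> u \<otimes> r \<otimes> a \<ominus> s \<otimes> z \<otimes> (d \<oplus> n \<otimes> x) \<oplus> s \<otimes> z \<otimes> d"
        using x z u(1,4) rc s(1,4) ac dc by algebra
      also have "\<dots> = s \<otimes> z \<otimes> d \<ominus> u \<otimes> r \<otimes> a"
        unfolding s(5)[symmetric] u(5)[symmetric]
        using x z u(1,4) rc s(1,4) ac dc b(1) by algebra
      also have "\<dots> \<in> A" using i(5,8) s(1,3) u(1,3) z rc by simp
      finally obtain v where v: "v \<in> carrier R" "v \<notin> P"
        "v \<otimes> (u \<otimes> r \<otimes> b' \<ominus> s \<otimes> z \<otimes> n) \<in> A"
        using regE[OF reg(1) P i(1)] s(1,4) u(1,4) rc z by (metis m_closed minus_closed)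
      have eq: "(v \<otimes> u) \<otimes> (r \<otimes> b') =
          v \<otimes> (u \<otimes> r \<otimes> b' \<ominus> s \<otimes> z \<otimes> n) \<oplus> (v \<otimes> s \<otimes> n) \<otimes> z"
        using v(1) u(1,4) s(1,4) rc z by algebra
      have nP: "v \<otimes> u \<notin> P" using v u primeideal_basic(5)[OF P] by simp
      show ?thesis
        by (rule sat_adjoinI[OF _ _ nP v(3) _ eq]) (use v(1) s(1,4) u(1,4) rc in simp_all)
    qed
  qed
qed

text \<open>Half of permuting a regular sequence of two elements. From \<open>x a = e + r w\<close>
  one reads \<open>w r = 0\<close> modulo \<open>A\<close> and \<open>x\<close>, so \<open>r\<close>
  is a multiple \<open>u x\<close> modulo \<open>A\<close>, and cancelling \<open>x\<close> leaves
  \<open>a = u w\<close> modulo \<open>A\<close>, all up to multipliers.\<close>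

lemma reg_adjoin_swap:
  assumes P: "primeideal P R" and A: "ideal A R" and xw: "x \<in> carrier R" "w \<in> carrier R"
    and reg: "regular_at R P A x" "regular_at R P (adjoin R A x) w"
  shows "regular_at R P (adjoin R A w) x"
  unfolding regular_at_def
proof (intro ballI impI)
  note i = ideal_basic[OF A]
  fix a assume a: "a \<in> carrier R" "x \<otimes> a \<in> sat R P (adjoin R A w)"
  from a(2) obtain s e r where s: "s \<in> carrier R" "s \<notin> P" "e \<in> A" "r \<in> carrier R"
    "s \<otimes> (x \<otimes> a) = e \<oplus> r \<otimes> w" by (rule sat_adjoinE)
  have ec: "e \<in> carrier R" using s i by blast
  have "w \<otimes> r = (e \<oplus> r \<otimes> w) \<ominus> e" using ec s(4) xw by algebra
  also have "\<dots> = \<ominus> e \<oplus> (s \<otimes> a) \<otimes> x"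
    unfolding s(5)[symmetric] using ec s(1) xw a(1) by algebra
  also have "\<dots> \<in> adjoin R A x"
    unfolding mem_adjoin using i(4)[OF s(3)] s(1) a(1) m_closed by blast
  finally have "w \<otimes> r \<in> sat R P (adjoin R A x)"
    using subset_sat[OF P ideal_basic(1)[OF adjoin_ideal[OF A xw(1)]]] by blast
  then have "r \<in> sat R P (adjoin R A x)" using reg(2) s(4) unfolding regular_at_def by blast
  then obtain t e' u where t: "t \<in> carrier R" "t \<notin> P" "e' \<in> A" "u \<in> carrier R"
    "t \<otimes> r = e' \<oplus> u \<otimes> x" by (rule sat_adjoinE)
  have ec': "e' \<in> carrier R" using t i by blast
  have "x \<otimes> (t \<otimes> s \<otimes> a \<ominus> u \<otimes> w) = t \<otimes> (s \<otimes> (x \<otimes> a)) \<ominus> u \<otimes> x \<otimes> w"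
    using s(1) t(1,4) a(1) xw by algebra
  also have "\<dots> = t \<otimes> e \<oplus> (t \<otimes> r) \<otimes> w \<ominus> u \<otimes> x \<otimes> w"
    unfolding s(5) using s(1,4) t(1,4) a(1) xw ec by algebra
  also have "\<dots> = t \<otimes> e \<oplus> e' \<otimes> w"
    unfolding t(5) using s(1) t(1,4) a(1) xw ec ec' by algebra
  also have "\<dots> \<in> A" using i(3,5,6) s t xw by simp
  finally obtain v where v: "v \<in> carrier R" "v \<notin> P" "v \<otimes> (t \<otimes> s \<otimes> a \<ominus> u \<otimes> w) \<in> A"
    using regE[OF reg(1) P i(1)] s t a xw by (metis m_closed minus_closed)
  have eq: "(v \<otimes> t \<otimes> s) \<otimes> a = v \<otimes> (t \<otimes> s \<otimes> a \<ominus> u \<otimes> w) \<oplus> (v \<otimes> u) \<otimes> w"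
    using v(1) s(1) t(1,4) a(1) xw by algebra
  have nP: "v \<otimes> t \<otimes> s \<notin> P" using v s t primeideal_basic(5)[OF P] by simp
  show "a \<in> sat R P (adjoin R A w)"
    by (rule sat_adjoinI[OF a(1) _ nP v(3) _ eq]) (use v(1) s(1) t(1,4) in simp_all)
qed

text \<open>Repeated swapping carries \<open>w\<close> to the front of \<open>xs\<close>. The swap
  past a member requires \<open>w\<close> to be regular behind it, hence the condition on all
  prefixes including \<open>xs\<close> itself.\<close>

lemma regs_adjoin:
  assumes "primeideal P R" "ideal A R" "set xs \<subseteq> carrier R" "w \<in> carrier R" "regular_seq_at R P A xs"
    "\<And>i. i \<le> length xs \<Longrightarrow> regular_at R P (adjs R A (take i xs)) w"
  shows "regular_seq_at R P (adjoin R A w) xs"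
  using assms(2,3,5,6)
proof (induction xs arbitrary: A)
  case (Cons x xs)
  have x: "x \<in> carrier R" using Cons by simp
  have r: "regular_at R P A w" "regular_at R P (adjoin R A x) w"
    using Cons.prems(4)[of 0] Cons.prems(4)[of 1] by simp_all
  have "regular_at R P (adjoin R A w) x"
    using reg_adjoin_swap[OF assms(1) Cons.prems(1) x assms(4)] Cons.prems(3) r by simp
  moreover have "regular_seq_at R P (adjoin R (adjoin R A x) w) xs"
    using Cons.IH[OF adjoin_ideal[OF Cons.prems(1) x]] Cons.prems(2,3) Cons.prems(4)[of "Suc _"]
    by simp
  ultimately show ?case
    using adjoin_commute[OF Cons.prems(1) x assms(4)] by simp
qed simp

text \<open>Extends \<open>assprime_adjoin_exchange\<close> by induction on the length: the last
  elements of both sequences are replaced by one common element \<open>w\<close>, which is then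
  moved to the front, and the shortened sequences are compared over \<open>A + R w\<close>.\<close>

lemma assprime_adjs_exchange:
  assumes P: "primeideal P R" and "ideal A R" "length xs = length zs"
    "set xs \<subseteq> P" "set zs \<subseteq> P" "regular_seq_at R P A xs" "regular_seq_at R P A zs"
    "P \<in> assprimes R (sat R P (adjs R A xs))"
  shows "P \<in> assprimes R (sat R P (adjs R A zs))"
  using assms(2-)
proof (induction "length xs" arbitrary: A xs zs)
  case 0
  then show ?case by simp
next
  case (Suc n)
  note Pc = primeideal_basic(4)[OF P]
  obtain xs' x where xs: "xs = xs' @ [x]" using Suc.hyps(2) by (metis length_Suc_conv_rev)
  obtain zs' z where zs: "zs = zs' @ [z]" using Suc.hyps(2) Suc.prems(2) by (metis length_Suc_conv_rev)
  have len: "length xs' = n" "length zs' = n" using Suc.hyps(2) Suc.prems(2) xs zs by auto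
  have xc: "set xs' \<subseteq> carrier R" "x \<in> carrier R" "set zs' \<subseteq> carrier R" "z \<in> carrier R"
    "x \<in> P" "z \<in> P" "set xs' \<subseteq> P" "set zs' \<subseteq> P"
    using Suc.prems(3,4) Pc xs zs by auto
  \<comment> \<open>All prefixes of the two shortened sequences. \<open>P\<close> is associated to
    none of them, because the next member of the original sequence lies in \<open>P\<close> and is
    regular there; hence a common \<open>w\<close> exists.\<close>
  let ?\<A> = "(\<lambda>i. adjs R A (take i xs')) ` {..n} \<union> (\<lambda>i. adjs R A (take i zs')) ` {..n}"
  have notass: "P \<notin> assprimes R (sat R P (adjs R A (take i ys')))"
    if "i \<le> n" "regular_seq_at R P A (ys' @ [y])" "set (ys' @ [y]) \<subseteq> P" "length ys' = n" for i ys' y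
  proof -
    have "regular_at R P (adjs R A (take i (ys' @ [y]))) ((ys' @ [y]) ! i)"
      using that(1,2,4) unfolding regs_iff_nth by simp
    moreover have "(ys' @ [y]) ! i \<in> P"
      using that(1,3,4) nth_mem[of i "ys' @ [y]"] by auto
    ultimately show ?thesis using reg_notin_assprime that(1,4) by fastforce
  qed
  have "\<exists>w\<in>P. \<forall>B\<in>?\<A>. regular_at R P B w"
  proof (rule ex_common_reg[OF P])
    fix B assume "B \<in> ?\<A>"
    then obtain i ys where i: "i \<le> n" "B = adjs R A (take i ys)" and ys: "ys \<in> {xs', zs'}"
      by auto
    have "set (take i ys) \<subseteq> carrier R"
      using set_take_subset[of i ys] ys xc(1,3) by blast
    then show "ideal B R" using adjs_ideal[OF Suc.prems(1)] i(2) by blast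
    show "P \<notin> assprimes R (sat R P B)"
    proof (cases "ys = xs'")
      case True
      then show ?thesis
        using notass[OF i(1) Suc.prems(5)[unfolded xs] Suc.prems(3)[unfolded xs] len(1)] i(2) by simp
    next
      case False
      then have "ys = zs'" using ys by simp
      then show ?thesis
        using notass[OF i(1) Suc.prems(6)[unfolded zs] Suc.prems(4)[unfolded zs] len(2)] i(2) by simp
    qed
  qed simp
  then obtain w where w: "w \<in> P" "\<And>i. i \<le> n \<Longrightarrow> regular_at R P (adjs R A (take i xs')) w"
    "\<And>i. i \<le> n \<Longrightarrow> regular_at R P (adjs R A (take i zs')) w" by auto
  have wc: "w \<in> carrier R" using w Pc by blast
  have ideals: "ideal (adjs R A xs') R" "ideal (adjs R A zs') R"
    using adjs_ideal[OF Suc.prems(1)] xc by auto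
  have wn: "regular_at R P (adjs R A xs') w" "regular_at R P (adjs R A zs') w"
    using w(2)[of n] w(3)[of n] len by auto
  have rs: "regular_seq_at R P A xs'" "regular_seq_at R P A zs'" "regular_at R P (adjs R A xs') x" "regular_at R P (adjs R A zs') z"
    using Suc.prems(5,6) xs zs by (auto simp: regs_append)
  have "P \<in> assprimes R (sat R P (adjoin R (adjs R A xs') w))"
    using assprime_adjoin_exchange[OF P ideals(1) xc(5) w(1) rs(3) wn(1)] Suc.prems(7) xs by simp
  then have "P \<in> assprimes R (sat R P (adjs R (adjoin R A w) xs'))"
    using adjs_adjoin[OF Suc.prems(1) xc(1) wc] by simp
  then have "P \<in> assprimes R (sat R P (adjs R (adjoin R A w) zs'))"
    using Suc.hyps(1)[of xs' "adjoin R A w" zs'] adjoin_ideal[OF Suc.prems(1) wc] len xc(7,8)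
      regs_adjoin[OF P Suc.prems(1) xc(1) wc rs(1)] regs_adjoin[OF P Suc.prems(1) xc(3) wc rs(2)] w(2,3)
    by simp
  then have "P \<in> assprimes R (sat R P (adjoin R (adjs R A zs') w))"
    using adjs_adjoin[OF Suc.prems(1) xc(3) wc] by simp
  then show ?case
    using assprime_adjoin_exchange[OF P ideals(2) w(1) xc(6) wn(2) rs(4)] zs by simp
qed

text \<open>The prefix of \<open>ys\<close> of the same length as \<open>zs\<close> still admits a
  regular element in \<open>P\<close>, namely \<open>ys ! length zs\<close>, so \<open>P\<close> is
  not associated to it. By exchange \<open>P\<close> is not associated to the ideal of
  \<open>zs\<close> either.\<close>

lemma regs_extend:
  assumes P: "primeideal P R" and A: "ideal A R" and "length zs < length ys"
    "set zs \<subseteq> P" "set ys \<subseteq> P" "regular_seq_at R P A zs" "regular_seq_at R P A ys"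
  shows "\<exists>w\<in>P. regular_at R P (adjs R A zs) w"
proof -
  let ?n = "length zs"
  have Pc: "set zs \<subseteq> carrier R" using assms primeideal_basic(4)[OF P] by blast
  have "regular_at R P (adjs R A (take ?n ys)) (ys ! ?n)" "regular_seq_at R P A (take ?n ys)"
    using assms(3,7) regs_append[of P A "take ?n ys" "drop ?n ys"] by (auto simp: regs_iff_nth)
  moreover have "ys ! ?n \<in> P" "set (take ?n ys) \<subseteq> P" using assms(3,5) by (auto dest: in_set_takeD)
  ultimately have "P \<notin> assprimes R (sat R P (adjs R A (take ?n ys)))"
    using reg_notin_assprime by blast
  then have "P \<notin> assprimes R (sat R P (adjs R A zs))"
    using assprime_adjs_exchange[OF P A, of zs "take ?n ys"] assms
      \<open>regular_seq_at R P A (take ?n ys)\<close> \<open>set (take ?n ys) \<subseteq> P\<close> by auto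
  then show ?thesis
    using ex_common_reg[OF P, of "{adjs R A zs}"] adjs_ideal[OF A Pc] by simp
qed

lemma regs_extend_length:
  assumes P: "primeideal P R" and A: "ideal A R" and "length zs \<le> length ys"
    "set zs \<subseteq> P" "set ys \<subseteq> P" "regular_seq_at R P A zs" "regular_seq_at R P A ys"
  shows "\<exists>ts. set ts \<subseteq> P \<and> regular_seq_at R P (adjs R A zs) ts \<and> length zs + length ts = length ys"
  using assms(3-7)
proof (induction "length ys - length zs" arbitrary: zs)
  case 0
  then show ?case by (intro exI[of _ "[]"]) auto
next
  case (Suc n)
  then have less: "length zs < length ys" by simp
  obtain w where w: "w \<in> P" "regular_at R P (adjs R A zs) w"
    using regs_extend[OF P A less Suc.prems(2-)] by blast
  have "n = length ys - length (zs @ [w])" "length (zs @ [w]) \<le> length ys" "set (zs @ [w]) \<subseteq> P"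
    "regular_seq_at R P A (zs @ [w])"
    using Suc.hyps(2) Suc.prems less w by (auto simp: regs_append)
  from Suc.hyps(1)[OF this(1,2,3) Suc.prems(3) this(4) Suc.prems(5)]
  obtain ts where "set ts \<subseteq> P" "regular_seq_at R P (adjs R A (zs @ [w])) ts"
    "length (zs @ [w]) + length ts = length ys" by blast
  then show ?case using w by (intro exI[of _ "w # ts"]) auto
qed

end

section \<open>Chains of primes and the Cohen-Macaulay property\<close>

text \<open>The height of a prime as a recursive lower bound, which makes sense before the height is
  known to be finite and supports induction along chains.\<close>

fun height_at_least :: "('a, 'b) ring_scheme \<Rightarrow> nat \<Rightarrow> 'a set \<Rightarrow> bool"
  where "height_at_least R 0 P \<longleftrightarrow> primeideal P R"
  | "height_at_least R (Suc n) P \<longleftrightarrow> primeideal P R \<and> (\<exists>Q. height_at_least R n Q \<and> Q \<subset> P)"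

lemma height_at_least_primeideal: "height_at_least R n P \<Longrightarrow> primeideal P R"
  by (cases n) auto

lemma height_at_least_mono: "\<lbrakk>height_at_least R n P; P \<subseteq> Q; primeideal Q R\<rbrakk> \<Longrightarrow> height_at_least R n Q"
  by (cases n) (simp, metis height_at_least.simps(2) psubset_subset_trans)

lemma height_at_least_SucD: "height_at_least R (Suc n) P \<Longrightarrow> height_at_least R n P"
  using height_at_least_mono by auto

lemma height_at_least_le: "\<lbrakk>height_at_least R n P; k \<le> n\<rbrakk> \<Longrightarrow> height_at_least R k P"
  by (induction n) (auto simp: le_Suc_eq intro: height_at_least_SucD simp del: height_at_least.simps)

declare height_at_least.simps(2) [simp del]

text \<open>Depth at least dimension for the localization at \<open>M\<close>, with the sequences
  pulled back to \<open>R\<close>. Quantifying over all \<open>n\<close> covers a height not yet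
  known to be finite.\<close>

definition cm_at :: "('a, 'b) ring_scheme \<Rightarrow> 'a set \<Rightarrow> bool"
  where "cm_at R M \<longleftrightarrow>
    (\<forall>n. height_at_least R n M \<longrightarrow> (\<exists>ys. set ys \<subseteq> M \<and> length ys = n \<and> regular_seq_at R M {\<zero>\<^bsub>R\<^esub>} ys))"

section \<open>Heights against lengths of regular sequences, and unmixedness\<close>

context noetherian_cring
begin

text \<open>Among the elements \<open>u\<close> outside \<open>sat R M A\<close> that
  \<open>p\<close> multiplies into it, one generating a maximal ideal together with \<open>A\<close>
  stays nonzero modulo \<open>A + R y\<close>. An associated prime above its annihilator there
  contains both \<open>p\<close> and \<open>y\<close>, while \<open>y\<close>, being regular, is not
  in \<open>p\<close>.\<close>

lemma assprime_adjoin_step: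
  assumes M: "primeideal M R" and A: "ideal A R" and y: "y \<in> M" "regular_at R M A y"
    and p: "p \<in> assprimes R (sat R M A)"
  shows "\<exists>p'\<in>assprimes R (sat R M (adjoin R A y)). p \<subset> p'"
proof -
  note Mc = subsetD[OF primeideal_basic(4)[OF M]]
  note i = ideal_basic[OF A] and iM = ideal_basic[OF primeideal_basic(1)[OF M]]
  let ?S = "sat R M A"
  note iS = ideal_basic[OF sat_ideal[OF M A]]
  have yc: "y \<in> carrier R" using y Mc by blast
  obtain u0 where u0: "primeideal p R" "u0 \<in> carrier R" "p = colon R ?S u0"
    using p unfolding assprimes_def by blast
  note pm = mem_if_eq_colon[OF u0(3)]
  have u0n: "u0 \<notin> ?S" using primeideal_basic(2)[OF u0(1)] u0(2) pm[of \<one>] by simp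
  let ?U = "{u \<in> carrier R. u \<notin> ?S \<and> (\<forall>r\<in>p. r \<otimes> u \<in> ?S)}"
  let ?C = "(\<lambda>u. sat R M (adjoin R A u)) ` ?U"
  have "u0 \<in> ?U" using u0(2) u0n pm by blast
  then have "?C \<noteq> {}" by blast
  then have "\<exists>B\<in>?C. \<forall>D\<in>?C. B \<subseteq> D \<longrightarrow> D = B"
    by (rule exists_maximal_ideal_in) (auto intro!: sat_ideal[OF M] adjoin_ideal[OF A])
  then obtain u where u: "u \<in> ?U"
    and max: "\<And>v. \<lbrakk>v \<in> ?U; sat R M (adjoin R A u) \<subseteq> sat R M (adjoin R A v)\<rbrakk>
      \<Longrightarrow> sat R M (adjoin R A v) = sat R M (adjoin R A u)" by auto
  have uc: "u \<in> carrier R" "u \<notin> ?S" "\<And>r. r \<in> p \<Longrightarrow> r \<otimes> u \<in> ?S" using u by auto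
  txt \<open>
    Otherwise \<open>u = y n\<close> modulo \<open>A\<close> up to a unit. Then also \<open>n \<in> ?U\<close>, and \<open>n\<close> generates a strictly
    larger ideal than \<open>u\<close> modulo \<open>A\<close>: from \<open>n = r u = r y n\<close> it would follow that \<open>(1 - r y) n = 0\<close>.
  \<close>
  have notin: "u \<notin> sat R M (adjoin R A y)"
  proof
    assume "u \<in> sat R M (adjoin R A y)"
    then obtain s a n where s: "s \<in> carrier R" "s \<notin> M" "a \<in> A" "n \<in> carrier R"
      "s \<otimes> u = a \<oplus> n \<otimes> y" by (rule sat_adjoinE)
    have ac: "a \<in> carrier R" using s(3) i(7) by blast
    have n1: "r \<otimes> n \<in> ?S" if r: "r \<in> p" for r
    proof -
      have rc: "r \<in> carrier R" using r primeideal_basic(4)[OF u0(1)] by blast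
      have "y \<otimes> (r \<otimes> n) = r \<otimes> (a \<oplus> n \<otimes> y) \<ominus> r \<otimes> a" using yc rc s(4) ac by algebra
      also have "\<dots> = s \<otimes> (r \<otimes> u) \<ominus> r \<otimes> a"
        unfolding s(5)[symmetric] using rc s(1) ac uc(1) by algebra
      also have "\<dots> \<in> ?S"
        using iS(5,8) uc(3)[OF r] s(1) i(5)[OF s(3) rc] subset_sat[OF M i(1)] by blast
      finally show ?thesis using y(2) rc s(4) unfolding regular_at_def by simp
    qed
    have n2: "n \<notin> ?S"
    proof
      assume "n \<in> ?S"
      then obtain t where t: "t \<in> carrier R" "t \<notin> M" "t \<otimes> n \<in> A" by (metis satE)
      have "(t \<otimes> s) \<otimes> u = t \<otimes> (s \<otimes> u)" using t(1) s(1) uc(1) by algebra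
      also have "\<dots> = t \<otimes> a \<oplus> (t \<otimes> n) \<otimes> y"
        unfolding s(5) using t(1) s(4) ac yc by algebra
      also have "\<dots> \<in> A" using i(3,5,6) t s(3) yc by simp
      finally show False
        using satI[OF uc(1), of "t \<otimes> s" M A] primeideal_basic(5)[OF M t(1) s(1) t(2) s(2)] t(1) s(1) uc(2)
        by simp
    qed
    have nU: "n \<in> ?U" using s(4) n1 n2 by blast
    note iD = ideal_basic[OF adjoin_ideal[OF A s(4)]]
    have "s \<otimes> u \<in> adjoin R A n"
      using adjoin_basic[OF A s(4)] iD(3)[of a "n \<otimes> y"] iD(6)[OF _ yc] s(3,5) by auto
    then have "u \<in> sat R M (adjoin R A n)" using satI[OF uc(1) s(1,2)] by blast
    then have "adjoin R A u \<subseteq> sat R M (adjoin R A n)"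
      using adjoin_basic[OF A] sat_ideal[OF M adjoin_ideal[OF A s(4)]] uc(1)
        subset_sat[OF M iD(1)] s(4) by (meson subset_trans)
    then have "sat R M (adjoin R A u) \<subseteq> sat R M (adjoin R A n)"
      using sat_mono sat_idem[OF M iD(1)] by metis
    then have "n \<in> sat R M (adjoin R A u)"
      using max[OF nU] subset_sat[OF M iD(1)] adjoin_basic(2)[OF A s(4)] by blast
    then obtain t a' r where t: "t \<in> carrier R" "t \<notin> M" "a' \<in> A" "r \<in> carrier R"
      "t \<otimes> n = a' \<oplus> r \<otimes> u" by (rule sat_adjoinE)
    have ac': "a' \<in> carrier R" using t(3) i(7) by blast
    \<comment> \<open>With the multipliers restored, the unit \<open>1 - r y\<close> becomes
      \<open>t s - y r\<close>, outside \<open>M\<close> because \<open>t s\<close> is outside and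
      \<open>y\<close> inside. Here it is applied to \<open>u\<close>, which is thereby forced into
      \<open>sat R M A\<close>.\<close>
    have "(t \<otimes> s \<ominus> y \<otimes> r) \<otimes> u = t \<otimes> (s \<otimes> u) \<ominus> y \<otimes> r \<otimes> u"
      using t(1,4) s(1) uc(1) yc by algebra
    also have "\<dots> = t \<otimes> a \<oplus> (t \<otimes> n) \<otimes> y \<ominus> y \<otimes> r \<otimes> u"
      unfolding s(5) using t(1,4) s(4) uc(1) yc ac by algebra
    also have "\<dots> = t \<otimes> a \<oplus> a' \<otimes> y"
      unfolding t(5) using t(1,4) s(4) uc(1) yc ac ac' by algebra
    also have "\<dots> \<in> A" using i(3,5,6) t s(3) yc by simp
    finally have inA: "(t \<otimes> s \<ominus> y \<otimes> r) \<otimes> u \<in> A" .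
    have "t \<otimes> s = (t \<otimes> s \<ominus> y \<otimes> r) \<oplus> y \<otimes> r" using t(1,4) s(1) yc by algebra
    then have "t \<otimes> s \<ominus> y \<otimes> r \<notin> M"
      using iM(3)[of "t \<otimes> s \<ominus> y \<otimes> r" "y \<otimes> r"] iM(6)[OF y(1) t(4)]
        primeideal_basic(5)[OF M t(1) s(1) t(2) s(2)] by auto
    then show False using satI[OF uc(1) _ _ inA] t(1,4) s(1) yc uc(2) by blast
  qed
  have Ay: "ideal (sat R M (adjoin R A y)) R" by (intro sat_ideal[OF M] adjoin_ideal[OF A] yc)
  obtain p' where p': "p' \<in> assprimes R (sat R M (adjoin R A y))"
    "colon R (sat R M (adjoin R A y)) u \<subseteq> p'"
    using ex_assprime[OF Ay uc(1) notin] by blast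
  have "p \<subseteq> p'"
  proof
    fix r assume r: "r \<in> p"
    have "r \<otimes> u \<in> sat R M (adjoin R A y)"
      using uc(3)[OF r] sat_mono[OF adjoin_basic(1)[OF A yc]] by blast
    then show "r \<in> p'"
      using p'(2) r primeideal_basic(4)[OF u0(1)] unfolding colon_def by blast
  qed
  moreover have "y \<in> p'"
    using subset_assprime[OF Ay p'(1)] adjoin_basic(2)[OF A yc]
      subset_sat[OF M ideal_basic(1)[OF adjoin_ideal[OF A yc]]] by blast
  moreover have "y \<notin> p" using reg_notin_assprime[OF p y(2)] .
  ultimately show ?thesis using p'(1) by blast
qed

text \<open>Each member of \<open>ys\<close> moves the associated prime to a strictly larger one,
  and the last prime reached still lies in \<open>M\<close>; these steps are added on top of the
  chain below \<open>p\<close>.\<close>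

lemma height_at_least_add_length_regs:
  assumes M: "primeideal M R" and "ideal A R" "set ys \<subseteq> M" "regular_seq_at R M A ys"
    "p \<in> assprimes R (sat R M A)" "height_at_least R r p"
  shows "height_at_least R (r + length ys) M"
  using assms(2-)
proof (induction ys arbitrary: A p r)
  case Nil
  then show ?case using height_at_least_mono[OF _ assprime_sat_subset[OF M]] M by simp
next
  case (Cons y ys)
  have y: "y \<in> carrier R" "y \<in> M" using Cons.prems(2) primeideal_basic(4)[OF M] by auto
  obtain p' where p': "p' \<in> assprimes R (sat R M (adjoin R A y))" "p \<subset> p'"
    using assprime_adjoin_step[OF M Cons.prems(1) y(2) _ Cons.prems(4)] Cons.prems(3) by auto
  have "height_at_least R (Suc r) p'" using p' Cons.prems(5) unfolding assprimes_def by (auto simp: height_at_least.simps(2))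
  then have "height_at_least R (Suc r + length ys) M"
    using Cons.IH[where r = "Suc r", OF adjoin_ideal[OF Cons.prems(1) y(1)] _ _ p'(1)] Cons.prems by simp
  then show ?case by simp
qed

lemma height_at_least_length_regs:
  assumes M: "primeideal M R" and "set ys \<subseteq> M" "regular_seq_at R M {\<zero>} ys"
  shows "height_at_least R (length ys) M"
proof -
  obtain p where p: "p \<in> assprimes R (sat R M {\<zero>})"
    using ex_assprime[OF sat_ideal[OF M zeroideal] one_closed sat_zero_proper[OF M]] by blast
  then have "height_at_least R 0 p" unfolding assprimes_def by simp
  then show ?thesis using height_at_least_add_length_regs[OF M zeroideal assms(2,3) p, of 0] by simp
qed

text \<open>A regular sequence whose ideal has maximal saturation cannot be prolonged in
  \<open>M\<close>. By exchange no longer regular sequence exists in \<open>M\<close>, and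
  \<open>cm_at\<close> turns this into a bound on the height.\<close>

lemma cm_at_finite_height:
  assumes M: "primeideal M R" and cm: "cm_at R M"
  obtains n where "height_at_least R n M" "\<not> height_at_least R (Suc n) M"
proof -
  note Mc = primeideal_basic(4)[OF M]
  let ?Z = "{zs. set zs \<subseteq> M \<and> regular_seq_at R M {\<zero>} zs}"
  let ?C = "(\<lambda>zs. sat R M (adjs R {\<zero>} zs)) ` ?Z"
  have "[] \<in> ?Z" by simp
  then have "?C \<noteq> {}" by blast
  then have "\<exists>B\<in>?C. \<forall>D\<in>?C. B \<subseteq> D \<longrightarrow> D = B"
    by (rule exists_maximal_ideal_in) (use Mc in \<open>auto intro!: sat_ideal[OF M] adjs_ideal[OF zeroideal]\<close>)
  then obtain zs where zs: "set zs \<subseteq> M" "regular_seq_at R M {\<zero>} zs"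
    and max: "\<And>ys. \<lbrakk>set ys \<subseteq> M; regular_seq_at R M {\<zero>} ys;
      sat R M (adjs R {\<zero>} zs) \<subseteq> sat R M (adjs R {\<zero>} ys)\<rbrakk>
      \<Longrightarrow> sat R M (adjs R {\<zero>} ys) = sat R M (adjs R {\<zero>} zs)" by auto
  have zc: "set zs \<subseteq> carrier R" using zs Mc by blast
  note iz = adjs_ideal[OF zeroideal zc]
  have "\<not> height_at_least R (Suc (length zs)) M"
  proof
    assume "height_at_least R (Suc (length zs)) M"
    then obtain ys where ys: "set ys \<subseteq> M" "length ys = Suc (length zs)" "regular_seq_at R M {\<zero>} ys"
      using cm unfolding cm_at_def by blast
    then obtain w where w: "w \<in> M" "regular_at R M (adjs R {\<zero>} zs) w"
      using regs_extend[OF M zeroideal, of zs ys] zs by auto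
    have wc: "w \<in> carrier R" using w Mc by blast
    note b = adjoin_basic[OF iz wc]
    \<comment> \<open>By maximality the prolongation by \<open>w\<close> leaves the saturation
      unchanged, so it already contains \<open>w\<close> and then, by regularity of
      \<open>w\<close>, also \<open>1\<close>.\<close>
    have "sat R M (adjs R {\<zero>} (zs @ [w])) = sat R M (adjs R {\<zero>} zs)"
      using max[of "zs @ [w]"] zs w sat_mono[OF b(1)] by (simp add: regs_append)
    moreover have "w \<in> sat R M (adjs R {\<zero>} (zs @ [w]))"
      using b(2) subset_sat[OF M ideal_basic(1)[OF adjoin_ideal[OF iz wc]]] by auto
    ultimately have "w \<otimes> \<one> \<in> sat R M (adjs R {\<zero>} zs)" using wc by simp
    then have "\<one> \<in> sat R M (adjs R {\<zero>} zs)" using w(2) unfolding regular_at_def by blast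
    moreover have "adjs R {\<zero>} zs \<subseteq> M"
      using adjs_basic(3)[OF zeroideal zc primeideal_basic(1)[OF M]] zs(1) primeideal_basic(3)[OF M] by auto
    ultimately show False
      using sat_subset_prime[OF M subset_refl] primeideal_basic(2)[OF M] by blast
  qed
  \<comment> \<open>The condition holds at 0, so below any failing \<open>k\<close> there is a last
    \<open>n\<close> at which it holds.\<close>
  moreover have "\<exists>n. height_at_least R n M \<and> \<not> height_at_least R (Suc n) M" if "\<not> height_at_least R k M" for k
    using that by (induction k) (use M in auto)
  ultimately show thesis using that by blast
qed

text \<open>If a sequence of length \<open>g < r\<close> could not be prolonged inside
  \<open>P\<close>, then \<open>P\<close> would lie in one of its associated primes, which has
  height at least \<open>r\<close>. With \<open>n\<close> the height of \<open>M\<close>, the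
  sequence has \<open>n - g\<close> further members in \<open>M\<close>, and these would raise the
  height of \<open>M\<close> to \<open>r + (n - g)\<close>, beyond \<open>n\<close>.\<close>

lemma cm_at_ex_regs:
  assumes M: "primeideal M R" and cm: "cm_at R M" and P: "primeideal P R" "P \<subseteq> M" "height_at_least R r P"
  shows "\<exists>zs. set zs \<subseteq> P \<and> length zs = r \<and> regular_seq_at R M {\<zero>} zs"
proof -
  note Mc = primeideal_basic(4)[OF M]
  obtain n where n: "height_at_least R n M" "\<not> height_at_least R (Suc n) M" by (rule cm_at_finite_height[OF M cm])
  obtain ys where ys: "set ys \<subseteq> M" "length ys = n" "regular_seq_at R M {\<zero>} ys"
    using cm n(1) unfolding cm_at_def by blast
  have rn: "r \<le> n"
    using height_at_least_le[OF height_at_least_mono[OF P(3,2) M], of "Suc n"] n(2) by (meson not_less_eq_eq)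
  have "\<exists>zs. set zs \<subseteq> P \<and> length zs = g \<and> regular_seq_at R M {\<zero>} zs" if "g \<le> r" for g
    using that
  proof (induction g)
    case 0
    then show ?case by simp
  next
    case (Suc g)
    then obtain zs where zs: "set zs \<subseteq> P" "length zs = g" "regular_seq_at R M {\<zero>} zs" by auto
    have zM: "set zs \<subseteq> M" "set zs \<subseteq> carrier R" using zs P(2) Mc by auto
    note iz = adjs_ideal[OF zeroideal zM(2)]
    have "\<exists>w\<in>P. regular_at R M (adjs R {\<zero>} zs) w"
    proof (rule ccontr)
      assume none: "\<not> ?thesis"
      let ?F = "assprimes R (sat R M (adjs R {\<zero>} zs))"
      have "\<exists>p\<in>?F. P \<subseteq> p"
      proof (rule ccontr)
        assume "\<not> ?thesis"
        then obtain w where w: "w \<in> P" "\<And>p. p \<in> ?F \<Longrightarrow> w \<notin> p"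
          using prime_avoidance[OF finite_assprimes[OF sat_ideal[OF M iz]] _ primeideal_basic(1)[OF P(1)]]
          unfolding assprimes_def by blast
        have "w \<in> carrier R" using w(1) primeideal_basic(4)[OF P(1)] by blast
        then show False using assprime_if_not_reg[OF M iz] w none by blast
      qed
      then obtain p where p: "p \<in> ?F" "P \<subseteq> p" by blast
      then have "height_at_least R r p" using height_at_least_mono[OF P(3)] unfolding assprimes_def by blast
      moreover obtain ts where ts: "set ts \<subseteq> M" "regular_seq_at R M (adjs R {\<zero>} zs) ts"
        "length zs + length ts = length ys"
        using regs_extend_length[OF M zeroideal _ zM(1) ys(1) zs(3) ys(3)] zs(2) ys(2) rn Suc.prems
        by auto
      ultimately have "height_at_least R (r + length ts) M"
        using height_at_least_add_length_regs[OF M iz ts(1,2) p(1)] by blast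
      then have "height_at_least R (Suc n) M"
        by (rule height_at_least_le) (use ts(3) zs(2) ys(2) Suc.prems in simp)
      then show False using n(2) by blast
    qed
    then obtain w where "w \<in> P" "regular_at R M (adjs R {\<zero>} zs) w" by blast
    then show ?case using zs by (intro exI[of _ "zs @ [w]"]) (simp add: regs_append)
  qed
  then show ?thesis by blast
qed

text \<open>If \<open>p\<close> had larger height, it would contain a regular sequence with one
  member more than \<open>xs\<close>, and by exchange \<open>xs\<close> could be prolonged inside
  \<open>p\<close>; but a regular element avoids all associated primes. The exchange takes place at
  \<open>p\<close>, so the two sequences and the associated prime are first brought there from
  \<open>M\<close> and \<open>Q\<close>.\<close>

lemma cm_at_unmixed:
  assumes M: "primeideal M R" and cm: "cm_at R M" and Q: "primeideal Q R" "Q \<subseteq> M"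
    and xs: "set xs \<subseteq> Q" "regular_seq_at R Q {\<zero>} xs"
    and p: "p \<in> assprimes R (sat R Q (adjs R {\<zero>} xs))"
  shows "\<not> height_at_least R (Suc (length xs)) p"
proof
  assume h: "height_at_least R (Suc (length xs)) p"
  have pp: "primeideal p R" using p unfolding assprimes_def by blast
  have pQ: "p \<subseteq> Q" by (rule assprime_sat_subset[OF Q(1) p])
  have xc: "set xs \<subseteq> carrier R" using xs(1) primeideal_basic(4)[OF Q(1)] by blast
  let ?A = "adjs R {\<zero>} xs"
  note iA = adjs_ideal[OF zeroideal xc]
  have sub: "?A \<subseteq> sat R Q ?A" by (rule subset_sat[OF Q(1) ideal_basic(1)[OF iA]])
  have xp: "set xs \<subseteq> p"
    using adjs_basic(2)[OF zeroideal xc] sub subset_assprime[OF sat_ideal[OF Q(1) iA] p] by blast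
  have xreg: "regular_seq_at R p {\<zero>} xs" by (rule regs_prime_antimono[OF pp Q(1) zeroideal pQ xc xs(2)])
  obtain zs where zs: "set zs \<subseteq> p" "length zs = Suc (length xs)" "regular_seq_at R M {\<zero>} zs"
    using cm_at_ex_regs[OF M cm pp _ h] pQ Q(2) by blast
  have zc: "set zs \<subseteq> carrier R" using zs(1) primeideal_basic(4)[OF pp] by blast
  have zreg: "regular_seq_at R p {\<zero>} zs"
    by (rule regs_prime_antimono[OF pp M zeroideal _ zc zs(3)]) (use pQ Q(2) in blast)
  obtain u where u: "u \<in> carrier R" "p = colon R (sat R Q ?A) u"
    using p unfolding assprimes_def by blast
  note pm = mem_if_eq_colon[OF u(2)]
  \<comment> \<open>The witness \<open>u\<close> survives localization at \<open>p\<close>, because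
    its annihilator is exactly \<open>p\<close> and so contains no multiplier outside
    \<open>p\<close>.\<close>
  have "p \<in> assprimes R (sat R p ?A)"
  proof (rule assprime_satI[OF pp u(1)])
    show "u \<notin> sat R p ?A"
    proof
      assume "u \<in> sat R p ?A"
      then obtain t where "t \<in> carrier R" "t \<notin> p" "t \<otimes> u \<in> ?A" by (metis satE)
      then show False using pm sub by blast
    qed
    show "r \<otimes> u \<in> sat R p ?A" if "r \<in> p" for r
      using that pm sat_antimono[OF pQ] by blast
  qed
  then show False
    using regs_extend[OF pp zeroideal _ xp zs(1) xreg zreg] zs(2) reg_notin_assprime by auto
qed

text \<open>Each generator \<open>e\<close> is replaced by \<open>e + j\<close> with
  \<open>j\<close> in the ideal of the generators still to be treated, which changes neither the
  ideal nor the number of generators. Avoidance by this coset could fail only at an associated prime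
  of the part already built that contains all generators, hence \<open>I\<close>; its height would
  be at least \<open>c\<close>, more than unmixedness allows.\<close>

lemma cm_at_regular_generators:
  assumes M: "primeideal M R" and cm: "cm_at R M" and Q: "primeideal Q R" "Q \<subseteq> M"
    and I: "ideal I R" "I \<subseteq> Q" "\<And>p. \<lbrakk>primeideal p R; I \<subseteq> p\<rbrakk> \<Longrightarrow> height_at_least R c p"
    and es: "set es \<subseteq> I" "length es \<le> c" "I \<subseteq> sat R Q (adjs R {\<zero>} es)"
  shows "\<exists>xs. set xs \<subseteq> I \<and> regular_seq_at R Q {\<zero>} xs \<and> I \<subseteq> sat R Q (adjs R {\<zero>} xs)"
proof -
  note Ic = ideal_basic(1)[OF I(1)]
  have "\<exists>xs. set xs \<subseteq> I \<and> regular_seq_at R Q {\<zero>} xs \<and> I \<subseteq> sat R Q (adjs R {\<zero>} xs)"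
    if "set xs \<subseteq> I" "regular_seq_at R Q {\<zero>} xs" "set es \<subseteq> I" "length xs + length es \<le> c"
      "I \<subseteq> sat R Q (adjs R {\<zero>} (xs @ es))" for xs es
    using that
  proof (induction es arbitrary: xs)
    case Nil
    then show ?case by auto
  next
    case (Cons e es)
    have cc: "set xs \<subseteq> carrier R" "e \<in> carrier R" "e \<in> I" "set es \<subseteq> carrier R" "set es \<subseteq> I"
      using Cons.prems Ic by auto
    have xQ: "set xs \<subseteq> Q" using Cons.prems(1) I(2) by blast
    let ?A = "adjs R {\<zero>} xs" and ?J = "adjs R {\<zero>} es"
    note iA = adjs_ideal[OF zeroideal cc(1)] and iJ = adjs_ideal[OF zeroideal cc(4)]
    let ?F = "assprimes R (sat R Q ?A)"
    have "\<exists>j\<in>?J. \<forall>p\<in>?F. e \<oplus> j \<notin> p"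
    proof (rule coset_prime_avoidance[OF finite_assprimes[OF sat_ideal[OF Q(1) iA]] _ iJ cc(2)])
      show "primeideal p R" if "p \<in> ?F" for p using that unfolding assprimes_def by blast
      show "\<not> ?J \<subseteq> p" if p: "p \<in> ?F" "e \<in> p" for p
      proof
        assume J: "?J \<subseteq> p"
        have pp: "primeideal p R" using p unfolding assprimes_def by blast
        have "?A \<subseteq> p"
          using subset_sat[OF Q(1) ideal_basic(1)[OF iA]] subset_assprime[OF sat_ideal[OF Q(1) iA] p(1)]
          by blast
        then have "set xs \<subseteq> p" using adjs_basic(2)[OF zeroideal cc(1)] by blast
        moreover have "set es \<subseteq> p" using J adjs_basic(2)[OF zeroideal cc(4)] by blast
        ultimately have "adjs R {\<zero>} (xs @ e # es) \<subseteq> p"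
          using p(2) cc primeideal_basic(1,3)[OF pp]
          by (intro adjs_basic(3)[OF zeroideal]) auto
        then have "I \<subseteq> p"
          using Cons.prems(5) sat_subset_prime[OF pp assprime_sat_subset[OF Q(1) p(1)]] by blast
        then have "height_at_least R (Suc (length xs)) p"
          using height_at_least_le[OF I(3)[OF pp]] Cons.prems(4) by simp
        then show False using cm_at_unmixed[OF M cm Q xQ Cons.prems(2) p(1)] by blast
      qed
    qed
    then obtain j where j: "j \<in> ?J" "\<And>p. p \<in> ?F \<Longrightarrow> e \<oplus> j \<notin> p" by blast
    have jc: "j \<in> carrier R" using j(1) ideal_basic(1)[OF iJ] by blast
    have JI: "?J \<subseteq> I"
      using adjs_basic(3)[OF zeroideal cc(4) I(1)] cc(5) ideal_basic(2)[OF I(1)] by auto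
    let ?w = "e \<oplus> j"
    have w: "?w \<in> I" "?w \<in> carrier R"
      using ideal_basic(3)[OF I(1)] cc j(1) JI jc by auto
    have "regular_at R Q ?A ?w" using assprime_if_not_reg[OF Q(1) iA w(2)] j(2) by blast
    then have regs: "regular_seq_at R Q {\<zero>} (xs @ [?w])" using Cons.prems(2) by (simp add: regs_append)
    let ?B = "adjs R {\<zero>} ((xs @ [?w]) @ es)"
    have bc: "set ((xs @ [?w]) @ es) \<subseteq> carrier R" using cc w by simp
    note b = adjs_basic[OF zeroideal bc] and iB = adjs_ideal[OF zeroideal bc]
    have "?J \<subseteq> ?B" using b(1,2) iB by (intro adjs_basic(3)[OF zeroideal cc(4)]) auto
    \<comment> \<open>The old generator \<open>e\<close> is recovered as \<open>?w - j\<close>, so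
      nothing is lost by the replacement.\<close>
    then have "?w \<ominus> j \<in> ?B" using ideal_basic(8)[OF iB] b(2) j(1) by auto
    moreover have "?w \<ominus> j = e" using cc jc by algebra
    ultimately have "adjs R {\<zero>} (xs @ e # es) \<subseteq> ?B"
      using b(1,2) iB cc by (intro adjs_basic(3)[OF zeroideal]) auto
    then have "I \<subseteq> sat R Q ?B" using Cons.prems(5) sat_mono by blast
    then show ?case
      using Cons.IH[of "xs @ [?w]"] regs w(1) Cons.prems(1,4) cc(5) by simp
  qed
  from this[of "[]" es] show ?thesis using es by simp
qed

end

section \<open>Powers of ideals generated by regular sequences\<close>

lemma ideal_power_0: "ideal_power R I 0 = carrier R"
  by (simp add: ideal_power_def nat_pow_def ideals_set_def)

lemma ideal_power_Suc: "ideal_power R I (Suc m) = ideal_power R I m \<cdot>\<^bsub>R\<^esub> I"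
  by (simp add: ideal_power_def nat_pow_def ideals_set_def)

context cring
begin

lemma mem_ideal_prodI: "\<lbrakk>a \<in> A; b \<in> B\<rbrakk> \<Longrightarrow> a \<otimes> b \<in> A \<cdot> B"
  by (rule ideal_prod.prod)

lemma ideal_power_ideal: "ideal I R \<Longrightarrow> ideal (ideal_power R I m) R"
  by (induction m) (auto simp: ideal_power_0 ideal_power_Suc oneideal ideal_prod_is_ideal)

lemma ideal_prod_mono: "\<lbrakk>A \<subseteq> A'; B \<subseteq> B'\<rbrakk> \<Longrightarrow> A \<cdot> B \<subseteq> A' \<cdot> B'"
proof
  fix x assume "A \<subseteq> A'" "B \<subseteq> B'" "x \<in> A \<cdot> B"
  from this(3,1,2) show "x \<in> A' \<cdot> B'"
    by (induction rule: ideal_prod.induct) (auto intro: ideal_prod.intros)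
qed

lemma ideal_prod_least:
  assumes "ideal C R" "\<And>a b. \<lbrakk>a \<in> A; b \<in> B\<rbrakk> \<Longrightarrow> a \<otimes> b \<in> C"
  shows "A \<cdot> B \<subseteq> C"
proof
  fix x assume "x \<in> A \<cdot> B"
  then show "x \<in> C"
    by induction (auto simp: assms(2) ideal_basic(3)[OF assms(1)])
qed

lemma ideal_power_mono: "I \<subseteq> J \<Longrightarrow> ideal_power R I m \<subseteq> ideal_power R J m"
  by (induction m) (auto simp: ideal_power_0 ideal_power_Suc ideal_prod_mono)

lemma ideal_power_Suc_subset:
  assumes "ideal I R"
  shows "ideal_power R I (Suc m) \<subseteq> ideal_power R I m" "ideal_power R I (Suc m) \<subseteq> I"
  using ideal_prod_inter[OF ideal_power_ideal[OF assms] assms] by (auto simp: ideal_power_Suc)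

lemma ideal_power_Suc': "ideal I R \<Longrightarrow> ideal_power R I (Suc m) = I \<cdot> ideal_power R I m"
  by (simp add: ideal_power_Suc ideal_prod_commute ideal_power_ideal)

lemma sat_prod:
  assumes P: "primeideal P R" and "ideal A R" "ideal B R" "A' \<subseteq> sat R P A" "B' \<subseteq> sat R P B"
  shows "A' \<cdot> B' \<subseteq> sat R P (A \<cdot> B)"
proof (rule ideal_prod_least)
  show "ideal (sat R P (A \<cdot> B)) R" by (intro sat_ideal[OF P] ideal_prod_is_ideal assms(2,3))
  fix a b assume "a \<in> A'" "b \<in> B'"
  then have ab: "a \<in> sat R P A" "b \<in> sat R P B" using assms(4,5) by auto
  obtain s where s: "a \<in> carrier R" "s \<in> carrier R" "s \<notin> P" "s \<otimes> a \<in> A"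
    using ab(1) by (rule satE)
  obtain t where t: "b \<in> carrier R" "t \<in> carrier R" "t \<notin> P" "t \<otimes> b \<in> B"
    using ab(2) by (rule satE)
  have "(s \<otimes> t) \<otimes> (a \<otimes> b) = (s \<otimes> a) \<otimes> (t \<otimes> b)" using s t by algebra
  then have "(s \<otimes> t) \<otimes> (a \<otimes> b) \<in> A \<cdot> B" using s t by (simp add: mem_ideal_prodI)
  then show "a \<otimes> b \<in> sat R P (A \<cdot> B)"
    using s t primeideal_basic(5)[OF P s(2) t(2)] satI[of "a \<otimes> b" "s \<otimes> t"] by simp
qed

lemma ideal_power_sat:
  assumes P: "primeideal P R" and "ideal I R" "ideal J R" "I \<subseteq> sat R P J"
  shows "ideal_power R I m \<subseteq> sat R P (ideal_power R J m)"
proof (induction m)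
  case 0
  then show ?case using subset_sat[OF P] by (simp add: ideal_power_0)
next
  case (Suc m)
  then show ?case
    unfolding ideal_power_Suc by (intro sat_prod P ideal_power_ideal assms)
qed

text \<open>A product of \<open>k + 1\<close> factors from \<open>J + R x\<close>, once expanded,
  consists of a term with all factors from \<open>J\<close> and of terms from which a factor
  \<open>x\<close> can be pulled out.\<close>

lemma ideal_power_adjoin_decompose:
  assumes J: "ideal J R" and x: "x \<in> carrier R" and a: "a \<in> ideal_power R (adjoin R J x) (Suc k)"
  shows "\<exists>e\<in>ideal_power R J (Suc k). \<exists>f\<in>ideal_power R (adjoin R J x) k. a = e \<oplus> x \<otimes> f"
  using a
proof (induction k arbitrary: a)
  case 0
  have "ideal_power R (adjoin R J x) (Suc 0) = adjoin R J x" "ideal_power R J (Suc 0) = J"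
    using J adjoin_ideal[OF J x] by (simp_all add: ideal_power_0 ideal_power_Suc' ideal_prod_one)
  then obtain j r where "j \<in> J" "r \<in> carrier R" "a = j \<oplus> r \<otimes> x"
    using 0 by (auto simp: mem_adjoin)
  then show ?case
    using \<open>ideal_power R J (Suc 0) = J\<close> x m_comm by (auto simp: ideal_power_0)
next
  case (Suc k)
  let ?J = "adjoin R J x"
  note iJ = adjoin_ideal[OF J x]
  note pJ = ideal_power_ideal[OF J] and pJ' = ideal_power_ideal[OF iJ]
  from Suc.prems have "a \<in> ideal_power R ?J (Suc k) \<cdot> ?J"
    by (simp only: ideal_power_Suc[of _ _ "Suc k"])
  then show ?case
  proof (induction a rule: ideal_prod.induct)
    case (prod i j)
    obtain e f where ef: "e \<in> ideal_power R J (Suc k)" "f \<in> ideal_power R ?J k" "i = e \<oplus> x \<otimes> f"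
      using Suc.IH[OF prod(1)] by blast
    obtain l r where lr: "l \<in> J" "r \<in> carrier R" "j = l \<oplus> r \<otimes> x"
      using prod(2) by (auto simp: mem_adjoin)
    have c: "e \<in> carrier R" "f \<in> carrier R" "l \<in> carrier R"
      using ef lr ideal_basic(7)[OF pJ] ideal_basic(7)[OF pJ'] ideal_basic(7)[OF J] by blast+
    have "i \<otimes> j = e \<otimes> l \<oplus> x \<otimes> (f \<otimes> (l \<oplus> r \<otimes> x) \<oplus> e \<otimes> r)"
      unfolding ef(3) lr(3) using c lr(2) x by algebra
    moreover have "e \<otimes> l \<in> ideal_power R J (Suc (Suc k))"
      using ef(1) lr(1) by (simp add: ideal_power_Suc[of _ _ "Suc k"] mem_ideal_prodI)
    moreover have "f \<otimes> j \<in> ideal_power R ?J (Suc k)"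
      using ef(2) prod(2) by (simp add: ideal_power_Suc mem_ideal_prodI)
    moreover have "e \<otimes> r \<in> ideal_power R ?J (Suc k)"
      using ideal_basic(6)[OF pJ'] ef(1) lr(2) ideal_power_mono[OF adjoin_basic(1)[OF J x]] by blast
    ultimately show ?case
      using ideal_basic(3)[OF pJ'[of "Suc k"], of "f \<otimes> j" "e \<otimes> r"] lr(3) by blast
  next
    case (sum a b)
    then obtain e f e' f' where *: "e \<in> ideal_power R J (Suc (Suc k))" "f \<in> ideal_power R ?J (Suc k)"
      "a = e \<oplus> x \<otimes> f" "e' \<in> ideal_power R J (Suc (Suc k))" "f' \<in> ideal_power R ?J (Suc k)"
      "b = e' \<oplus> x \<otimes> f'" by blast
    have c: "e \<in> carrier R" "f \<in> carrier R" "e' \<in> carrier R" "f' \<in> carrier R"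
      using * ideal_basic(7)[OF pJ] ideal_basic(7)[OF pJ'] by blast+
    have "a \<oplus> b = (e \<oplus> e') \<oplus> x \<otimes> (f \<oplus> f')" unfolding * using c x by algebra
    then show ?case
      using ideal_basic(3)[OF pJ *(1,4)] ideal_basic(3)[OF pJ' *(2,5)] by blast
  qed
qed

lemma prod_power_adjoin_decompose:
  assumes J: "ideal J R" and x: "x \<in> carrier R" and K: "ideal K R"
    and a: "a \<in> K \<cdot> ideal_power R (adjoin R J x) (Suc k)"
  shows "\<exists>e\<in>K \<cdot> ideal_power R J (Suc k). \<exists>f\<in>K \<cdot> ideal_power R (adjoin R J x) k. a = e \<oplus> x \<otimes> f"
  using a
proof (induction a rule: ideal_prod.induct)
  case (prod i j)
  note pJ = ideal_power_ideal[OF J] and pJ' = ideal_power_ideal[OF adjoin_ideal[OF J x]]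
  obtain e f where ef: "e \<in> ideal_power R J (Suc k)" "f \<in> ideal_power R (adjoin R J x) k"
    "j = e \<oplus> x \<otimes> f"
    using ideal_power_adjoin_decompose[OF J x prod(2)] by blast
  have c: "e \<in> carrier R" "f \<in> carrier R" "i \<in> carrier R"
    using ef prod ideal_basic(7)[OF pJ] ideal_basic(7)[OF pJ'] ideal_basic(7)[OF K] by blast+
  have "i \<otimes> j = i \<otimes> e \<oplus> x \<otimes> (i \<otimes> f)" unfolding ef(3) using c x by algebra
  then show ?case
    using mem_ideal_prodI[OF prod(1) ef(1)] mem_ideal_prodI[OF prod(1) ef(2)] by blast
next
  case (sum a b)
  note pJ = ideal_prod_is_ideal[OF K ideal_power_ideal[OF J]]
    and pJ' = ideal_prod_is_ideal[OF K ideal_power_ideal[OF adjoin_ideal[OF J x]]]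
  from sum obtain e f e' f' where *: "e \<in> K \<cdot> ideal_power R J (Suc k)"
    "f \<in> K \<cdot> ideal_power R (adjoin R J x) k"
    "a = e \<oplus> x \<otimes> f" "e' \<in> K \<cdot> ideal_power R J (Suc k)"
    "f' \<in> K \<cdot> ideal_power R (adjoin R J x) k" "b = e' \<oplus> x \<otimes> f'" by blast
  have c: "e \<in> carrier R" "f \<in> carrier R" "e' \<in> carrier R" "f' \<in> carrier R"
    using * ideal_basic(7)[OF pJ] ideal_basic(7)[OF pJ'] by blast+
  have "a \<oplus> b = (e \<oplus> e') \<oplus> x \<otimes> (f \<oplus> f')" unfolding * using c x by algebra
  then show ?case
    using ideal_basic(3)[OF pJ *(1,4)] ideal_basic(3)[OF pJ' *(2,5)] by blast
qed

text \<open>Regularity climbs the filtration by powers. The hypothesis is injectivity of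
  \<open>w\<close> on the graded pieces, and an element that \<open>w\<close> multiplies into the
  next power lies in the current power by induction, hence represents a member of the graded
  piece.\<close>

lemma reg_power_of_graded:
  assumes P: "primeideal P R" and J: "ideal J R" and w: "w \<in> carrier R"
    and graded: "\<And>k a. \<lbrakk>a \<in> ideal_power R J k; w \<otimes> a \<in> sat R P (J \<cdot> ideal_power R J k)\<rbrakk>
      \<Longrightarrow> a \<in> sat R P (J \<cdot> ideal_power R J k)"
  shows "regular_at R P (ideal_power R J m) w"
proof (induction m)
  case 0
  then show ?case using subset_sat[OF P, of "carrier R"] by (auto simp: regular_at_def ideal_power_0)
next
  case (Suc m)
  note pJ = ideal_power_ideal[OF J]
  show ?case
    unfolding regular_at_def
  proof (intro ballI impI)
    fix a assume a: "a \<in> carrier R" "w \<otimes> a \<in> sat R P (ideal_power R J (Suc m))"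
    then have "w \<otimes> a \<in> sat R P (ideal_power R J m)"
      using sat_mono[OF ideal_power_Suc_subset(1)[OF J]] by blast
    then have "a \<in> sat R P (ideal_power R J m)" using Suc a(1) unfolding regular_at_def by blast
    then obtain s where s: "s \<in> carrier R" "s \<notin> P" "s \<otimes> a \<in> ideal_power R J m" by (metis satE)
    have "w \<otimes> (s \<otimes> a) = s \<otimes> (w \<otimes> a)" using w s a by algebra
    then have "w \<otimes> (s \<otimes> a) \<in> sat R P (ideal_power R J (Suc m))"
      using ideal_basic(5)[OF sat_ideal[OF P pJ] a(2) s(1)] by simp
    then have "s \<otimes> a \<in> sat R P (ideal_power R J (Suc m))"
      using graded[OF s(3)] by (simp add: ideal_power_Suc'[OF J])
    then show "a \<in> sat R P (ideal_power R J (Suc m))" using sat_cancel[OF P a(1) s(1,2)] by blast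
  qed
qed

text \<open>
  For an ideal \<open>J\<close> generated by a regular sequence, \<open>J\<^sup>k / K J\<^sup>k\<close> is free over \<open>R / K\<close>. The lemma
  records only that \<open>w\<close> is regular on this quotient if it is regular on \<open>R / K\<close>.
\<close>

lemma regs_graded:
  assumes P: "primeideal P R" and "set xs \<subseteq> carrier R" "regular_seq_at R P {\<zero>} xs"
    and "ideal K R" "adjs R {\<zero>} xs \<subseteq> K" "w \<in> carrier R" "regular_at R P K w"
    and "a \<in> ideal_power R (adjs R {\<zero>} xs) k"
    and "w \<otimes> a \<in> sat R P (K \<cdot> ideal_power R (adjs R {\<zero>} xs) k)"
  shows "a \<in> sat R P (K \<cdot> ideal_power R (adjs R {\<zero>} xs) k)"
  using assms(2-)
proof (induction xs arbitrary: K w a k rule: rev_induct)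
  case Nil
  show ?case
  proof (cases k)
    case 0
    show ?thesis
      using Nil.prems(6,7,8) unfolding 0 ideal_power_0 ideal_prod_one[OF Nil.prems(3)] regular_at_def by blast
  next
    case (Suc l)
    then have "a = \<zero>"
      using Nil.prems(7) ideal_power_Suc_subset(2)[OF zeroideal] by auto
    then show ?thesis
      using ideal_basic(2)[OF sat_ideal[OF P ideal_prod_is_ideal[OF Nil.prems(3) ideal_power_ideal[OF zeroideal]]]]
      by simp
  qed
next
  case (snoc x xs)
  note IH = snoc.IH
  have c: "set xs \<subseteq> carrier R" "x \<in> carrier R" using snoc.prems(1) by auto
  have rs: "regular_seq_at R P {\<zero>} xs" "regular_at R P (adjs R {\<zero>} xs) x"
    using snoc.prems(2) by (auto simp: regs_append)
  define J' where "J' = adjs R {\<zero>} xs"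
  define J where "J = adjoin R J' x"
  have J': "ideal J' R" unfolding J'_def by (rule adjs_ideal[OF zeroideal c(1)])
  have J: "ideal J R" unfolding J_def by (rule adjoin_ideal[OF J' c(2)])
  have JJ: "J' \<subseteq> J" "x \<in> J" unfolding J_def using adjoin_basic[OF J' c(2)] by auto
  note pJ = ideal_power_ideal[OF J] and pJ' = ideal_power_ideal[OF J']
  \<comment> \<open>The outer induction hypothesis with \<open>K = J'\<close>, followed along the
    filtration: \<open>x\<close> is regular on all powers of \<open>J'\<close>, not only on
    \<open>J'\<close>.\<close>
  have xreg: "regular_at R P (ideal_power R J' m) x" for m
    using IH[OF c(1) rs(1) J'[unfolded J'_def] subset_refl c(2) rs(2)]
    by (intro reg_power_of_graded[OF P J' c(2)]) (simp add: J'_def)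
  have J_eq: "adjs R {\<zero>} (xs @ [x]) = J" by (simp add: J_def J'_def)
  have "a \<in> sat R P (K \<cdot> ideal_power R J k)"
    if K: "ideal K R" "J \<subseteq> K" and w: "w \<in> carrier R" "regular_at R P K w"
      and "a \<in> ideal_power R J k" "w \<otimes> a \<in> sat R P (K \<cdot> ideal_power R J k)" for K w a k
    using that(5-)
  proof (induction k arbitrary: a)
    case 0
    then show ?case
      using w(2) unfolding ideal_power_0 ideal_prod_one[OF K(1)] regular_at_def by blast
  next
    case (Suc k)
    note iK = ideal_prod_is_ideal[OF K(1) pJ] and iK' = ideal_prod_is_ideal[OF K(1) pJ']
    \<comment> \<open>The part \<open>a1\<close> is settled by the inner induction on the exponent,
      the part \<open>a0\<close> by the outer one on the sequence.\<close>
    obtain a0 a1 where a: "a0 \<in> ideal_power R J' (Suc k)" "a1 \<in> ideal_power R J k"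
      "a = a0 \<oplus> x \<otimes> a1"
      using ideal_power_adjoin_decompose[OF J' c(2)] Suc.prems(1) unfolding J_def by blast
    obtain s where s: "s \<in> carrier R" "s \<notin> P" "s \<otimes> (w \<otimes> a) \<in> K \<cdot> ideal_power R J (Suc k)"
      using Suc.prems(2) by (metis satE)
    obtain e f where ef: "e \<in> K \<cdot> ideal_power R J' (Suc k)" "f \<in> K \<cdot> ideal_power R J k"
      "s \<otimes> (w \<otimes> a) = e \<oplus> x \<otimes> f"
      using prod_power_adjoin_decompose[OF J' c(2) K(1)] s(3) unfolding J_def by blast
    have ac: "a \<in> carrier R" "a0 \<in> carrier R" "a1 \<in> carrier R" "e \<in> carrier R" "f \<in> carrier R"
      using Suc.prems(1) a(1,2) ef(1,2) ideal_basic(7)[OF pJ] ideal_basic(7)[OF pJ']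
        ideal_basic(7)[OF iK] ideal_basic(7)[OF iK'] by blast+
    have eJ': "e \<in> ideal_power R J' (Suc k)"
      using ef(1) ideal_prod_inter[OF K(1) pJ'] by blast
    \<comment> \<open>Comparing the two expressions for \<open>s w a\<close> isolates a multiple of
      \<open>x\<close> in the power of \<open>J'\<close>. Cancelling \<open>x\<close> gives
      \<open>s w a1 = f\<close> modulo that power, which is contained in the product of
      \<open>K\<close> with the \<open>k\<close>-th power of \<open>J\<close>.\<close>
    have "x \<otimes> (s \<otimes> w \<otimes> a1 \<ominus> f) = s \<otimes> (w \<otimes> (a0 \<oplus> x \<otimes> a1)) \<ominus> x \<otimes> f \<ominus> s \<otimes> w \<otimes> a0"
      using c(2) s(1) w(1) ac by algebra
    also have "\<dots> = e \<ominus> s \<otimes> w \<otimes> a0"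
      unfolding a(3)[symmetric] ef(3) using c(2) s(1) w(1) ac by algebra
    also have "\<dots> \<in> ideal_power R J' (Suc k)"
      using ideal_basic(5,8)[OF pJ'] eJ' a(1) s(1) w(1) by simp
    finally obtain t where t: "t \<in> carrier R" "t \<notin> P"
      "t \<otimes> (s \<otimes> w \<otimes> a1 \<ominus> f) \<in> ideal_power R J' (Suc k)"
      using regE[OF xreg P ideal_basic(1)[OF pJ']] s(1) w(1) ac by (metis m_closed minus_closed)
    have "ideal_power R J' (Suc k) \<subseteq> K \<cdot> ideal_power R J k"
      unfolding ideal_power_Suc'[OF J']
      by (intro ideal_prod_mono ideal_power_mono JJ subset_trans[OF JJ(1) K(2)])
    then have "t \<otimes> (s \<otimes> w \<otimes> a1 \<ominus> f) \<oplus> t \<otimes> f \<in> K \<cdot> ideal_power R J k"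
      using t(3) ideal_basic(3,5)[OF iK] ef(2) t(1) by blast
    moreover have "t \<otimes> (s \<otimes> w \<otimes> a1 \<ominus> f) \<oplus> t \<otimes> f = (t \<otimes> s) \<otimes> (w \<otimes> a1)"
      using t(1) s(1) w(1) ac by algebra
    ultimately have "w \<otimes> a1 \<in> sat R P (K \<cdot> ideal_power R J k)"
      using satI[of "w \<otimes> a1" "t \<otimes> s"] primeideal_basic(5)[OF P t(1) s(1) t(2) s(2)] t(1) s(1) w(1) ac
      by simp
    then have "a1 \<in> sat R P (K \<cdot> ideal_power R J k)" using Suc.IH[OF a(2)] by blast
    then obtain v where v: "v \<in> carrier R" "v \<notin> P" "v \<otimes> a1 \<in> K \<cdot> ideal_power R J k"
      by (metis satE)
    have xva1: "x \<otimes> (v \<otimes> a1) \<in> K \<cdot> ideal_power R J (Suc k)"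
    proof -
      have "x \<otimes> (v \<otimes> a1) \<in> J \<cdot> (K \<cdot> ideal_power R J k)"
        using JJ(2) v(3) by (rule mem_ideal_prodI)
      also have "\<dots> = K \<cdot> (J \<cdot> ideal_power R J k)"
        using ideal_prod_assoc[OF J K(1) pJ] ideal_prod_assoc[OF K(1) J pJ]
          ideal_prod_commute[OF J K(1)] by simp
      finally show ?thesis by (simp add: ideal_power_Suc'[OF J])
    qed
    \<comment> \<open>With \<open>a1\<close> settled, \<open>w v a0\<close> alone lies in the
      product of \<open>K\<close> with the power of \<open>J\<close>. A second decomposition
      improves \<open>J\<close> to \<open>J'\<close>: in its remainder \<open>x f'\<close>,
      cancelling \<open>x\<close> puts \<open>f'\<close> into the power of \<open>J'\<close>, and
      \<open>x\<close> itself belongs to \<open>K\<close>.\<close>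
    have "w \<otimes> (v \<otimes> a0) = v \<otimes> (w \<otimes> (a0 \<oplus> x \<otimes> a1)) \<ominus> w \<otimes> (x \<otimes> (v \<otimes> a1))"
      using w(1) v(1) ac c(2) by algebra
    also have "\<dots> = v \<otimes> (w \<otimes> a) \<ominus> w \<otimes> (x \<otimes> (v \<otimes> a1))" using a(3) by simp
    also have "\<dots> \<in> sat R P (K \<cdot> ideal_power R J (Suc k))"
      by (rule ideal_basic(8)[OF sat_ideal[OF P iK] ideal_basic(5)[OF sat_ideal[OF P iK] Suc.prems(2) v(1)]
          subsetD[OF subset_sat[OF P ideal_basic(1)[OF iK]] ideal_basic(5)[OF iK xva1 w(1)]]])
    finally obtain s' where s': "s' \<in> carrier R" "s' \<notin> P"
      "s' \<otimes> (w \<otimes> (v \<otimes> a0)) \<in> K \<cdot> ideal_power R J (Suc k)" by (metis satE)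
    obtain e' f' where ef': "e' \<in> K \<cdot> ideal_power R J' (Suc k)" "f' \<in> K \<cdot> ideal_power R J k"
      "s' \<otimes> (w \<otimes> (v \<otimes> a0)) = e' \<oplus> x \<otimes> f'"
      using prod_power_adjoin_decompose[OF J' c(2) K(1)] s'(3) unfolding J_def by blast
    have ec': "e' \<in> carrier R" "f' \<in> carrier R"
      using ef'(1,2) ideal_basic(7)[OF iK] ideal_basic(7)[OF iK'] by blast+
    have "x \<otimes> f' = (e' \<oplus> x \<otimes> f') \<ominus> e'" using ec' c(2) by algebra
    also have "\<dots> = s' \<otimes> w \<otimes> v \<otimes> a0 \<ominus> e'"
      unfolding ef'(3)[symmetric] using ec' s'(1) w(1) v(1) ac by algebra
    also have "\<dots> \<in> ideal_power R J' (Suc k)"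
    proof (rule ideal_basic(8)[OF pJ' ideal_basic(5)[OF pJ' a(1)]])
      show "e' \<in> ideal_power R J' (Suc k)" using ef'(1) ideal_prod_inter[OF K(1) pJ'] by blast
    qed (use s'(1) w(1) v(1) in simp)
    finally obtain t' where t': "t' \<in> carrier R" "t' \<notin> P" "t' \<otimes> f' \<in> ideal_power R J' (Suc k)"
      using regE[OF xreg P ideal_basic(1)[OF pJ'] ec'(2)] by metis
    have "(t' \<otimes> s') \<otimes> (w \<otimes> (v \<otimes> a0)) = t' \<otimes> (s' \<otimes> (w \<otimes> (v \<otimes> a0)))"
      using t'(1) s'(1) w(1) v(1) ac by algebra
    also have "\<dots> = t' \<otimes> e' \<oplus> x \<otimes> (t' \<otimes> f')"
      unfolding ef'(3) using t'(1) ec' c(2) by algebra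
    also have "\<dots> \<in> K \<cdot> ideal_power R J' (Suc k)"
      by (rule ideal_basic(3)[OF iK' ideal_basic(5)[OF iK' ef'(1) t'(1)]
            mem_ideal_prodI[OF subsetD[OF K(2) JJ(2)] t'(3)]])
    finally have "w \<otimes> (v \<otimes> a0) \<in> sat R P (K \<cdot> ideal_power R J' (Suc k))"
      using satI[of "w \<otimes> (v \<otimes> a0)" "t' \<otimes> s'"] primeideal_basic(5)[OF P t'(1) s'(1) t'(2) s'(2)]
        t'(1) s'(1) w(1) v(1) ac by simp
    moreover have "v \<otimes> a0 \<in> ideal_power R J' (Suc k)" using ideal_basic(5)[OF pJ' a(1) v(1)] .
    ultimately have "v \<otimes> a0 \<in> sat R P (K \<cdot> ideal_power R J' (Suc k))"
      using IH[OF c(1) rs(1) K(1) _ w] JJ(1) K(2) unfolding J'_def by blast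
    then have "v \<otimes> a0 \<in> sat R P (K \<cdot> ideal_power R J (Suc k))"
      using sat_mono[OF ideal_prod_mono[OF subset_refl ideal_power_mono[OF JJ(1)]]] by blast
    then have "v \<otimes> a0 \<oplus> x \<otimes> (v \<otimes> a1) \<in> sat R P (K \<cdot> ideal_power R J (Suc k))"
      by (rule ideal_basic(3)[OF sat_ideal[OF P iK] _ subsetD[OF subset_sat[OF P ideal_basic(1)[OF iK]] xva1]])
    moreover have "v \<otimes> a0 \<oplus> x \<otimes> (v \<otimes> a1) = v \<otimes> a"
      unfolding a(3) using v(1) ac c(2) by algebra
    ultimately show ?case using sat_cancel[OF P ac(1) v(1,2)] by simp
  qed
  then show ?case using snoc.prems(3-) unfolding J_eq by blast
qed

end

section \<open>Associated primes of powers\<close>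

context noetherian_cring
begin

text \<open>The generators are taken in \<open>I\<close> itself, so \<open>I\<close> and the ideal
  \<open>?J\<close> generated by them have the same saturation at \<open>Q\<close>, and so have
  their powers; this transfers the results on regular sequences to \<open>I\<close>.\<close>

lemma assprime_if_assprime_power:
  assumes Q: "primeideal Q R" and I: "ideal I R"
    and xs: "set xs \<subseteq> I" "regular_seq_at R Q {\<zero>} xs" "I \<subseteq> sat R Q (adjs R {\<zero>} xs)"
    and ass: "Q \<in> assprimes R (sat R Q (ideal_power R I m))"
  shows "Q \<in> assprimes R I"
proof -
  let ?J = "adjs R {\<zero>} xs"
  have xc: "set xs \<subseteq> carrier R" using xs(1) ideal_basic(1)[OF I] by blast
  note J = adjs_ideal[OF zeroideal xc]
  note pJ = ideal_power_ideal[OF J]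
  have JI: "?J \<subseteq> I" using adjs_basic(3)[OF zeroideal xc I] xs(1) ideal_basic(2)[OF I] by auto
  have sat_eq: "sat R Q A = sat R Q B" if "B \<subseteq> A" "A \<subseteq> sat R Q B" "ideal B R" for A B
    using sat_mono[OF that(1)] sat_mono[OF that(2)] sat_idem[OF Q ideal_basic(1)[OF that(3)]]
    by (metis subset_antisym)
  have eq1: "sat R Q I = sat R Q ?J" by (rule sat_eq[OF JI xs(3) J])
  have eqm: "sat R Q (ideal_power R I m) = sat R Q (ideal_power R ?J m)"
    by (rule sat_eq[OF ideal_power_mono[OF JI] ideal_power_sat[OF Q I J xs(3)] pJ])
  have "Q \<in> assprimes R (sat R Q ?J)"
  proof (rule ccontr)
    assume "\<not> ?thesis"
    then obtain w where w: "w \<in> Q" "regular_at R Q ?J w"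
      using ex_common_reg[OF Q, of "{?J}"] J by auto
    have wc: "w \<in> carrier R" using w(1) primeideal_basic(4)[OF Q] by blast
    have "regular_at R Q (ideal_power R ?J m) w"
      by (rule reg_power_of_graded[OF Q J wc])
        (rule regs_graded[OF Q xc xs(2) J subset_refl wc w(2)])
    then show False using reg_notin_assprime[OF ass[unfolded eqm]] w(1) by blast
  qed
  then show ?thesis using assprime_of_sat[OF Q I] eq1 by simp
qed

end

section \<open>Determinants\<close>

context cring
begin

lemma finsum_in_ideal:
  assumes H: "ideal H R" and "\<And>i. i \<in> F \<Longrightarrow> f i \<in> H"
  shows "(\<Oplus>i\<in>F. f i) \<in> H"
proof (cases "finite F")
  case True
  then show ?thesis
    using assms(2)
  proof (induction F)
    case empty
    then show ?case using ideal_basic(2)[OF H] by simp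
  next
    case (insert i F)
    then have "f \<in> F \<rightarrow> carrier R" "f i \<in> carrier R" using ideal_basic(7)[OF H] by blast+
    then show ?case using insert ideal_basic(3)[OF H] by simp
  qed
next
  case False
  then show ?thesis using ideal_basic(2)[OF H] by (simp add: finsum_infinite)
qed

definition signed :: "(nat \<Rightarrow> nat) \<Rightarrow> 'a \<Rightarrow> 'a"
  where "signed \<sigma> t = (if evenperm \<sigma> then t else \<ominus> t)"

lemma signed_closed [simp]: "t \<in> carrier R \<Longrightarrow> signed \<sigma> t \<in> carrier R"
  by (simp add: signed_def)

lemma ring_det_signed:
  "ring_det R k B = (\<Oplus>\<sigma>\<in>{\<sigma>. \<sigma> permutes {..<k}}. signed \<sigma> (\<Otimes>i\<in>{..<k}. B i (\<sigma> i)))"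
  by (simp add: ring_det_def signed_def Let_def)

lemma permutes_lessThan: "\<sigma> permutes {..<k} \<Longrightarrow> i < k \<Longrightarrow> \<sigma> i < (k::nat)"
  using permutes_in_image[of \<sigma> "{..<k}" i] by simp

lemma ring_det_term_closed:
  fixes k :: nat
  assumes "\<forall>i<k. \<forall>j<k. B i j \<in> carrier R" "\<sigma> permutes {..<k}"
  shows "(\<Otimes>i\<in>{..<k}. B i (\<sigma> i)) \<in> carrier R"
  using assms(1) permutes_lessThan[OF assms(2)] by (intro finprod_closed) auto

lemma ring_det_closed:
  assumes "\<forall>i<k. \<forall>j<k. B i j \<in> carrier R"
  shows "ring_det R k B \<in> carrier R"
  unfolding ring_det_signed
  using ring_det_term_closed[OF assms] by (intro finsum_closed) auto

lemma ring_det_cong: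
  assumes "\<forall>i<k. \<forall>j<k. B i j = C i j"
    "\<forall>i<k. \<forall>j<k. C i j \<in> carrier R"
  shows "ring_det R k B = ring_det R k C"
  unfolding ring_det_signed
proof (rule finsum_cong')
  show "(\<lambda>\<sigma>. signed \<sigma> (\<Otimes>i\<in>{..<k}. C i (\<sigma> i))) \<in> {\<sigma>. \<sigma> permutes {..<k}} \<rightarrow> carrier R"
    using ring_det_term_closed[OF assms(2)] by auto
  fix \<sigma> assume "\<sigma> \<in> {\<sigma>. \<sigma> permutes {..<k}}"
  then have \<sigma>: "\<sigma> permutes {..<k}" by simp
  have "(\<Otimes>i\<in>{..<k}. B i (\<sigma> i)) = (\<Otimes>i\<in>{..<k}. C i (\<sigma> i))"
    using assms permutes_lessThan[OF \<sigma>] by (intro finprod_cong') auto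
  then show "signed \<sigma> (\<Otimes>i\<in>{..<k}. B i (\<sigma> i)) = signed \<sigma> (\<Otimes>i\<in>{..<k}. C i (\<sigma> i))"
    by simp
qed simp

text \<open>Reindexing by inverse permutations exchanges rows and columns and preserves the
  signs.\<close>

lemma ring_det_transpose:
  assumes B: "\<forall>i<k. \<forall>j<k. B i j \<in> carrier R"
  shows "ring_det R k (\<lambda>i j. B j i) = ring_det R k B"
proof -
  let ?S = "{\<sigma>. \<sigma> permutes {..<k}}"
  let ?f = "\<lambda>\<sigma>. signed \<sigma> (\<Otimes>i\<in>{..<k}. B i (\<sigma> i))"
  have eq: "signed \<sigma> (\<Otimes>i\<in>{..<k}. B (\<sigma> i) i) = ?f (inv_into UNIV \<sigma>)" if "\<sigma> permutes {..<k}" for \<sigma>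
  proof -
    have i: "inv_into UNIV \<sigma> permutes {..<k}" by (rule permutes_inv[OF that])
    have "(\<Otimes>i\<in>\<sigma> ` {..<k}. B i (inv_into UNIV \<sigma> i)) = (\<Otimes>i\<in>{..<k}. B (\<sigma> i) (inv_into UNIV \<sigma> (\<sigma> i)))"
      using permutes_lessThan[OF i] permutes_inj_on[OF that] permutes_image[OF that] B
      by (intro finprod_reindex) auto
    then have "(\<Otimes>i\<in>{..<k}. B i (inv_into UNIV \<sigma> i)) = (\<Otimes>i\<in>{..<k}. B (\<sigma> i) i)"
      using permutes_image[OF that] permutes_inverses(2)[OF that] by simp
    moreover have "evenperm (inv_into UNIV \<sigma>) = evenperm \<sigma>"
      using that by (intro evenperm_inv) (auto intro: permutes_imp_permutation)
    ultimately show ?thesis by (simp add: signed_def)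
  qed
  have "ring_det R k (\<lambda>i j. B j i) = (\<Oplus>\<sigma>\<in>?S. ?f (inv_into UNIV \<sigma>))"
    unfolding ring_det_signed
    using eq ring_det_term_closed[OF B permutes_inv] by (intro finsum_cong') auto
  also have "\<dots> = (\<Oplus>\<sigma>\<in>inv_into UNIV ` ?S. ?f \<sigma>)"
  proof (rule finsum_reindex[symmetric])
    show "?f \<in> inv_into UNIV ` ?S \<rightarrow> carrier R"
      using ring_det_term_closed[OF B permutes_inv] by auto
    show "inj_on (inv_into UNIV) ?S"
      by (rule inj_onI) (metis mem_Collect_eq permutes_inv_inv)
  qed
  also have "inv_into UNIV ` ?S = ?S"
    using image_inverse_permutations[of "{..<k}"] by (auto simp: Setcompr_eq_image)
  finally show ?thesis unfolding ring_det_signed .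
qed

text \<open>The coefficients \<open>C\<close> are fixed before the row \<open>v\<close> is chosen,
  so linearity in one row and membership in ideals follow from the same formula.\<close>

lemma ring_det_row_expansion:
  assumes B: "\<forall>i<k. \<forall>j<k. B i j \<in> carrier R" and a: "a < k"
  obtains C :: "(nat \<Rightarrow> nat) \<Rightarrow> 'a" where "\<And>\<sigma>. \<sigma> permutes {..<k} \<Longrightarrow> C \<sigma> \<in> carrier R"
    "\<And>v. \<forall>j<k. v j \<in> carrier R \<Longrightarrow>
      ring_det R k (B(a := v)) = (\<Oplus>\<sigma>\<in>{\<sigma>. \<sigma> permutes {..<k}}. v (\<sigma> a) \<otimes> C \<sigma>)"
proof -
  define C where "C \<sigma> = signed \<sigma> (\<Otimes>i\<in>{..<k} - {a}. B i (\<sigma> i))" for \<sigma>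
  have c: "(\<Otimes>i\<in>{..<k} - {a}. B i (\<sigma> i)) \<in> carrier R" if "\<sigma> permutes {..<k}" for \<sigma>
    using permutes_lessThan[OF that] B by (intro finprod_closed) auto
  have "ring_det R k (B(a := v)) = (\<Oplus>\<sigma>\<in>{\<sigma>. \<sigma> permutes {..<k}}. v (\<sigma> a) \<otimes> C \<sigma>)"
    if v: "\<forall>j<k. v j \<in> carrier R" for v
    unfolding ring_det_signed
  proof (rule finsum_cong')
    show "(\<lambda>\<sigma>. v (\<sigma> a) \<otimes> C \<sigma>) \<in> {\<sigma>. \<sigma> permutes {..<k}} \<rightarrow> carrier R"
      using c v a permutes_lessThan by (auto simp: C_def)
    fix \<sigma> assume "\<sigma> \<in> {\<sigma>. \<sigma> permutes {..<k}}"
    then have \<sigma>: "\<sigma> permutes {..<k}" by simp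
    have va: "v (\<sigma> a) \<in> carrier R" using v permutes_lessThan[OF \<sigma> a] by blast
    have ins: "{..<k} = insert a ({..<k} - {a})" using a by auto
    have "(\<Otimes>i\<in>{..<k}. (B(a := v)) i (\<sigma> i)) = (\<Otimes>i\<in>insert a ({..<k} - {a}). (B(a := v)) i (\<sigma> i))"
      using ins by simp
    also have "\<dots> = v (\<sigma> a) \<otimes> (\<Otimes>i\<in>{..<k} - {a}. (B(a := v)) i (\<sigma> i))"
      using va B permutes_lessThan[OF \<sigma>] by (subst finprod_insert) auto
    also have "(\<Otimes>i\<in>{..<k} - {a}. (B(a := v)) i (\<sigma> i)) = (\<Otimes>i\<in>{..<k} - {a}. B i (\<sigma> i))"
      using B permutes_lessThan[OF \<sigma>] by (intro finprod_cong') auto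
    finally show "signed \<sigma> (\<Otimes>i\<in>{..<k}. (B(a := v)) i (\<sigma> i)) = v (\<sigma> a) \<otimes> C \<sigma>"
      using va c[OF \<sigma>] by (simp add: signed_def C_def r_minus)
  qed simp
  moreover have "C \<sigma> \<in> carrier R" if "\<sigma> permutes {..<k}" for \<sigma> using c[OF that] by (simp add: C_def)
  ultimately show thesis using that by blast
qed

lemma ring_det_row_add:
  assumes B: "\<forall>i<k. \<forall>j<k. B i j \<in> carrier R" and a: "a < k"
    and v: "\<forall>j<k. v j \<in> carrier R" and w: "\<forall>j<k. w j \<in> carrier R"
  shows "ring_det R k (B(a := \<lambda>j. v j \<oplus> w j)) = ring_det R k (B(a := v)) \<oplus> ring_det R k (B(a := w))"
proof -
  obtain C where C: "\<And>\<sigma>. \<sigma> permutes {..<k} \<Longrightarrow> C \<sigma> \<in> carrier R"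
    "\<And>v. \<forall>j<k. v j \<in> carrier R \<Longrightarrow>
      ring_det R k (B(a := v)) = (\<Oplus>\<sigma>\<in>{\<sigma>. \<sigma> permutes {..<k}}. v (\<sigma> a) \<otimes> C \<sigma>)"
    using ring_det_row_expansion[OF B a] by blast
  have vw: "v (\<sigma> a) \<in> carrier R" "w (\<sigma> a) \<in> carrier R" if "\<sigma> permutes {..<k}" for \<sigma>
    using v w permutes_lessThan[OF that a] by auto
  have "ring_det R k (B(a := \<lambda>j. v j \<oplus> w j))
      = (\<Oplus>\<sigma>\<in>{\<sigma>. \<sigma> permutes {..<k}}. (v (\<sigma> a) \<oplus> w (\<sigma> a)) \<otimes> C \<sigma>)"
    using v w by (intro C(2)) auto
  also have "\<dots> = (\<Oplus>\<sigma>\<in>{\<sigma>. \<sigma> permutes {..<k}}. v (\<sigma> a) \<otimes> C \<sigma> \<oplus> w (\<sigma> a) \<otimes> C \<sigma>)"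
    using C(1) vw by (intro finsum_cong') (auto simp: l_distr)
  also have "\<dots> = ring_det R k (B(a := v)) \<oplus> ring_det R k (B(a := w))"
    using C vw v w by (simp add: finsum_addf Pi_def)
  finally show ?thesis .
qed

lemma ring_det_row_smult:
  assumes B: "\<forall>i<k. \<forall>j<k. B i j \<in> carrier R" and a: "a < k"
    and v: "\<forall>j<k. v j \<in> carrier R" and c: "c \<in> carrier R"
  shows "ring_det R k (B(a := \<lambda>j. c \<otimes> v j)) = c \<otimes> ring_det R k (B(a := v))"
proof -
  obtain C where C: "\<And>\<sigma>. \<sigma> permutes {..<k} \<Longrightarrow> C \<sigma> \<in> carrier R"
    "\<And>v. \<forall>j<k. v j \<in> carrier R \<Longrightarrow>
      ring_det R k (B(a := v)) = (\<Oplus>\<sigma>\<in>{\<sigma>. \<sigma> permutes {..<k}}. v (\<sigma> a) \<otimes> C \<sigma>)"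
    using ring_det_row_expansion[OF B a] by blast
  have va: "v (\<sigma> a) \<in> carrier R" if "\<sigma> permutes {..<k}" for \<sigma>
    using v permutes_lessThan[OF that a] by auto
  have "ring_det R k (B(a := \<lambda>j. c \<otimes> v j))
      = (\<Oplus>\<sigma>\<in>{\<sigma>. \<sigma> permutes {..<k}}. (c \<otimes> v (\<sigma> a)) \<otimes> C \<sigma>)"
    using v c by (intro C(2)) auto
  also have "\<dots> = (\<Oplus>\<sigma>\<in>{\<sigma>. \<sigma> permutes {..<k}}. c \<otimes> (v (\<sigma> a) \<otimes> C \<sigma>))"
    using C(1) va c by (intro finsum_cong') (auto simp: m_assoc)
  also have "\<dots> = c \<otimes> (\<Oplus>\<sigma>\<in>{\<sigma>. \<sigma> permutes {..<k}}. v (\<sigma> a) \<otimes> C \<sigma>)"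
    using C(1) va c by (intro finsum_rdistr[symmetric]) (auto simp: finite_permutations)
  finally show ?thesis using C(2)[of v] v by simp
qed

lemma ring_det_row_in_ideal:
  assumes B: "\<forall>i<k. \<forall>j<k. B i j \<in> carrier R" and a: "a < k"
    and H: "ideal H R" and v: "\<forall>j<k. v j \<in> H"
  shows "ring_det R k (B(a := v)) \<in> H"
proof -
  obtain C where C: "\<And>\<sigma>. \<sigma> permutes {..<k} \<Longrightarrow> C \<sigma> \<in> carrier R"
    "\<And>v. \<forall>j<k. v j \<in> carrier R \<Longrightarrow>
      ring_det R k (B(a := v)) = (\<Oplus>\<sigma>\<in>{\<sigma>. \<sigma> permutes {..<k}}. v (\<sigma> a) \<otimes> C \<sigma>)"
    using ring_det_row_expansion[OF B a] by blast
  have "(\<Oplus>\<sigma>\<in>{\<sigma>. \<sigma> permutes {..<k}}. v (\<sigma> a) \<otimes> C \<sigma>) \<in> H"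
    using C(1) v permutes_lessThan[OF _ a] ideal_basic(6)[OF H] by (intro finsum_in_ideal[OF H]) auto
  then show ?thesis using C(2)[of v] v ideal_basic(7)[OF H] by simp
qed

lemma ring_det_row_zero:
  assumes "\<forall>i<k. \<forall>j<k. B i j \<in> carrier R" "a < k"
  shows "ring_det R k (B(a := \<lambda>j. \<zero>)) = \<zero>"
  using ring_det_row_in_ideal[OF assms zeroideal, of "\<lambda>j. \<zero>"] by simp

text \<open>
  Composition with the transposition of the two equal rows matches the even permutations with
  the odd ones; this argument also works in characteristic two.
\<close>

lemma ring_det_equal_rows:
  assumes B: "\<forall>i<k. \<forall>j<k. B i j \<in> carrier R"
    and ab: "a < k" "b < k" "a \<noteq> b" "\<forall>j<k. B a j = B b j"
  shows "ring_det R k B = \<zero>"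
proof -
  let ?S = "{\<sigma>. \<sigma> permutes {..<k}}"
  let ?E = "{\<sigma>. \<sigma> permutes {..<k} \<and> evenperm \<sigma>}" and ?O = "{\<sigma>. \<sigma> permutes {..<k} \<and> \<not> evenperm \<sigma>}"
  let ?t = "\<lambda>\<sigma>. \<Otimes>i\<in>{..<k}. B i (\<sigma> i)"
  let ?\<tau> = "transpose a b"
  note tc = ring_det_term_closed[OF B]
  have fin: "finite ?S" by (simp add: finite_permutations)
  have finE: "finite ?E" "finite ?O" using fin by (auto intro: rev_finite_subset)
  have \<tau>: "?\<tau> permutes {..<k}" using ab by (intro permutes_swap_id) auto
  have \<tau>2: "?\<tau> \<circ> ?\<tau> = id" by simp
  have ev: "evenperm (\<sigma> \<circ> ?\<tau>) = (\<not> evenperm \<sigma>)" if "\<sigma> permutes {..<k}" for \<sigma>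
    using evenperm_comp[of \<sigma> ?\<tau>] permutes_imp_permutation[OF _ that] ab(3)
    by (simp add: evenperm_swap permutation_swap_id)
  have t_eq: "?t (\<sigma> \<circ> ?\<tau>) = ?t \<sigma>" if \<sigma>: "\<sigma> permutes {..<k}" for \<sigma>
  proof -
    have "?t \<sigma> = (\<Otimes>i\<in>?\<tau> ` {..<k}. B i (\<sigma> i))" using permutes_image[OF \<tau>] by simp
    also have "\<dots> = (\<Otimes>i\<in>{..<k}. B (?\<tau> i) (\<sigma> (?\<tau> i)))"
      using permutes_image[OF \<tau>] permutes_lessThan[OF \<sigma>] B
      by (intro finprod_reindex) (auto intro: permutes_inj_on[OF \<tau>])
    also have "\<dots> = (\<Otimes>i\<in>{..<k}. B i ((\<sigma> \<circ> ?\<tau>) i))"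
    proof (rule finprod_cong')
      show "(\<lambda>i. B i ((\<sigma> \<circ> ?\<tau>) i)) \<in> {..<k} \<rightarrow> carrier R"
        using B permutes_lessThan[OF \<sigma>] permutes_lessThan[OF \<tau>] by auto
      fix i assume "i \<in> {..<k}"
      then have "\<sigma> (?\<tau> i) < k" using permutes_lessThan[OF \<sigma>] permutes_lessThan[OF \<tau>] by auto
      then show "B (?\<tau> i) (\<sigma> (?\<tau> i)) = B i ((\<sigma> \<circ> ?\<tau>) i)"
        using ab(4) by (cases "i = a"; cases "i = b") auto
    qed simp
    finally show ?thesis by simp
  qed
  have E: "(\<lambda>\<sigma>. \<sigma> \<circ> ?\<tau>) ` ?E = ?O"
  proof (intro equalityI subsetI)
    fix \<sigma> assume "\<sigma> \<in> (\<lambda>\<sigma>. \<sigma> \<circ> ?\<tau>) ` ?E"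
    then show "\<sigma> \<in> ?O" using ev permutes_compose[OF \<tau>] by auto
  next
    fix \<sigma> assume \<sigma>: "\<sigma> \<in> ?O"
    then have "\<sigma> \<circ> ?\<tau> \<in> ?E" using ev permutes_compose[OF \<tau>] by auto
    moreover have "\<sigma> = (\<sigma> \<circ> ?\<tau>) \<circ> ?\<tau>" by (simp add: comp_assoc)
    ultimately show "\<sigma> \<in> (\<lambda>\<sigma>. \<sigma> \<circ> ?\<tau>) ` ?E" by blast
  qed
  have inj: "inj_on (\<lambda>\<sigma>. \<sigma> \<circ> ?\<tau>) ?E"
    by (rule inj_onI) (metis comp_assoc \<tau>2 comp_id)
  have S: "?S = ?E \<union> ?O" by auto
  have "ring_det R k B = (\<Oplus>\<sigma>\<in>?E. signed \<sigma> (?t \<sigma>)) \<oplus> (\<Oplus>\<sigma>\<in>?O. signed \<sigma> (?t \<sigma>))"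
    unfolding ring_det_signed S using finE tc by (intro finsum_Un_disjoint) auto
  also have "(\<Oplus>\<sigma>\<in>?E. signed \<sigma> (?t \<sigma>)) = (\<Oplus>\<sigma>\<in>?E. ?t \<sigma>)"
    using tc by (intro finsum_cong') (auto simp: signed_def)
  also have "(\<Oplus>\<sigma>\<in>?O. signed \<sigma> (?t \<sigma>)) = (\<Oplus>\<sigma>\<in>?E. signed (\<sigma> \<circ> ?\<tau>) (?t (\<sigma> \<circ> ?\<tau>)))"
    using finsum_reindex[OF _ inj, of "\<lambda>\<sigma>. signed \<sigma> (?t \<sigma>)"] tc unfolding E by simp
  also have "\<dots> = (\<Oplus>\<sigma>\<in>?E. \<ominus> (?t \<sigma>))"
    using tc ev t_eq by (intro finsum_cong') (auto simp: signed_def)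
  also have "(\<Oplus>\<sigma>\<in>?E. ?t \<sigma>) \<oplus> (\<Oplus>\<sigma>\<in>?E. \<ominus> (?t \<sigma>)) = (\<Oplus>\<sigma>\<in>?E. ?t \<sigma> \<oplus> \<ominus> (?t \<sigma>))"
    using tc by (intro finsum_addf[symmetric]) auto
  also have "\<dots> = (\<Oplus>\<sigma>\<in>?E. \<zero>)" using tc by (intro finsum_cong') (auto simp: r_neg)
  finally show ?thesis by simp
qed

text \<open>Cramer's rule modulo \<open>H\<close> by row operations: replacing row \<open>a\<close>
  by the combination of all rows with coefficients \<open>h i\<close> multiplies the determinant by
  \<open>h a\<close> and puts every entry of that row into \<open>H\<close>.\<close>

lemma cramer_ideal:
  assumes B: "\<forall>i<k. \<forall>j<k. B i j \<in> carrier R"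
    and h: "\<forall>i<k. h i \<in> carrier R" and H: "ideal H R"
    and rel: "\<forall>j<k. (\<Oplus>i\<in>{..<k}. h i \<otimes> B i j) \<in> H" and a: "a < k"
  shows "ring_det R k B \<otimes> h a \<in> H"
proof -
  let ?D = "\<lambda>v. ring_det R k (B(a := v))"
  let ?s = "\<lambda>F j. \<Oplus>i\<in>F. h i \<otimes> B i j"
  have sc: "?s F j \<in> carrier R" if "F \<subseteq> {..<k}" "j < k" for F j
    using that B h by (intro finsum_closed) auto
  \<comment> \<open>The rows other than \<open>a\<close> contribute nothing, as each of them would
    occur twice.\<close>
  have zero: "?D (?s F) = \<zero>" if "finite F" "F \<subseteq> {..<k} - {a}" for F
    using that
  proof (induction F)
    case empty
    then show ?case using ring_det_row_zero[OF B a] by (simp add: fun_upd_def)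
  next
    case (insert i F)
    have i: "i < k" "i \<noteq> a" "F \<subseteq> {..<k}" using insert.prems by auto
    have "?D (?s (insert i F)) = ?D (\<lambda>j. h i \<otimes> B i j \<oplus> ?s F j)"
    proof (rule ring_det_cong; intro allI impI)
      fix i' j assume ij: "i' < k" "j < k"
      have "?s (insert i F) j = h i \<otimes> B i j \<oplus> ?s F j"
        using insert.hyps i ij B h by (intro finsum_insert) auto
      then show "(B(a := ?s (insert i F))) i' j = (B(a := \<lambda>j. h i \<otimes> B i j \<oplus> ?s F j)) i' j" by simp
      show "(B(a := \<lambda>j. h i \<otimes> B i j \<oplus> ?s F j)) i' j \<in> carrier R"
        using B h i sc[of F j] ij by simp
    qed
    also have "\<dots> = h i \<otimes> ?D (B i) \<oplus> ?D (?s F)"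
      using ring_det_row_add[OF B a, of "\<lambda>j. h i \<otimes> B i j" "?s F"] ring_det_row_smult[OF B a, of "B i" "h i"]
        B h i sc by simp
    also have "?D (B i) = \<zero>"
      using i a B by (intro ring_det_equal_rows[of k _ a i]) auto
    finally show ?case using insert h i(1) by simp
  qed
  have ka: "{..<k} = insert a ({..<k} - {a})" using a by auto
  have "?D (?s {..<k}) = ?D (\<lambda>j. h a \<otimes> B a j \<oplus> ?s ({..<k} - {a}) j)"
  proof (rule ring_det_cong; intro allI impI)
    fix i' j assume ij: "i' < k" "j < k"
    have "?s {..<k} j = ?s (insert a ({..<k} - {a})) j" using ka by simp
    also have "\<dots> = h a \<otimes> B a j \<oplus> ?s ({..<k} - {a}) j"
      using a ij B h by (intro finsum_insert) auto
    finally show "(B(a := ?s {..<k})) i' j = (B(a := \<lambda>j. h a \<otimes> B a j \<oplus> ?s ({..<k} - {a}) j)) i' j"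
      by simp
    show "(B(a := \<lambda>j. h a \<otimes> B a j \<oplus> ?s ({..<k} - {a}) j)) i' j \<in> carrier R"
      using B h a sc[of "{..<k} - {a}" j] ij by auto
  qed
  also have "\<dots> = h a \<otimes> ?D (B a) \<oplus> ?D (?s ({..<k} - {a}))"
    using ring_det_row_add[OF B a, of "\<lambda>j. h a \<otimes> B a j" "?s ({..<k} - {a})"]
      ring_det_row_smult[OF B a, of "B a" "h a"] B h a sc[of "{..<k} - {a}"] by simp
  also have "?D (?s ({..<k} - {a})) = \<zero>" by (rule zero) auto
  also have "?D (B a) = ring_det R k B" by simp
  finally have "?D (?s {..<k}) = h a \<otimes> ring_det R k B"
    using h a ring_det_closed[OF B] by (simp add: fun_upd_def)
  moreover have "?D (?s {..<k}) \<in> H" by (rule ring_det_row_in_ideal[OF B a H rel])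
  ultimately show ?thesis using m_comm[of "h a" "ring_det R k B"] h a ring_det_closed[OF B] by simp
qed

text \<open>Composition with \<open>\<tau>\<close> permutes the summands of the expansion and
  changes every sign by that of \<open>\<tau>\<close>.\<close>

lemma ring_det_permute_columns:
  assumes B: "\<forall>i<k. \<forall>j<k. B i j \<in> carrier R" and \<tau>: "\<tau> permutes {..<k}"
  shows "ring_det R k (\<lambda>i j. B i (\<tau> j)) = signed \<tau> (ring_det R k B)"
proof -
  let ?S = "{\<sigma>. \<sigma> permutes {..<k}}"
  let ?t = "\<lambda>\<sigma>. \<Otimes>i\<in>{..<k}. B i (\<sigma> i)"
  note tc = ring_det_term_closed[OF B]
  have comp: "\<tau> \<circ> \<sigma> permutes {..<k}" if "\<sigma> permutes {..<k}" for \<sigma>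
    using permutes_compose[OF that \<tau>] .
  have ev: "evenperm (\<tau> \<circ> \<sigma>) \<longleftrightarrow> (evenperm \<tau> \<longleftrightarrow> evenperm \<sigma>)" if "\<sigma> permutes {..<k}" for \<sigma>
    using permutes_imp_permutation[OF _ that] permutes_imp_permutation[OF _ \<tau>]
    by (intro evenperm_comp) auto
  have "ring_det R k (\<lambda>i j. B i (\<tau> j)) = (\<Oplus>\<sigma>\<in>?S. signed \<tau> (signed (\<tau> \<circ> \<sigma>) (?t (\<tau> \<circ> \<sigma>))))"
    unfolding ring_det_signed
  proof (rule finsum_cong')
    show "(\<lambda>\<sigma>. signed \<tau> (signed (\<tau> \<circ> \<sigma>) (?t (\<tau> \<circ> \<sigma>)))) \<in> ?S \<rightarrow> carrier R"
      using tc[OF comp] by auto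
    fix \<sigma> assume "\<sigma> \<in> ?S"
    then have \<sigma>: "\<sigma> permutes {..<k}" by simp
    show "signed \<sigma> (\<Otimes>i\<in>{..<k}. B i (\<tau> (\<sigma> i))) = signed \<tau> (signed (\<tau> \<circ> \<sigma>) (?t (\<tau> \<circ> \<sigma>)))"
      using tc[OF comp[OF \<sigma>]] ev[OF \<sigma>] by (auto simp: signed_def)
  qed simp
  also have "\<dots> = (\<Oplus>\<sigma>\<in>(\<circ>) \<tau> ` ?S. signed \<tau> (signed \<sigma> (?t \<sigma>)))"
  proof (rule finsum_reindex[symmetric])
    show "(\<lambda>\<sigma>. signed \<tau> (signed \<sigma> (?t \<sigma>))) \<in> (\<circ>) \<tau> ` ?S \<rightarrow> carrier R"
      using tc[OF comp] by auto
    show "inj_on ((\<circ>) \<tau>) ?S"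
      by (rule inj_onI) (metis permutes_inv_o(2)[OF \<tau>] comp_assoc id_comp)
  qed
  also have "(\<circ>) \<tau> ` ?S = ?S"
    using image_compose_permutations_left[OF \<tau>] by (auto simp: Setcompr_eq_image)
  also have "(\<Oplus>\<sigma>\<in>?S. signed \<tau> (signed \<sigma> (?t \<sigma>))) = signed \<tau> (\<Oplus>\<sigma>\<in>?S. signed \<sigma> (?t \<sigma>))"
  proof (cases "evenperm \<tau>")
    case False
    have "(\<Oplus>\<sigma>\<in>?S. \<ominus> \<one> \<otimes> signed \<sigma> (?t \<sigma>)) = \<ominus> \<one> \<otimes> (\<Oplus>\<sigma>\<in>?S. signed \<sigma> (?t \<sigma>))"
      using tc by (intro finsum_rdistr[symmetric]) (auto simp: finite_permutations)
    moreover have "(\<Oplus>\<sigma>\<in>?S. \<ominus> \<one> \<otimes> signed \<sigma> (?t \<sigma>)) = (\<Oplus>\<sigma>\<in>?S. \<ominus> signed \<sigma> (?t \<sigma>))"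
      using tc by (intro finsum_cong') (auto simp: l_minus)
    moreover have "(\<Oplus>\<sigma>\<in>?S. signed \<sigma> (?t \<sigma>)) \<in> carrier R"
      using tc by (intro finsum_closed) auto
    ultimately show ?thesis using False by (simp add: signed_def[of \<tau>] l_minus)
  qed (simp add: signed_def[of \<tau>])
  finally show ?thesis unfolding ring_det_signed .
qed

text \<open>A permutation other than the identity moves some index and so picks an entry off the
  diagonal.\<close>

lemma ring_det_diagonal:
  assumes B: "\<forall>i<k. \<forall>j<k. B i j \<in> carrier R"
    and off: "\<forall>i<k. \<forall>j<k. i \<noteq> j \<longrightarrow> B i j = \<zero>"
  shows "ring_det R k B = (\<Otimes>i\<in>{..<k}. B i i)"
proof -
  let ?S = "{\<sigma>. \<sigma> permutes {..<k}}"
  note tc = ring_det_term_closed[OF B]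
  have idS: "id \<in> ?S" by (simp add: permutes_id)
  have zero: "(\<Otimes>i\<in>{..<k}. B i (\<sigma> i)) = \<zero>" if \<sigma>: "\<sigma> permutes {..<k}" "\<sigma> \<noteq> id" for \<sigma>
  proof -
    obtain i where i: "i < k" "\<sigma> i \<noteq> i"
      using \<sigma> by (metis eq_id_iff lessThan_iff permutes_not_in)
    have "{..<k} = insert i ({..<k} - {i})" using i by auto
    then have "(\<Otimes>i\<in>{..<k}. B i (\<sigma> i)) = (\<Otimes>i\<in>insert i ({..<k} - {i}). B i (\<sigma> i))" by simp
    also have "\<dots> = B i (\<sigma> i) \<otimes> (\<Otimes>i\<in>{..<k} - {i}. B i (\<sigma> i))"
      using i B permutes_lessThan[OF \<sigma>(1)] by (intro finprod_insert) auto
    also have "B i (\<sigma> i) = \<zero>" using off i permutes_lessThan[OF \<sigma>(1)] by metis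
    also have "\<zero> \<otimes> (\<Otimes>i\<in>{..<k} - {i}. B i (\<sigma> i)) = \<zero>"
      using B permutes_lessThan[OF \<sigma>(1)] by (intro l_null finprod_closed) auto
    finally show ?thesis .
  qed
  have "ring_det R k B = (\<Oplus>\<sigma>\<in>insert id (?S - {id}). signed \<sigma> (\<Otimes>i\<in>{..<k}. B i (\<sigma> i)))"
    unfolding ring_det_signed using idS by (simp add: insert_absorb)
  also have "\<dots> = signed id (\<Otimes>i\<in>{..<k}. B i (id i))
      \<oplus> (\<Oplus>\<sigma>\<in>?S - {id}. signed \<sigma> (\<Otimes>i\<in>{..<k}. B i (\<sigma> i)))"
    using tc idS tc[of id] by (intro finsum_insert) (auto simp: finite_permutations permutes_id)
  also have "(\<Oplus>\<sigma>\<in>?S - {id}. signed \<sigma> (\<Otimes>i\<in>{..<k}. B i (\<sigma> i))) = (\<Oplus>\<sigma>\<in>?S - {id}. \<zero>)"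
    using zero by (intro finsum_cong') (auto simp: signed_def)
  finally show ?thesis using tc[of id] by (simp add: signed_def permutes_id evenperm_id)
qed

end

section \<open>Presentations and Fitting ideals\<close>

context cring
begin

lemma finsum_lessThan_Suc:
  assumes "\<forall>i<Suc n. f i \<in> carrier R"
  shows "(\<Oplus>i\<in>{..<Suc n}. f i) = (\<Oplus>i\<in>{..<n}. f i) \<oplus> f n"
proof -
  have "(\<Oplus>i\<in>{..<n}. f i) \<in> carrier R" using assms by (intro finsum_closed) auto
  then show ?thesis using assms by (simp add: lessThan_Suc a_comm)
qed

lemma mem_adjs_map_iff:
  assumes "\<forall>i<n. g i \<in> carrier R"
  shows "x \<in> adjs R {\<zero>} (map g [0..<n]) \<longleftrightarrow>
    (\<exists>v. (\<forall>i<n. v i \<in> carrier R) \<and> x = (\<Oplus>i\<in>{..<n}. v i \<otimes> g i))"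
  using assms
proof (induction n arbitrary: x)
  case (Suc n)
  let ?A = "adjs R {\<zero>} (map g [0..<n])"
  show ?case
  proof
    assume "x \<in> adjs R {\<zero>} (map g [0..<Suc n])"
    then obtain a r where ar: "a \<in> ?A" "r \<in> carrier R" "x = a \<oplus> r \<otimes> g n"
      by (auto simp: mem_adjoin)
    obtain v where v: "\<forall>i<n. v i \<in> carrier R" "a = (\<Oplus>i\<in>{..<n}. v i \<otimes> g i)"
      using Suc.IH[of a] Suc.prems ar(1) by auto
    have "(\<Oplus>i\<in>{..<Suc n}. (v(n := r)) i \<otimes> g i) = (\<Oplus>i\<in>{..<n}. (v(n := r)) i \<otimes> g i) \<oplus> r \<otimes> g n"
      using v(1) Suc.prems ar(2) by (subst finsum_lessThan_Suc) (auto simp: less_Suc_eq)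
    also have "(\<Oplus>i\<in>{..<n}. (v(n := r)) i \<otimes> g i) = a"
      unfolding v(2) using v(1) Suc.prems by (intro finsum_cong') auto
    finally show "\<exists>v. (\<forall>i<Suc n. v i \<in> carrier R) \<and> x = (\<Oplus>i\<in>{..<Suc n}. v i \<otimes> g i)"
      using v(1) ar(2,3) by (intro exI[of _ "v(n := r)"]) (auto simp: less_Suc_eq)
  next
    assume "\<exists>v. (\<forall>i<Suc n. v i \<in> carrier R) \<and> x = (\<Oplus>i\<in>{..<Suc n}. v i \<otimes> g i)"
    then obtain v where v: "\<forall>i<Suc n. v i \<in> carrier R" "x = (\<Oplus>i\<in>{..<Suc n}. v i \<otimes> g i)" by blast
    have "x = (\<Oplus>i\<in>{..<n}. v i \<otimes> g i) \<oplus> v n \<otimes> g n"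
      unfolding v(2) using v(1) Suc.prems by (intro finsum_lessThan_Suc) auto
    moreover have "(\<Oplus>i\<in>{..<n}. v i \<otimes> g i) \<in> ?A"
    proof (subst Suc.IH)
      show "\<exists>va. (\<forall>i<n. va i \<in> carrier R) \<and> (\<Oplus>i\<in>{..<n}. v i \<otimes> g i) = (\<Oplus>i\<in>{..<n}. va i \<otimes> g i)"
        using v(1) by (intro exI[of _ v]) simp
    qed (use Suc.prems in simp)
    ultimately show "x \<in> adjs R {\<zero>} (map g [0..<Suc n])"
      using v(1) by (auto simp: mem_adjoin)
  qed
qed auto

lemma mem_genideal_image_iff:
  fixes n :: nat
  assumes "\<forall>i<n. g i \<in> carrier R"
  shows "x \<in> Idl (g ` {..<n}) \<longleftrightarrow>
    (\<exists>v. (\<forall>i<n. v i \<in> carrier R) \<and> x = (\<Oplus>i\<in>{..<n}. v i \<otimes> g i))"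
proof -
  have "Idl (g ` {..<n}) = adjs R {\<zero>} (map g [0..<n])"
    using adjs_zero_eq_genideal[of "map g [0..<n]"] assms by (simp add: atLeast0LessThan image_subset_iff)
  then show ?thesis using mem_adjs_map_iff[OF assms] by simp
qed

section \<open>Presentations of an ideal as relations between its generators\<close>

lemma ideal_module_abelian_monoid:
  assumes I: "ideal I R"
  shows "abelian_monoid (ideal_module R I)"
  using ideal_basic(2,3)[OF I] ideal_basic(7)[OF I]
  by (intro abelian_monoidI) (auto simp: ideal_module_def a_ac)

lemma finsum_ideal_module:
  assumes I: "ideal I R" and F: "finite F" "\<And>i. i \<in> F \<Longrightarrow> f i \<in> I"
  shows "finsum (ideal_module R I) f F = finsum R f F"
  using F
proof (induction F)
  case empty
  interpret M: abelian_monoid "ideal_module R I" by (rule ideal_module_abelian_monoid[OF I])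
  show ?case by (simp add: ideal_module_def M.finsum_empty[unfolded ideal_module_def, simplified])
next
  case (insert i F)
  interpret M: abelian_monoid "ideal_module R I" by (rule ideal_module_abelian_monoid[OF I])
  have c: "carrier (ideal_module R I) = I" "\<And>a b. a \<oplus>\<^bsub>ideal_module R I\<^esub> b = a \<oplus> b"
    by (simp_all add: ideal_module_def)
  have fR: "f \<in> F \<rightarrow> carrier R" "f i \<in> carrier R"
    using insert.prems ideal_basic(7)[OF I] by blast+
  have fI: "f \<in> F \<rightarrow> carrier (ideal_module R I)" "f i \<in> carrier (ideal_module R I)"
    using insert.prems c by auto
  show ?case
    using M.finsum_insert[OF insert.hyps(1,2) fI] finsum_insert[OF insert.hyps(1,2) fR]
      insert.IH insert.prems c(2) by simp
qed

lemma lin_comb_ideal_module: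
  assumes I: "ideal I R" and "\<forall>i<n. g i \<in> I" "\<forall>i<n. v i \<in> carrier R"
  shows "lin_comb (ideal_module R I) n g v = (\<Oplus>i\<in>{..<n}. v i \<otimes> g i)"
proof -
  have "v i \<odot>\<^bsub>ideal_module R I\<^esub> x = v i \<otimes> x" for i x by (simp add: ideal_module_def)
  then show ?thesis
    unfolding lin_comb_def
    using finsum_ideal_module[OF I, of "{..<n}" "\<lambda>i. v i \<otimes> g i"] assms ideal_basic(5)[OF I] by simp
qed

lemma finsum_times_delta:
  fixes n :: nat
  assumes "\<forall>i<n. a i \<in> carrier R" "j < n"
  shows "(\<Oplus>i\<in>{..<n}. a i \<otimes> (if i = j then \<one> else \<zero>)) = a j"
proof -
  have "(\<Oplus>i\<in>{..<n}. a i \<otimes> (if i = j then \<one> else \<zero>)) = (\<Oplus>i\<in>{..<n}. if j = i then a i else \<zero>)"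
    using assms by (intro finsum_cong') auto
  also have "\<dots> = a j" using assms by (intro finsum_singleton) auto
  finally show ?thesis .
qed

text \<open>Exactness written out in coordinates: the columns are relations between the generators,
  and every relation is a combination of columns. Vectors are plain functions constrained on the
  index range, which spares the extensionality of \<open>free_vecs\<close>.\<close>

definition ideal_presentation ::
    "'a set \<Rightarrow> nat \<Rightarrow> nat \<Rightarrow> (nat \<Rightarrow> nat \<Rightarrow> 'a) \<Rightarrow> (nat \<Rightarrow> 'a) \<Rightarrow> bool"
  where "ideal_presentation I \<mu> q A g \<longleftrightarrow>
    (\<forall>i<\<mu>. \<forall>j<q. A i j \<in> carrier R) \<and> (\<forall>i<\<mu>. g i \<in> carrier R) \<and> I = Idl (g ` {..<\<mu>}) \<and>
    (\<forall>j<q. (\<Oplus>i\<in>{..<\<mu>}. A i j \<otimes> g i) = \<zero>) \<and>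
    (\<forall>v. (\<forall>i<\<mu>. v i \<in> carrier R) \<longrightarrow> (\<Oplus>i\<in>{..<\<mu>}. v i \<otimes> g i) = \<zero> \<longrightarrow>
      (\<exists>e. (\<forall>j<q. e j \<in> carrier R) \<and> (\<forall>i<\<mu>. v i = (\<Oplus>j\<in>{..<q}. A i j \<otimes> e j))))"

lemma presentation_imp_ideal_presentation:
  assumes I: "ideal I R" and pres: "presentation R (ideal_module R I) \<mu> q A g"
  shows "ideal_presentation I \<mu> q A g"
proof -
  let ?M = "ideal_module R I"
  have cM: "carrier ?M = I" and zM: "\<zero>\<^bsub>?M\<^esub> = \<zero>" by (simp_all add: ideal_module_def)
  have A: "\<forall>i<\<mu>. \<forall>j<q. A i j \<in> carrier R" and gI: "\<forall>i<\<mu>. g i \<in> I"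
    and surj: "lin_comb ?M \<mu> g ` free_vecs R \<mu> = I"
    and ker: "{v \<in> free_vecs R \<mu>. lin_comb ?M \<mu> g v = \<zero>} = mat_apply R \<mu> q A ` free_vecs R q"
    using pres unfolding presentation_def cM zM by auto
  have gR: "\<forall>i<\<mu>. g i \<in> carrier R" using gI ideal_basic(7)[OF I] by blast
  have fv: "\<forall>i<n. v i \<in> carrier R" if "v \<in> free_vecs R n" for v n
    using that by (auto simp: free_vecs_def PiE_iff)
  have rs: "restrict v {..<n} \<in> free_vecs R n" if "\<forall>i<n. v i \<in> carrier R" for v n
    using that by (auto simp: free_vecs_def)
  note lc = lin_comb_ideal_module[OF I gI]
  have "I \<subseteq> Idl (g ` {..<\<mu>})"
  proof
    fix x assume "x \<in> I"
    then obtain v where "v \<in> free_vecs R \<mu>" "x = lin_comb ?M \<mu> g v" using surj by auto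
    then show "x \<in> Idl (g ` {..<\<mu>})"
      unfolding mem_genideal_image_iff[OF gR] using lc[OF fv] fv by (intro exI[of _ v]) simp
  qed
  moreover have "Idl (g ` {..<\<mu>}) \<subseteq> I" using gI by (intro genideal_minimal I) auto
  moreover have "(\<Oplus>i\<in>{..<\<mu>}. A i j \<otimes> g i) = \<zero>" if j: "j < q" for j
  proof -
    \<comment> \<open>The \<open>j\<close>-th basis vector is mapped to the \<open>j\<close>-th
      column, which exactness puts into the kernel.\<close>
    let ?e = "\<lambda>l\<in>{..<q}. if l = j then \<one> else \<zero>"
    have "?e \<in> free_vecs R q" by (intro rs) auto
    then have k: "mat_apply R \<mu> q A ?e \<in> free_vecs R \<mu>" "lin_comb ?M \<mu> g (mat_apply R \<mu> q A ?e) = \<zero>"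
      using ker by blast+
    have e: "mat_apply R \<mu> q A ?e i = A i j" if "i < \<mu>" for i
    proof -
      have "mat_apply R \<mu> q A ?e i = (\<Oplus>l\<in>{..<q}. A i l \<otimes> (if l = j then \<one> else \<zero>))"
        unfolding mat_apply_def using that A by (auto intro!: finsum_cong')
      then show ?thesis using finsum_times_delta[of q "A i" j] that A j by simp
    qed
    have "(\<Oplus>i\<in>{..<\<mu>}. mat_apply R \<mu> q A ?e i \<otimes> g i) = \<zero>" using lc[OF fv[OF k(1)]] k(2) by simp
    moreover have "(\<Oplus>i\<in>{..<\<mu>}. mat_apply R \<mu> q A ?e i \<otimes> g i) = (\<Oplus>i\<in>{..<\<mu>}. A i j \<otimes> g i)"
      using e A gR j by (intro finsum_cong') auto
    ultimately show ?thesis by simp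
  qed
  moreover have "\<exists>e. (\<forall>j<q. e j \<in> carrier R) \<and> (\<forall>i<\<mu>. v i = (\<Oplus>j\<in>{..<q}. A i j \<otimes> e j))"
    if v: "\<forall>i<\<mu>. v i \<in> carrier R" and zero: "(\<Oplus>i\<in>{..<\<mu>}. v i \<otimes> g i) = \<zero>" for v
  proof -
    let ?v = "restrict v {..<\<mu>}"
    have "(\<Oplus>i\<in>{..<\<mu>}. ?v i \<otimes> g i) = (\<Oplus>i\<in>{..<\<mu>}. v i \<otimes> g i)"
      using v gR by (intro finsum_cong') auto
    then have "lin_comb ?M \<mu> g ?v = \<zero>" using lc[of ?v] v zero by simp
    then have "?v \<in> mat_apply R \<mu> q A ` free_vecs R q" using rs[OF v] ker by blast
    then obtain e where e: "e \<in> free_vecs R q" "?v = mat_apply R \<mu> q A e" by blast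
    have "v i = (\<Oplus>j\<in>{..<q}. A i j \<otimes> e j)" if "i < \<mu>" for i
      using fun_cong[OF e(2), of i] that by (simp add: mat_apply_def)
    then show ?thesis using fv[OF e(1)] by blast
  qed
  ultimately show ?thesis unfolding ideal_presentation_def using A gR by blast
qed

section \<open>Finite generation of submodules of free modules\<close>

primrec vspan :: "nat \<Rightarrow> (nat \<Rightarrow> 'a) list \<Rightarrow> (nat \<Rightarrow> 'a) set"
  where "vspan n [] = {\<lambda>i\<in>{..<n}. \<zero>}"
  | "vspan n (w # ws) = {\<lambda>i\<in>{..<n}. v i \<oplus> c \<otimes> w i | v c. v \<in> vspan n ws \<and> c \<in> carrier R}"

text \<open>Closure under \<open>v + c w\<close>, together with the zero vector, covers sums and
  scalar multiples at once.\<close>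

definition submod :: "nat \<Rightarrow> (nat \<Rightarrow> 'a) set \<Rightarrow> bool"
  where "submod n V \<longleftrightarrow> V \<subseteq> free_vecs R n \<and> (\<lambda>i\<in>{..<n}. \<zero>) \<in> V \<and>
    (\<forall>v\<in>V. \<forall>w\<in>V. \<forall>c\<in>carrier R. (\<lambda>i\<in>{..<n}. v i \<oplus> c \<otimes> w i) \<in> V)"

lemma free_vecsD: "\<lbrakk>v \<in> free_vecs R n; i < n\<rbrakk> \<Longrightarrow> v i \<in> carrier R"
  by (auto simp: free_vecs_def PiE_iff)

lemma free_vecs_restrict: "v \<in> free_vecs R n \<Longrightarrow> restrict v {..<n} = v"
  by (auto simp: free_vecs_def)

lemma restrict_free_vecs: "\<forall>i<n. v i \<in> carrier R \<Longrightarrow> restrict v {..<n} \<in> free_vecs R n"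
  by (auto simp: free_vecs_def)

lemma vspan_subset: "\<lbrakk>submod n V; set ws \<subseteq> V\<rbrakk> \<Longrightarrow> vspan n ws \<subseteq> V"
  by (induction ws) (auto simp: submod_def)

text \<open>Prepending \<open>w\<close> to the list adds it as the last column of the matrix, so
  that the earlier columns keep their indices; this is the origin of \<open>rev\<close>.\<close>

lemma vspan_eq_mat_apply:
  assumes "set ws \<subseteq> free_vecs R n"
  shows "vspan n ws = mat_apply R n (length ws) (\<lambda>i j. (rev ws ! j) i) ` free_vecs R (length ws)"
  using assms
proof (induction ws)
  case Nil
  then show ?case by (auto simp: mat_apply_def free_vecs_def)
next
  case (Cons w ws)
  let ?q = "length ws"
  let ?A = "\<lambda>i j. (rev ws ! j) i" and ?B = "\<lambda>i j. (rev (w # ws) ! j) i"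
  have A: "?A i j \<in> carrier R" if "i < n" "j < ?q" for i j
  proof -
    have "rev ws ! j \<in> set ws" using that nth_mem[of j "rev ws"] by simp
    then show ?thesis using Cons.prems that free_vecsD by auto
  qed
  have w: "w i \<in> carrier R" if "i < n" for i using Cons.prems that free_vecsD by auto
  have B: "?B i j = (if j < ?q then ?A i j else w i)" if "j < Suc ?q" for i j
    using that by (auto simp: nth_append less_Suc_eq)
  have key: "mat_apply R n (Suc ?q) ?B e = (\<lambda>i\<in>{..<n}. mat_apply R n ?q ?A (restrict e {..<?q}) i \<oplus> e ?q \<otimes> w i)"
    if e: "\<forall>j<Suc ?q. e j \<in> carrier R" for e
  proof
    fix i
    show "mat_apply R n (Suc ?q) ?B e i =
        (\<lambda>i\<in>{..<n}. mat_apply R n ?q ?A (restrict e {..<?q}) i \<oplus> e ?q \<otimes> w i) i"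
    proof (cases "i < n")
      case True
      have "(\<Oplus>j\<in>{..<Suc ?q}. ?B i j \<otimes> e j) = (\<Oplus>j\<in>{..<?q}. ?B i j \<otimes> e j) \<oplus> ?B i ?q \<otimes> e ?q"
        using e A[OF True] w[OF True] B by (intro finsum_lessThan_Suc) auto
      also have "(\<Oplus>j\<in>{..<?q}. ?B i j \<otimes> e j) = (\<Oplus>j\<in>{..<?q}. ?A i j \<otimes> restrict e {..<?q} j)"
        using e A[OF True] B by (intro finsum_cong') auto
      also have "?B i ?q \<otimes> e ?q = e ?q \<otimes> w i" using B[of ?q i] e w[OF True] m_comm by simp
      finally show ?thesis using True by (simp add: mat_apply_def)
    qed (simp add: mat_apply_def)
  qed
  show ?case
  proof (intro equalityI subsetI)
    fix x assume "x \<in> vspan n (w # ws)"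
    then obtain v c where vc: "v \<in> vspan n ws" "c \<in> carrier R" "x = (\<lambda>i\<in>{..<n}. v i \<oplus> c \<otimes> w i)"
      by auto
    obtain e where e: "e \<in> free_vecs R ?q" "v = mat_apply R n ?q ?A e"
      using vc(1) Cons by auto
    let ?e = "\<lambda>j\<in>{..<Suc ?q}. if j = ?q then c else e j"
    have ec: "\<forall>j<Suc ?q. (if j = ?q then c else e j) \<in> carrier R"
      using e vc(2) free_vecsD by (auto simp: less_Suc_eq)
    have "restrict ?e {..<?q} = restrict e {..<?q}" by auto
    also have "\<dots> = e" by (rule free_vecs_restrict[OF e(1)])
    finally have "restrict ?e {..<?q} = e" .
    then have "x = mat_apply R n (Suc ?q) ?B ?e" using key[of ?e] ec vc(3) e(2) by simp
    then show "x \<in> mat_apply R n (length (w # ws)) ?B ` free_vecs R (length (w # ws))"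
      using restrict_free_vecs[OF ec] by auto
  next
    fix x assume "x \<in> mat_apply R n (length (w # ws)) ?B ` free_vecs R (length (w # ws))"
    then obtain e where e: "e \<in> free_vecs R (Suc ?q)" "x = mat_apply R n (Suc ?q) ?B e" by auto
    have ec: "\<forall>j<Suc ?q. e j \<in> carrier R" using e(1) free_vecsD by auto
    have "mat_apply R n ?q ?A (restrict e {..<?q}) \<in> vspan n ws"
      using restrict_free_vecs[of ?q e] ec Cons by auto
    then show "x \<in> vspan n (w # ws)" using key[OF ec] e(2) ec by auto
  qed
qed

end

context noetherian_cring
begin

text \<open>Induction on the number of coordinates: the last coordinates form an ideal, generated by
  those of finitely many vectors \<open>ws\<close>, and the vectors whose last coordinate vanishes
  form a submodule with one coordinate less, generated by \<open>us\<close>.\<close>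

lemma submod_finitely_generated:
  assumes "submod n V"
  shows "\<exists>ws. set ws \<subseteq> V \<and> V = vspan n ws"
  using assms
proof (induction n arbitrary: V)
  case 0
  have "(\<lambda>i\<in>{..<0::nat}. \<zero>) = (\<lambda>x. undefined)" by auto
  then have "free_vecs R 0 = {\<lambda>i\<in>{..<0}. \<zero>}"
    by (simp add: free_vecs_def)
  moreover have "V \<subseteq> free_vecs R 0" "(\<lambda>i\<in>{..<0}. \<zero>) \<in> V"
    using 0 by (simp_all add: submod_def)
  ultimately have "V = {\<lambda>i\<in>{..<0}. \<zero>}" by blast
  then show ?case by (intro exI[of _ "[]"]) auto
next
  case (Suc n)
  have V: "V \<subseteq> free_vecs R (Suc n)" "(\<lambda>i\<in>{..<Suc n}. \<zero>) \<in> V"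
    "\<And>v w c. \<lbrakk>v \<in> V; w \<in> V; c \<in> carrier R\<rbrakk> \<Longrightarrow> (\<lambda>i\<in>{..<Suc n}. v i \<oplus> c \<otimes> w i) \<in> V"
    using Suc.prems unfolding submod_def by auto
  have Vc: "v i \<in> carrier R" if "v \<in> V" "i < Suc n" for v i
    using V(1) that free_vecsD by blast
  let ?J = "(\<lambda>v. v n) ` V"
  have J: "ideal ?J R"
  proof (rule ideal_of_closed)
    show "?J \<subseteq> carrier R" using Vc by auto
    show "\<zero> \<in> ?J" using V(2) by (intro image_eqI[of _ _ "\<lambda>i\<in>{..<Suc n}. \<zero>"]) auto
  next
    fix a b assume "a \<in> ?J" "b \<in> ?J"
    then obtain v w where vw: "v \<in> V" "w \<in> V" "a = v n" "b = w n" by blast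
    then show "a \<oplus> b \<in> ?J"
      using V(3)[OF vw(1,2) one_closed] Vc[OF vw(2), of n]
      by (intro image_eqI[of _ _ "\<lambda>i\<in>{..<Suc n}. v i \<oplus> \<one> \<otimes> w i"]) auto
  next
    fix a r assume "a \<in> ?J" "r \<in> carrier R"
    then obtain w where w: "w \<in> V" "a = w n" "r \<in> carrier R" by blast
    then show "r \<otimes> a \<in> ?J"
      using V(3)[OF V(2) w(1,3)] Vc[OF w(1), of n]
      by (intro image_eqI[of _ _ "\<lambda>i\<in>{..<Suc n}. (\<lambda>i\<in>{..<Suc n}. \<zero>) i \<oplus> r \<otimes> w i"]) auto
  qed
  obtain X where X: "X \<subseteq> carrier R" "finite X" "?J = Idl X" using finetely_gen[OF J] by blast
  have "X \<subseteq> ?J" using genideal_self[OF X(1)] X(3) by simp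
  then obtain W where W: "W \<subseteq> V" "finite W" "X = (\<lambda>v. v n) ` W"
    using finite_subset_image[OF X(2)] by metis
  obtain ws where ws: "set ws = W" using finite_list[OF W(2)] by blast
  let ?V0 = "(\<lambda>v. restrict v {..<n}) ` {v \<in> V. v n = \<zero>}"
  have "submod n ?V0"
    unfolding submod_def
  proof (intro conjI ballI)
    show "?V0 \<subseteq> free_vecs R n" using Vc by (auto intro!: restrict_free_vecs)
    show "(\<lambda>i\<in>{..<n}. \<zero>) \<in> ?V0"
      using V(2) by (intro image_eqI[of _ _ "\<lambda>i\<in>{..<Suc n}. \<zero>"]) auto
  next
    fix v w c assume "v \<in> ?V0" "w \<in> ?V0" and c: "c \<in> carrier R"
    then obtain v' w' where vw: "v' \<in> V" "w' \<in> V" "v' n = \<zero>" "w' n = \<zero>"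
      "v = restrict v' {..<n}" "w = restrict w' {..<n}" by auto
    then show "(\<lambda>i\<in>{..<n}. v i \<oplus> c \<otimes> w i) \<in> ?V0"
      using V(3)[OF vw(1,2) c] c
      by (intro image_eqI[of _ _ "\<lambda>i\<in>{..<Suc n}. v' i \<oplus> c \<otimes> w' i"]) (auto simp: fun_eq_iff)
  qed
  then obtain us where us: "set us \<subseteq> ?V0" "?V0 = vspan n us" using Suc.IH by blast
  \<comment> \<open>Padding by a zero coordinate inverts the restriction on vectors whose last
    coordinate vanishes.\<close>
  define ext where "ext = (\<lambda>u. \<lambda>i\<in>{..<Suc n}. if i = n then \<zero> else u i)"
  have ext: "ext (restrict v {..<n}) = v" if "v \<in> V" "v n = \<zero>" for v
  proof -
    have "ext (restrict v {..<n}) = restrict v {..<Suc n}"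
      using that(2) by (auto simp: ext_def fun_eq_iff less_Suc_eq)
    also have "\<dots> = v" using free_vecs_restrict that(1) V(1) by blast
    finally show ?thesis .
  qed
  have usV: "set (map ext us) \<subseteq> V" using us(1) ext by fastforce
  have vs0: "vspan (Suc n) (map ext us) \<supseteq> ext ` vspan n us"
  proof -
    have "ext u \<in> vspan (Suc n) (map ext us')" if "u \<in> vspan n us'" "set us' \<subseteq> ?V0" for u us'
      using that
    proof (induction us' arbitrary: u)
      case Nil
      then show ?case by (auto simp: ext_def fun_eq_iff)
    next
      case (Cons w us')
      then obtain v c where vc: "v \<in> vspan n us'" "c \<in> carrier R" "u = (\<lambda>i\<in>{..<n}. v i \<oplus> c \<otimes> w i)"
        by auto
      have "ext v \<in> vspan (Suc n) (map ext us')" using Cons.IH[OF vc(1)] Cons.prems(2) by simp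
      moreover have "ext u = (\<lambda>i\<in>{..<Suc n}. ext v i \<oplus> c \<otimes> ext w i)"
        unfolding vc(3) using vc(2) by (auto simp: ext_def fun_eq_iff)
      ultimately show ?case using vc(2) by (simp only: vspan.simps list.map) blast
    qed
    then show ?thesis using us(1) by blast
  qed
  \<comment> \<open>Stated for sublists \<open>ws'\<close>: subtracting a multiple of the first
    vector moves the last coordinate into the ideal of the remaining ones, until it vanishes and the
    vector comes from \<open>us\<close>.\<close>
  have span: "v \<in> vspan (Suc n) (ws' @ map ext us)"
    if "v \<in> V" "set ws' \<subseteq> V" "v n \<in> adjs R {\<zero>} (map (\<lambda>w. w n) ws')" for v ws'
    using that
  proof (induction ws' arbitrary: v)
    case Nil
    then have "restrict v {..<n} \<in> vspan n us" using us(2) by auto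
    then show ?case using vs0 ext[of v] Nil by auto
  next
    case (Cons w ws')
    have wc: "w n \<in> carrier R" "set (map (\<lambda>w. w n) ws') \<subseteq> carrier R" using Cons.prems(2) Vc by auto
    have "v n \<in> adjoin R (adjs R {\<zero>} (map (\<lambda>w. w n) ws')) (w n)"
      using Cons.prems(3) adjs_adjoin[OF zeroideal wc(2,1)] by simp
    then obtain b c where bc: "b \<in> adjs R {\<zero>} (map (\<lambda>w. w n) ws')" "c \<in> carrier R"
      "v n = b \<oplus> c \<otimes> w n" by (auto simp: mem_adjoin)
    have bR: "b \<in> carrier R" using bc(1) ideal_basic(7)[OF adjs_ideal[OF zeroideal wc(2)]] by blast
    let ?v = "\<lambda>i\<in>{..<Suc n}. v i \<oplus> (\<ominus> c) \<otimes> w i"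
    have "?v \<in> V" using V(3) Cons.prems bc(2) by simp
    moreover have "?v n = b" using bc(2,3) bR wc(1) by simp algebra
    ultimately have "?v \<in> vspan (Suc n) (ws' @ map ext us)"
      using Cons.IH[of ?v] Cons.prems(2) bc(1) by (simp only: set_simps) blast
    moreover have "v = (\<lambda>i\<in>{..<Suc n}. ?v i \<oplus> c \<otimes> w i)"
    proof
      fix i
      show "v i = (\<lambda>i\<in>{..<Suc n}. ?v i \<oplus> c \<otimes> w i) i"
      proof (cases "i < Suc n")
        case True
        then have "v i \<in> carrier R" "w i \<in> carrier R" using Vc Cons.prems by auto
        then have "v i = (v i \<oplus> (\<ominus> c) \<otimes> w i) \<oplus> c \<otimes> w i" using bc(2) by algebra
        then show ?thesis using True by simp
      next
        case False
        then show ?thesis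
          using fun_cong[OF free_vecs_restrict[of v "Suc n"], of i] V(1) Cons.prems(1) by auto
      qed
    qed
    ultimately show ?case using bc(2) by (simp only: vspan.simps append_Cons) blast
  qed
  have "set (map (\<lambda>w. w n) ws) = X" using ws W(3) by simp
  then have "adjs R {\<zero>} (map (\<lambda>w. w n) ws) = ?J" using adjs_zero_eq_genideal X by metis
  then have "V \<subseteq> vspan (Suc n) (ws @ map ext us)" using span[of _ ws] ws W(1) by blast
  moreover have "set (ws @ map ext us) \<subseteq> V" using ws W(1) usV by simp
  ultimately show ?case using vspan_subset[OF Suc.prems] by blast
qed

text \<open>The generators come from the Noetherian property, and the matrix from finite generation
  of the syzygies, a submodule of a free module.\<close>

lemma ex_presentation:
  assumes I: "ideal I R"
  shows "\<exists>\<mu> q A g. presentation R (ideal_module R I) \<mu> q A g"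
proof -
  let ?M = "ideal_module R I"
  have cM: "carrier ?M = I" and zM: "\<zero>\<^bsub>?M\<^esub> = \<zero>" by (simp_all add: ideal_module_def)
  obtain X where X: "X \<subseteq> carrier R" "finite X" "I = Idl X" using finetely_gen[OF I] by blast
  obtain xs where xs: "set xs = X" using finite_list[OF X(2)] by blast
  let ?\<mu> = "length xs" and ?g = "\<lambda>i. xs ! i"
  have im: "?g ` {..<?\<mu>} = X" using xs by (auto simp: set_conv_nth)
  have gI: "\<forall>i<?\<mu>. ?g i \<in> I" using xs X genideal_self[OF X(1)] nth_mem by blast
  have gR: "\<forall>i<?\<mu>. ?g i \<in> carrier R" using gI ideal_basic(7)[OF I] by blast
  note lc = lin_comb_ideal_module[OF I gI]
  have fv: "\<forall>i<n. v i \<in> carrier R" if "v \<in> free_vecs R n" for v n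
    using that free_vecsD by blast
  have surj: "lin_comb ?M ?\<mu> ?g ` free_vecs R ?\<mu> = I"
  proof (intro equalityI subsetI)
    fix x assume "x \<in> lin_comb ?M ?\<mu> ?g ` free_vecs R ?\<mu>"
    then obtain v where v: "v \<in> free_vecs R ?\<mu>" "x = lin_comb ?M ?\<mu> ?g v" by blast
    then have "x \<in> Idl (?g ` {..<?\<mu>})"
      unfolding mem_genideal_image_iff[OF gR] using lc[OF fv] fv by (intro exI[of _ v]) simp
    then show "x \<in> I" using im X(3) by simp
  next
    fix x assume "x \<in> I"
    then obtain v where v: "\<forall>i<?\<mu>. v i \<in> carrier R" "x = (\<Oplus>i\<in>{..<?\<mu>}. v i \<otimes> ?g i)"
      using mem_genideal_image_iff[OF gR, of x] unfolding im X(3)[symmetric] by blast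
    let ?v = "restrict v {..<?\<mu>}"
    have "x = (\<Oplus>i\<in>{..<?\<mu>}. ?v i \<otimes> ?g i)"
      unfolding v(2) using v gR by (intro finsum_cong') auto
    then have "x = lin_comb ?M ?\<mu> ?g ?v" using lc[of ?v] v(1) by simp
    then show "x \<in> lin_comb ?M ?\<mu> ?g ` free_vecs R ?\<mu>" using restrict_free_vecs[OF v(1)] by blast
  qed
  let ?K = "{v \<in> free_vecs R ?\<mu>. lin_comb ?M ?\<mu> ?g v = \<zero>}"
  have "submod ?\<mu> ?K"
    unfolding submod_def
  proof (intro conjI ballI)
    let ?z = "\<lambda>i\<in>{..<?\<mu>}. \<zero>"
    have "(\<Oplus>i\<in>{..<?\<mu>}. ?z i \<otimes> ?g i) = (\<Oplus>i\<in>{..<?\<mu>}. \<zero>)" using gR by (intro finsum_cong') auto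
    then have "lin_comb ?M ?\<mu> ?g ?z = \<zero>" using lc[of ?z] by simp
    then show "?z \<in> ?K" using restrict_free_vecs[of ?\<mu> "\<lambda>i. \<zero>"] by simp
  next
    fix v w c assume "v \<in> ?K" "w \<in> ?K" and c: "c \<in> carrier R"
    then have v: "v \<in> free_vecs R ?\<mu>" "(\<Oplus>i\<in>{..<?\<mu>}. v i \<otimes> ?g i) = \<zero>"
      and w: "w \<in> free_vecs R ?\<mu>" "(\<Oplus>i\<in>{..<?\<mu>}. w i \<otimes> ?g i) = \<zero>" using lc[OF fv] by auto
    let ?u = "\<lambda>i\<in>{..<?\<mu>}. v i \<oplus> c \<otimes> w i"
    note vc = free_vecsD[OF v(1)] and wc = free_vecsD[OF w(1)]
    have "(\<Oplus>i\<in>{..<?\<mu>}. ?u i \<otimes> ?g i) = (\<Oplus>i\<in>{..<?\<mu>}. v i \<otimes> ?g i \<oplus> c \<otimes> (w i \<otimes> ?g i))"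
      using vc wc gR c by (intro finsum_cong') (auto simp: l_distr m_assoc)
    also have "\<dots> = (\<Oplus>i\<in>{..<?\<mu>}. v i \<otimes> ?g i) \<oplus> (\<Oplus>i\<in>{..<?\<mu>}. c \<otimes> (w i \<otimes> ?g i))"
      using vc wc gR c by (intro finsum_addf) auto
    also have "(\<Oplus>i\<in>{..<?\<mu>}. c \<otimes> (w i \<otimes> ?g i)) = c \<otimes> (\<Oplus>i\<in>{..<?\<mu>}. w i \<otimes> ?g i)"
      using wc gR c by (intro finsum_rdistr[symmetric]) auto
    finally have "(\<Oplus>i\<in>{..<?\<mu>}. ?u i \<otimes> ?g i) = \<zero>" using v(2) w(2) c by simp
    moreover have uc: "\<forall>i<?\<mu>. v i \<oplus> c \<otimes> w i \<in> carrier R" using vc wc c by simp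
    ultimately show "?u \<in> ?K" using lc[of ?u] restrict_free_vecs[OF uc] by simp
  qed auto
  then obtain ws where ws: "set ws \<subseteq> ?K" "?K = vspan ?\<mu> ws"
    using submod_finitely_generated by blast
  have wf: "set ws \<subseteq> free_vecs R ?\<mu>" using ws(1) by blast
  let ?A = "\<lambda>i j. (rev ws ! j) i"
  have "\<forall>i<?\<mu>. \<forall>j<length ws. ?A i j \<in> carrier R"
    using wf nth_mem[of _ "rev ws"] free_vecsD by fastforce
  moreover have "?K = mat_apply R ?\<mu> (length ws) ?A ` free_vecs R (length ws)"
    using ws(2) vspan_eq_mat_apply[OF wf] by simp
  ultimately have "presentation R ?M ?\<mu> (length ws) ?A ?g"
    unfolding presentation_def cM zM using gI surj by blast
  then show ?thesis by blast
qed

text \<open>Since a presentation exists, the choice in \<open>fitting_ideal\<close> returns a value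
  that comes from an actual one, about which nothing further is known.\<close>

lemma fitting_ideal_cases:
  assumes I: "ideal I R"
  obtains \<mu> q A g where "ideal_presentation I \<mu> q A g"
    "fitting_ideal R (ideal_module R I) c = (if \<mu> \<le> c then carrier R else Idl (minors R \<mu> q A (\<mu> - c)))"
proof -
  have "\<exists>F \<mu> q A g. presentation R (ideal_module R I) \<mu> q A g \<and>
      F = (if \<mu> \<le> c then carrier R else Idl (minors R \<mu> q A (\<mu> - c)))"
    using ex_presentation[OF I] by blast
  from someI_ex[OF this] show thesis
    using that presentation_imp_ideal_presentation[OF I] unfolding fitting_ideal_def by blast
qed

end

section \<open>Local generators from minors, and exchange of local generators\<close>

context cring
begin

text \<open>The columns of the minor are relations that place combinations of the \<open>k\<close>
  generators in its rows into the ideal of the remaining generators. By Cramer's rule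
  \<open>x\<close> multiplies each of these \<open>k\<close> generators into that ideal, and
  \<open>x\<close> is a unit at \<open>p\<close>.\<close>

lemma minor_generates:
  assumes p: "primeideal p R" and pres: "ideal_presentation I \<mu> q A g"
    and x: "x \<in> minors R \<mu> q A k" "x \<notin> p"
  shows "\<exists>T\<subseteq>{..<\<mu>}. card T = \<mu> - k \<and> I \<subseteq> sat R p (Idl (g ` T))"
proof -
  have A: "\<forall>i<\<mu>. \<forall>j<q. A i j \<in> carrier R" and g: "\<forall>i<\<mu>. g i \<in> carrier R"
    and I: "I = Idl (g ` {..<\<mu>})" and col: "\<forall>j<q. (\<Oplus>i\<in>{..<\<mu>}. A i j \<otimes> g i) = \<zero>"
    using pres unfolding ideal_presentation_def by auto
  obtain r s where rs: "x = ring_det R k (\<lambda>i j. A (r i) (s j))"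
    "strict_mono_on {..<k} r" "r ` {..<k} \<subseteq> {..<\<mu>}" "s ` {..<k} \<subseteq> {..<q}"
    using x(1) unfolding minors_def by blast
  have r: "r i < \<mu>" "s i < q" if "i < k" for i using rs(3,4) that by auto
  have inj: "inj_on r {..<k}" using rs(2) by (rule strict_mono_on_imp_inj_on)
  let ?T = "{..<\<mu>} - r ` {..<k}"
  have gT: "g ` ?T \<subseteq> carrier R" using g by auto
  let ?H = "Idl (g ` ?T)"
  note H = genideal_ideal[OF gT] and Hs = genideal_self[OF gT]
  have B: "\<forall>i<k. \<forall>j<k. A (r i) (s j) \<in> carrier R" using A r by auto
  have gr: "\<forall>i<k. g (r i) \<in> carrier R" using g r by auto
  have rel: "\<forall>j<k. (\<Oplus>i\<in>{..<k}. g (r i) \<otimes> A (r i) (s j)) \<in> ?H"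
  proof (intro allI impI)
    fix j assume j: "j < k"
    let ?f = "\<lambda>i. A i (s j) \<otimes> g i"
    have fc: "?f i \<in> carrier R" if "i < \<mu>" for i using A g r(2)[OF j] that by auto
    have "{..<\<mu>} = r ` {..<k} \<union> ?T" using rs(3) by auto
    then have "\<zero> = (\<Oplus>i\<in>r ` {..<k} \<union> ?T. ?f i)" using col r(2)[OF j] by simp
    also have "\<dots> = (\<Oplus>i\<in>r ` {..<k}. ?f i) \<oplus> (\<Oplus>i\<in>?T. ?f i)"
      using fc rs(3) by (intro finsum_Un_disjoint) auto
    also have "(\<Oplus>i\<in>r ` {..<k}. ?f i) = (\<Oplus>i\<in>{..<k}. ?f (r i))"
      using fc r(1) by (intro finsum_reindex[OF _ inj]) auto
    also have "\<dots> = (\<Oplus>i\<in>{..<k}. g (r i) \<otimes> A (r i) (s j))"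
      using A g r(1) r(2)[OF j] by (intro finsum_cong') (auto simp: m_comm)
    finally have sum: "\<zero> = (\<Oplus>i\<in>{..<k}. g (r i) \<otimes> A (r i) (s j)) \<oplus> (\<Oplus>i\<in>?T. ?f i)" .
    have T: "(\<Oplus>i\<in>?T. ?f i) \<in> ?H"
    proof (rule finsum_in_ideal[OF H])
      fix i assume i: "i \<in> ?T"
      then have "g i \<in> ?H" using Hs by blast
      then show "?f i \<in> ?H" using ideal_basic(5)[OF H] A i r(2)[OF j] by simp
    qed
    have c: "(\<Oplus>i\<in>{..<k}. g (r i) \<otimes> A (r i) (s j)) \<in> carrier R"
      using A g r(1) r(2)[OF j] by (intro finsum_closed) auto
    have "(\<Oplus>i\<in>{..<k}. g (r i) \<otimes> A (r i) (s j)) = \<ominus> (\<Oplus>i\<in>?T. ?f i)"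
      using sum_zero_eq_neg[OF c ideal_basic(7)[OF H T]] sum by simp
    then show "(\<Oplus>i\<in>{..<k}. g (r i) \<otimes> A (r i) (s j)) \<in> ?H" using ideal_basic(4)[OF H T] by simp
  qed
  have sub: "?H \<subseteq> sat R p ?H" by (rule subset_sat[OF p ideal_basic(1)[OF H]])
  have "g i \<in> sat R p ?H" if i: "i < \<mu>" for i
  proof (cases "i \<in> r ` {..<k}")
    case True
    then obtain a where a: "a < k" "i = r a" by auto
    have "x \<otimes> g i \<in> ?H" using cramer_ideal[OF B gr H rel a(1)] rs(1) a(2) by simp
    moreover have "x \<in> carrier R" using ring_det_closed[OF B] rs(1) by simp
    ultimately show ?thesis using satI[of "g i" x] x(2) g i by blast
  next
    case False
    then show ?thesis using Hs sub i by blast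
  qed
  then have "I \<subseteq> sat R p ?H" unfolding I by (intro genideal_minimal sat_ideal[OF p H]) auto
  moreover have "card ?T = \<mu> - k"
    using rs(3) card_image[OF inj] by (simp add: card_Diff_subset)
  ultimately show ?thesis by (intro exI[of _ ?T]) simp
qed

lemma adjoin_genideal_subset:
  assumes "X \<subseteq> carrier R" "x \<in> carrier R"
  shows "adjoin R (Idl X) x \<subseteq> Idl (insert x X)"
proof (rule adjoin_basic(3)[OF genideal_ideal[OF assms(1)] assms(2)])
  have c: "insert x X \<subseteq> carrier R" using assms by simp
  show "ideal (Idl (insert x X)) R" by (rule genideal_ideal[OF c])
  show "Idl X \<subseteq> Idl (insert x X)" by (rule subset_Idl_subset[OF c]) blast
  show "x \<in> Idl (insert x X)" using genideal_self[OF c] by blast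
qed

text \<open>
  Exchange in a local ring: if \<open>e\<close> and the ideal \<open>J\<close> generate the ideal generated by \<open>g\<close>, then
  either \<open>J\<close> alone does, or some \<open>g i\<close> involves \<open>e\<close> with a unit coefficient and may replace it.
\<close>

lemma generator_exchange:
  assumes p: "primeideal p R" and J: "ideal J R" and g: "\<forall>i<n::nat. g i \<in> carrier R"
    and e: "e \<in> Idl (g ` {..<n})" and gen: "Idl (g ` {..<n}) \<subseteq> sat R p (adjoin R J e)"
  shows "Idl (g ` {..<n}) \<subseteq> sat R p J \<or>
    (\<exists>i<n. Idl (g ` {..<n}) \<subseteq> sat R p (adjoin R J (g i)))"
proof -
  let ?I = "Idl (g ` {..<n})"
  have gc: "g ` {..<n} \<subseteq> carrier R" using g by auto
  have ec: "e \<in> carrier R" using e ideal_basic(7)[OF genideal_ideal[OF gc]] by blast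
  note iJ = ideal_basic[OF J] and ip = ideal_basic[OF primeideal_basic(1)[OF p]]
  have step: "?I \<subseteq> sat R p K" if K: "ideal K R" "J \<subseteq> K" "e \<in> sat R p K" for K
  proof -
    have "adjoin R J e \<subseteq> sat R p K"
      using subset_sat[OF p ideal_basic(1)[OF K(1)]] K by (intro adjoin_basic(3)[OF J ec] sat_ideal[OF p]) auto
    then have "sat R p (adjoin R J e) \<subseteq> sat R p K"
      using sat_mono sat_idem[OF p ideal_basic(1)[OF K(1)]] by metis
    then show ?thesis using gen by blast
  qed
  show ?thesis
  proof (cases "\<exists>i<n. \<exists>s\<in>carrier R. \<exists>j\<in>J. \<exists>a\<in>carrier R. s \<otimes> g i = j \<oplus> a \<otimes> e \<and> a \<notin> p")
    case True
    then obtain i s j a where *: "i < n" "s \<in> carrier R" "j \<in> J" "a \<in> carrier R"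
      "s \<otimes> g i = j \<oplus> a \<otimes> e" "a \<notin> p" by blast
    have c: "g i \<in> carrier R" "j \<in> carrier R" using g *(1,3) iJ(7) by auto
    let ?K = "adjoin R J (g i)"
    note K = adjoin_ideal[OF J c(1)] and Kb = adjoin_basic[OF J c(1)]
    have "a \<otimes> e = (j \<oplus> a \<otimes> e) \<ominus> j" using c ec *(4) by algebra
    also have "\<dots> = s \<otimes> g i \<ominus> j" unfolding *(5) by simp
    also have "\<dots> \<in> ?K" using ideal_basic(5,8)[OF K] Kb(1,2) *(2,3) by blast
    finally have "e \<in> sat R p ?K" using satI[OF ec *(4,6)] by blast
    then show ?thesis using step[OF K Kb(1)] *(1) by blast
  next
    case False
    \<comment> \<open>This is \<open>J + p e\<close>. Its saturation contains every
      \<open>g i\<close>, hence \<open>e\<close>, and a relation \<open>s e = j + a e\<close> with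
      \<open>a\<close> in \<open>p\<close> can be solved for \<open>e\<close>, as in Nakayama's
      lemma.\<close>
    let ?K = "{j \<oplus> a \<otimes> e | j a. j \<in> J \<and> a \<in> p}"
    have "ideal ?K R"
    proof (rule ideal_of_closed)
      show "?K \<subseteq> carrier R" using iJ(7) ip(7) ec by auto
      have "\<zero> = \<zero> \<oplus> \<zero> \<otimes> e" using ec by simp
      then show "\<zero> \<in> ?K" using iJ(2) ip(2) by blast
    next
      fix x y assume "x \<in> ?K" "y \<in> ?K"
      then obtain j a j' a' where *: "j \<in> J" "a \<in> p" "x = j \<oplus> a \<otimes> e" "j' \<in> J" "a' \<in> p"
        "y = j' \<oplus> a' \<otimes> e" by blast
      have c: "j \<in> carrier R" "a \<in> carrier R" "j' \<in> carrier R" "a' \<in> carrier R"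
        using * iJ(7) ip(7) by auto
      have "x \<oplus> y = (j \<oplus> j') \<oplus> (a \<oplus> a') \<otimes> e" unfolding * using c ec by algebra
      then show "x \<oplus> y \<in> ?K" using iJ(3)[OF *(1,4)] ip(3)[OF *(2,5)] by blast
    next
      fix x t assume "x \<in> ?K" and t: "t \<in> carrier R"
      then obtain j a where *: "j \<in> J" "a \<in> p" "x = j \<oplus> a \<otimes> e" by blast
      have c: "j \<in> carrier R" "a \<in> carrier R" using * iJ(7) ip(7) by auto
      have "t \<otimes> x = t \<otimes> j \<oplus> (t \<otimes> a) \<otimes> e" unfolding * using c t ec by algebra
      then show "t \<otimes> x \<in> ?K" using iJ(5)[OF *(1) t] ip(5)[OF *(2) t] by blast
    qed
    moreover have "g i \<in> sat R p ?K" if i: "i < n" for i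
    proof -
      have "g i \<in> sat R p (adjoin R J e)" using gen genideal_self[OF gc] i by blast
      then obtain s j a where *: "s \<in> carrier R" "s \<notin> p" "j \<in> J" "a \<in> carrier R"
        "s \<otimes> g i = j \<oplus> a \<otimes> e" by (rule sat_adjoinE)
      then have "a \<in> p" using False i by blast
      with *(3) have "j \<oplus> a \<otimes> e \<in> ?K" by auto
      then show ?thesis
        unfolding *(5)[symmetric] by (rule satI[OF g[rule_format, OF i] *(1,2)])
    qed
    ultimately have "?I \<subseteq> sat R p ?K" by (intro genideal_minimal sat_ideal[OF p]) auto
    then have "e \<in> sat R p ?K" using e by blast
    then obtain s where "e \<in> carrier R" and s: "s \<in> carrier R" "s \<notin> p" "s \<otimes> e \<in> ?K"
      by (rule satE)
    from s(3) obtain j a where *: "j \<in> J" "a \<in> p" "s \<otimes> e = j \<oplus> a \<otimes> e" by auto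
    have c: "j \<in> carrier R" "a \<in> carrier R" using * iJ(7) ip(7) by auto
    have "(s \<ominus> a) \<otimes> e = s \<otimes> e \<ominus> a \<otimes> e" using s(1) c ec by algebra
    also have "\<dots> = j" unfolding *(3) using c ec by algebra
    finally have "(s \<ominus> a) \<otimes> e \<in> J" using *(1) by simp
    moreover have "s \<ominus> a \<notin> p"
    proof
      assume "s \<ominus> a \<in> p"
      then have "(s \<ominus> a) \<oplus> a \<in> p" using ip(3) *(2) by blast
      moreover have "(s \<ominus> a) \<oplus> a = s" using s(1) c by algebra
      ultimately show False using s(2) by simp
    qed
    ultimately have "e \<in> sat R p J" using satI[OF ec minus_closed[OF s(1) c(2)]] by blast
    then show ?thesis using step[OF J] by blast
  qed
qed

text \<open>Steinitz exchange over a local ring: the members of \<open>es\<close> are dropped or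
  replaced one at a time by some \<open>g i\<close>, whose indices are collected in
  \<open>T\<close>, so that \<open>card T + length es\<close> never grows.\<close>

lemma ex_generating_subset:
  assumes p: "primeideal p R" and g: "\<forall>i<n::nat. g i \<in> carrier R"
    and es: "set es \<subseteq> Idl (g ` {..<n})" "Idl (g ` {..<n}) \<subseteq> sat R p (adjs R {\<zero>} es)"
  shows "\<exists>T\<subseteq>{..<n}. card T \<le> length es \<and> Idl (g ` {..<n}) \<subseteq> sat R p (Idl (g ` T))"
proof -
  let ?I = "Idl (g ` {..<n})"
  have gc: "g ` {..<n} \<subseteq> carrier R" using g by auto
  have "\<exists>T'\<subseteq>{..<n}. card T' \<le> card T + length es \<and> ?I \<subseteq> sat R p (Idl (g ` T'))"
    if "T \<subseteq> {..<n}" "set es \<subseteq> ?I" "?I \<subseteq> sat R p (adjs R (Idl (g ` T)) es)" for T es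
    using that
  proof (induction es arbitrary: T)
    case Nil
    then show ?case by auto
  next
    case (Cons e es)
    have ec: "e \<in> carrier R" "set es \<subseteq> carrier R"
      using Cons.prems(2) ideal_basic(7)[OF genideal_ideal[OF gc]] by auto
    have Tc: "g ` T \<subseteq> carrier R" using Cons.prems(1) g by auto
    note iT = genideal_ideal[OF Tc]
    let ?J = "adjs R (Idl (g ` T)) es"
    note J = adjs_ideal[OF iT ec(2)]
    have "?I \<subseteq> sat R p (adjoin R ?J e)"
      using Cons.prems(3) adjs_adjoin[OF iT ec(2,1)] by simp
    then consider "?I \<subseteq> sat R p ?J" | i where "i < n" "?I \<subseteq> sat R p (adjoin R ?J (g i))"
      using generator_exchange[OF p J g, of e] Cons.prems(2) by auto
    then show ?case
    proof cases
      case 1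
      then obtain T' where "T' \<subseteq> {..<n}" "card T' \<le> card T + length es" "?I \<subseteq> sat R p (Idl (g ` T'))"
        using Cons.IH[OF Cons.prems(1)] Cons.prems(2) by auto
      then show ?thesis by (intro exI[of _ T']) simp
    next
      case (2 i)
      have gi: "g i \<in> carrier R" using g 2(1) by blast
      have iT': "ideal (Idl (g ` insert i T)) R" using Tc gi by (intro genideal_ideal) auto
      have "adjs R (adjoin R (Idl (g ` T)) (g i)) es \<subseteq> adjs R (Idl (g ` insert i T)) es"
        using adjoin_genideal_subset[OF Tc gi] adjs_basic[OF iT' ec(2)] adjs_ideal[OF iT' ec(2)]
        by (intro adjs_basic(3)[OF adjoin_ideal[OF iT gi] ec(2)]) auto
      then have "?I \<subseteq> sat R p (adjs R (Idl (g ` insert i T)) es)"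
        using 2(2) unfolding adjs_adjoin[OF iT ec(2) gi] by (rule subset_trans[OF _ sat_mono, rotated])
      moreover have "insert i T \<subseteq> {..<n}" using Cons.prems(1) 2(1) by simp
      ultimately obtain T' where T': "T' \<subseteq> {..<n}" "card T' \<le> card (insert i T) + length es"
        "?I \<subseteq> sat R p (Idl (g ` T'))"
        using Cons.IH[of "insert i T"] Cons.prems(2) by auto
      moreover have "card (insert i T) \<le> Suc (card T)"
        using Cons.prems(1) by (simp add: card_insert_if finite_subset)
      ultimately show ?thesis by (intro exI[of _ T']) simp
    qed
  qed
  \<comment> \<open>At the start \<open>T\<close> is empty, and its ideal is the zero ideal on which
    \<open>es\<close> is stacked.\<close>
  moreover have "Idl {} = {\<zero>}"
    using genideal_minimal[OF zeroideal, of "{}"] ideal_basic(2)[OF genideal_ideal[of "{}"]] by blast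
  ultimately show ?thesis using es by (metis (no_types, lifting) add_0 card.empty empty_subsetI image_empty)
qed

end

lemma ex_strict_mono_enumeration:
  assumes "finite (U :: nat set)"
  shows "\<exists>r. strict_mono_on {..<card U} r \<and> r ` {..<card U} = U"
proof -
  obtain h where "bij_betw h {..<card U} U" "strict_mono_on {..<card U} h"
    by (rule ex_bij_betw_strict_mono_card[OF assms])
  then show ?thesis by (intro exI[of _ h]) (simp add: bij_betw_def)
qed

section \<open>A minor outside the prime from few local generators\<close>

context cring
begin

lemma finprod_notin_prime:
  assumes p: "primeideal p R" and "\<forall>i<k::nat. s i \<in> carrier R \<and> s i \<notin> p"
  shows "(\<Otimes>i\<in>{..<k}. s i) \<notin> p"
  using assms(2)
proof (induction k)
  case 0
  then show ?case using primeideal_basic(2)[OF p] by simp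
next
  case (Suc k)
  have "(\<Otimes>i\<in>{..<k}. s i) \<in> carrier R" using Suc.prems by (intro finprod_closed) auto
  then show ?case
    using Suc primeideal_basic(5)[OF p] by (simp add: lessThan_Suc)
qed

lemma minors_closed:
  assumes "\<forall>i<\<mu>. \<forall>j<q. A i j \<in> carrier R"
  shows "minors R \<mu> q A k \<subseteq> carrier R"
proof
  fix x assume "x \<in> minors R \<mu> q A k"
  then obtain r s where "x = ring_det R k (\<lambda>i j. A (r i) (s j))"
    "r ` {..<k} \<subseteq> {..<\<mu>}" "s ` {..<k} \<subseteq> {..<q}"
    unfolding minors_def by blast
  then show "x \<in> carrier R"
    using assms by (simp only:) (intro ring_det_closed, auto)
qed

text \<open>The definition of minors admits increasing column selections only. A repeated column
  gives zero, and distinct columns are a permutation of an increasing selection, which affects at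
  most the sign.\<close>

lemma ring_det_columns_in_ideal:
  assumes A: "\<forall>i<\<mu>. \<forall>j<q. A i j \<in> carrier R" and H: "ideal H R"
    and min: "minors R \<mu> q A k \<subseteq> H"
    and r: "strict_mono_on {..<k} r" "r ` {..<k} \<subseteq> {..<\<mu>}" and f: "\<forall>j<k. f j < q"
  shows "ring_det R k (\<lambda>i j. A (r i) (f j)) \<in> H"
proof (cases "inj_on f {..<k}")
  case True
  let ?F = "f ` {..<k}"
  have card: "card ?F = k" using card_image[OF True] by simp
  obtain s where s: "strict_mono_on {..<k} s" "s ` {..<k} = ?F"
    using ex_strict_mono_enumeration[of ?F] card by auto
  have sinj: "inj_on s {..<k}" using s(1) by (rule strict_mono_on_imp_inj_on)
  have B: "\<forall>i<k. \<forall>j<k. A (r i) (s j) \<in> carrier R"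
  proof (intro allI impI)
    fix i j assume ij: "i < k" "j < k"
    then have "r i < \<mu>" using r(2) by auto
    moreover have "s j \<in> ?F" using s(2) ij by blast
    ultimately show "A (r i) (s j) \<in> carrier R" using A f by auto
  qed
  \<comment> \<open>The permutation that matches \<open>f\<close> with the increasing selection,
    extended by the identity as \<open>permutes\<close> requires.\<close>
  define \<tau> where "\<tau> j = (if j < k then the_inv_into {..<k} s (f j) else j)" for j
  have \<tau>: "\<tau> j < k" "s (\<tau> j) = f j" if "j < k" for j
  proof -
    have fj: "f j \<in> s ` {..<k}" using s(2) that by blast
    show "\<tau> j < k" using the_inv_into_into[OF sinj fj subset_refl] that by (simp add: \<tau>_def)
    show "s (\<tau> j) = f j" using f_the_inv_into_f[OF sinj fj] that by (simp add: \<tau>_def)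
  qed
  have "inj_on \<tau> {..<k}"
    using True \<tau>(2) by (metis (no_types, lifting) inj_on_def lessThan_iff)
  moreover have "\<tau> ` {..<k} \<subseteq> {..<k}" using \<tau>(1) by auto
  ultimately have "bij_betw \<tau> {..<k} {..<k}"
    using endo_inj_surj[of "{..<k}" \<tau>] by (simp add: bij_betw_def)
  then have perm: "\<tau> permutes {..<k}" by (rule bij_imp_permutes) (simp add: \<tau>_def)
  have "ring_det R k (\<lambda>i j. A (r i) (f j)) = ring_det R k (\<lambda>i j. A (r i) (s (\<tau> j)))"
    using \<tau>(2) A f r(2) by (intro ring_det_cong) auto
  also have "\<dots> = signed \<tau> (ring_det R k (\<lambda>i j. A (r i) (s j)))"
    using ring_det_permute_columns[OF B perm] .
  also have "\<dots> \<in> H"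
  proof -
    have "s ` {..<k} \<subseteq> {..<q}" using s(2) f by auto
    then have "ring_det R k (\<lambda>i j. A (r i) (s j)) \<in> minors R \<mu> q A k"
      unfolding minors_def using r s(1) by blast
    then have "ring_det R k (\<lambda>i j. A (r i) (s j)) \<in> H" using min by blast
    then show ?thesis using ideal_basic(4)[OF H] by (simp add: signed_def)
  qed
  finally show ?thesis .
next
  case False
  then obtain a b where ab: "a < k" "b < k" "a \<noteq> b" "f a = f b" by (auto simp: inj_on_def)
  have B: "\<forall>i<k. \<forall>j<k. A (r i) (f j) \<in> carrier R" using A f r(2) by auto
  have "ring_det R k (\<lambda>i j. A (r i) (f j)) = ring_det R k (\<lambda>i j. A (r j) (f i))"
    using ring_det_transpose[OF B] by simp
  also have "\<dots> = \<zero>"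
    using B ab by (intro ring_det_equal_rows[OF _ ab(1-3)]) auto
  finally show ?thesis using ideal_basic(2)[OF H] by simp
qed

lemma ring_det_row_combination_in_ideal:
  assumes B: "\<forall>i<k. \<forall>j<k. B i j \<in> carrier R" and a: "a < k" and H: "ideal H R"
    and w: "\<forall>j<q::nat. \<forall>c<k. w c j \<in> carrier R" and e: "\<forall>j<q. e j \<in> carrier R"
    and det: "\<forall>j<q. ring_det R k (B(a := \<lambda>c. w c j)) \<in> H"
  shows "ring_det R k (B(a := \<lambda>c. \<Oplus>j\<in>{..<q}. w c j \<otimes> e j)) \<in> H"
  using w e det
proof (induction q)
  case 0
  then show ?case using ring_det_row_zero[OF B a] ideal_basic(2)[OF H] by (simp add: fun_upd_def)
next
  case (Suc q)
  let ?s = "\<lambda>c. \<Oplus>j\<in>{..<q}. w c j \<otimes> e j" and ?t = "\<lambda>c. e q \<otimes> w c q"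
  have sc: "\<forall>c<k. ?s c \<in> carrier R" using Suc.prems(1,2) by (auto intro!: finsum_closed)
  have tc: "\<forall>c<k. ?t c \<in> carrier R" "\<forall>c<k. w c q \<in> carrier R" using Suc.prems(1,2) by auto
  have "ring_det R k (B(a := \<lambda>c. \<Oplus>j\<in>{..<Suc q}. w c j \<otimes> e j)) = ring_det R k (B(a := \<lambda>c. ?s c \<oplus> ?t c))"
  proof (rule ring_det_cong; intro allI impI)
    fix i c assume ic: "i < k" "c < k"
    have "(\<Oplus>j\<in>{..<Suc q}. w c j \<otimes> e j) = ?s c \<oplus> w c q \<otimes> e q"
      using Suc.prems(1,2) ic(2) by (intro finsum_lessThan_Suc) auto
    moreover have "w c q \<otimes> e q = ?t c" using Suc.prems(1,2) ic(2) by (intro m_comm) auto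
    ultimately show "(B(a := \<lambda>c. \<Oplus>j\<in>{..<Suc q}. w c j \<otimes> e j)) i c = (B(a := \<lambda>c. ?s c \<oplus> ?t c)) i c"
      by simp
    show "(B(a := \<lambda>c. ?s c \<oplus> ?t c)) i c \<in> carrier R"
      using sc tc B ic by simp
  qed
  also have "\<dots> = ring_det R k (B(a := ?s)) \<oplus> ring_det R k (B(a := ?t))"
    using ring_det_row_add[OF B a sc tc(1)] by (simp add: fun_upd_def)
  also have "ring_det R k (B(a := ?t)) = e q \<otimes> ring_det R k (B(a := \<lambda>c. w c q))"
    using ring_det_row_smult[OF B a tc(2)] Suc.prems(2) by simp
  finally have "ring_det R k (B(a := \<lambda>c. \<Oplus>j\<in>{..<Suc q}. w c j \<otimes> e j)) =
      ring_det R k (B(a := ?s)) \<oplus> e q \<otimes> ring_det R k (B(a := \<lambda>c. w c q))"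
    by (simp add: fun_upd_def)
  moreover have "ring_det R k (B(a := ?s)) \<in> H" using Suc by (simp add: fun_upd_def)
  moreover have "e q \<otimes> ring_det R k (B(a := \<lambda>c. w c q)) \<in> H"
    using ideal_basic(5)[OF H] Suc.prems(2,3) by (simp add: fun_upd_def)
  ultimately show ?case using ideal_basic(3)[OF H] by (simp add: fun_upd_def)
qed

text \<open>Expressing \<open>s g i\<close> by the generators indexed by \<open>T\<close> is a
  relation between all generators, whose coefficients outside \<open>T\<close> are \<open>s\<close>
  at \<open>i\<close> and zero elsewhere; exactness makes it a combination \<open>e\<close> of the
  columns of \<open>A\<close>.\<close>

lemma genideal_image_relation:
  assumes pres: "ideal_presentation I \<mu> q A g" and T: "T \<subseteq> {..<\<mu>}" and i: "i < \<mu>"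
    and s: "s \<in> carrier R" "s \<otimes> g i \<in> Idl (g ` T)"
  shows "\<exists>e. (\<forall>j<q. e j \<in> carrier R) \<and>
    (\<forall>a<\<mu>. a \<notin> T \<longrightarrow> (\<Oplus>j\<in>{..<q}. A a j \<otimes> e j) = (if a = i then s else \<zero>))"
proof -
  have g: "\<forall>i<\<mu>. g i \<in> carrier R"
    and syz: "\<And>v. \<lbrakk>\<forall>i<\<mu>. v i \<in> carrier R; (\<Oplus>i\<in>{..<\<mu>}. v i \<otimes> g i) = \<zero>\<rbrakk> \<Longrightarrow>
      \<exists>e. (\<forall>j<q. e j \<in> carrier R) \<and> (\<forall>i<\<mu>. v i = (\<Oplus>j\<in>{..<q}. A i j \<otimes> e j))"
    using pres unfolding ideal_presentation_def by auto
  \<comment> \<open>Padding with zeros turns combinations of the generators indexed by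
    \<open>T\<close> into sums over the full index range.\<close>
  let ?g = "\<lambda>i. if i \<in> T then g i else \<zero>"
  have g': "\<forall>i<\<mu>. ?g i \<in> carrier R" using g by simp
  have "g ` T \<subseteq> ?g ` {..<\<mu>}" using T by (force simp: image_iff)
  then have "Idl (g ` T) \<subseteq> Idl (?g ` {..<\<mu>})" using g' by (intro subset_Idl_subset) auto
  then obtain v where v: "\<forall>i<\<mu>. v i \<in> carrier R" "s \<otimes> g i = (\<Oplus>i\<in>{..<\<mu>}. v i \<otimes> ?g i)"
    using s(2) mem_genideal_image_iff[OF g'] by blast
  define b where "b a = (if a \<in> T then v a else \<zero>)" for a
  have b: "\<forall>a<\<mu>. b a \<in> carrier R" using v(1) by (simp add: b_def)
  have sb: "s \<otimes> g i = (\<Oplus>a\<in>{..<\<mu>}. b a \<otimes> g a)"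
    unfolding v(2) using v(1) g by (intro finsum_cong') (auto simp: b_def)
  define u where "u a = s \<otimes> (if a = i then \<one> else \<zero>) \<oplus> (\<ominus> \<one>) \<otimes> b a" for a
  have u: "\<forall>a<\<mu>. u a \<in> carrier R" using s b by (simp add: u_def)
  let ?d = "\<lambda>a. g a \<otimes> (if a = i then \<one> else \<zero>)"
  have "(\<Oplus>a\<in>{..<\<mu>}. u a \<otimes> g a) = (\<Oplus>a\<in>{..<\<mu>}. s \<otimes> ?d a \<oplus> (\<ominus> \<one>) \<otimes> (b a \<otimes> g a))"
  proof (rule finsum_cong')
    show "(\<lambda>a. s \<otimes> ?d a \<oplus> (\<ominus> \<one>) \<otimes> (b a \<otimes> g a)) \<in> {..<\<mu>} \<rightarrow> carrier R" using s b g by simp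
    fix a assume "a \<in> {..<\<mu>}"
    then have c: "b a \<in> carrier R" "g a \<in> carrier R" using b g by auto
    have "(s \<otimes> d \<oplus> (\<ominus> \<one>) \<otimes> b a) \<otimes> g a = s \<otimes> (g a \<otimes> d) \<oplus> (\<ominus> \<one>) \<otimes> (b a \<otimes> g a)"
      if "d \<in> carrier R" for d
      using that c s(1) by algebra
    then show "u a \<otimes> g a = s \<otimes> ?d a \<oplus> (\<ominus> \<one>) \<otimes> (b a \<otimes> g a)"
      unfolding u_def by simp
  qed simp
  also have "\<dots> = (\<Oplus>a\<in>{..<\<mu>}. s \<otimes> ?d a) \<oplus> (\<Oplus>a\<in>{..<\<mu>}. (\<ominus> \<one>) \<otimes> (b a \<otimes> g a))"
    using s b g by (intro finsum_addf) auto
  also have "(\<Oplus>a\<in>{..<\<mu>}. s \<otimes> ?d a) = s \<otimes> (\<Oplus>a\<in>{..<\<mu>}. ?d a)"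
    using s g by (intro finsum_rdistr[symmetric]) auto
  also have "(\<Oplus>a\<in>{..<\<mu>}. ?d a) = g i" by (rule finsum_times_delta[OF g i])
  also have "(\<Oplus>a\<in>{..<\<mu>}. (\<ominus> \<one>) \<otimes> (b a \<otimes> g a)) = (\<ominus> \<one>) \<otimes> (\<Oplus>a\<in>{..<\<mu>}. b a \<otimes> g a)"
    using b g by (intro finsum_rdistr[symmetric]) auto
  also have "s \<otimes> g i \<oplus> (\<ominus> \<one>) \<otimes> (\<Oplus>a\<in>{..<\<mu>}. b a \<otimes> g a) = \<zero>"
    unfolding sb[symmetric] using s(1) g i by (simp add: l_minus r_neg)
  finally obtain e where e: "\<forall>j<q. e j \<in> carrier R" "\<forall>a<\<mu>. u a = (\<Oplus>j\<in>{..<q}. A a j \<otimes> e j)"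
    using syz[OF u] by blast
  have "u a = (if a = i then s else \<zero>)" if "a < \<mu>" "a \<notin> T" for a
    using that s(1) by (simp add: u_def b_def)
  then show ?thesis using e by (intro exI[of _ e]) auto
qed

text \<open>Each generator outside \<open>T\<close> is, up to a multiplier \<open>s l\<close>, a
  combination of those in \<open>T\<close>. The corresponding combinations of columns form a
  diagonal matrix in the rows outside \<open>T\<close>, whose determinant is the product of the
  \<open>s l\<close> and so lies outside \<open>p\<close>. By multilinearity it is a combination of
  \<open>k\<close>-minors, which therefore cannot all lie in \<open>p\<close>.\<close>

lemma minors_not_subset:
  assumes p: "primeideal p R" and pres: "ideal_presentation I \<mu> q A g"
    and T: "T \<subseteq> {..<\<mu>}" "I \<subseteq> sat R p (Idl (g ` T))" and k: "k + card T = \<mu>"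
  shows "\<not> minors R \<mu> q A k \<subseteq> p"
proof
  assume min: "minors R \<mu> q A k \<subseteq> p"
  have A: "\<forall>i<\<mu>. \<forall>j<q. A i j \<in> carrier R" and g: "\<forall>i<\<mu>. g i \<in> carrier R"
    and I: "I = Idl (g ` {..<\<mu>})"
    using pres unfolding ideal_presentation_def by auto
  note ip = primeideal_basic(1)[OF p]
  let ?U = "{..<\<mu>} - T"
  have "card ?U = k" using T(1) k finite_subset[OF T(1)] by (simp add: card_Diff_subset)
  then obtain r where r: "strict_mono_on {..<k} r" "r ` {..<k} = ?U"
    using ex_strict_mono_enumeration[of ?U] by auto
  have rinj: "inj_on r {..<k}" using r(1) by (rule strict_mono_on_imp_inj_on)
  have r\<mu>: "r a < \<mu>" "r a \<notin> T" if "a < k" for a using r(2) that by auto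
  have gc: "g ` {..<\<mu>} \<subseteq> carrier R" using g by auto
  have "\<forall>l. \<exists>s e. l < k \<longrightarrow> s \<in> carrier R \<and> s \<notin> p \<and> (\<forall>j<q. e j \<in> carrier R) \<and>
    (\<forall>a<\<mu>. a \<notin> T \<longrightarrow> (\<Oplus>j\<in>{..<q}. A a j \<otimes> e j) = (if a = r l then s else \<zero>))"
  proof
    fix l
    show "\<exists>s e. l < k \<longrightarrow> s \<in> carrier R \<and> s \<notin> p \<and> (\<forall>j<q. e j \<in> carrier R) \<and>
      (\<forall>a<\<mu>. a \<notin> T \<longrightarrow> (\<Oplus>j\<in>{..<q}. A a j \<otimes> e j) = (if a = r l then s else \<zero>))"
    proof (cases "l < k")
      case True
      have "g (r l) \<in> sat R p (Idl (g ` T))"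
        using genideal_self[OF gc] T(2) I r\<mu>(1)[OF True] by blast
      then obtain s where s: "s \<in> carrier R" "s \<notin> p" "s \<otimes> g (r l) \<in> Idl (g ` T)" by (metis satE)
      then show ?thesis using genideal_image_relation[OF pres T(1) r\<mu>(1)[OF True] s(1,3)] by blast
    qed simp
  qed
  from choice[OF this] obtain s where "\<forall>l. \<exists>e. l < k \<longrightarrow> s l \<in> carrier R \<and> s l \<notin> p \<and>
    (\<forall>j<q. e j \<in> carrier R) \<and>
    (\<forall>a<\<mu>. a \<notin> T \<longrightarrow> (\<Oplus>j\<in>{..<q}. A a j \<otimes> e j) = (if a = r l then s l else \<zero>))" ..
  from choice[OF this] obtain e where e: "\<forall>l. l < k \<longrightarrow> s l \<in> carrier R \<and> s l \<notin> p \<and>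
    (\<forall>j<q. e l j \<in> carrier R) \<and>
    (\<forall>a<\<mu>. a \<notin> T \<longrightarrow> (\<Oplus>j\<in>{..<q}. A a j \<otimes> e l j) = (if a = r l then s l else \<zero>))" ..
  have se: "s l \<in> carrier R" "s l \<notin> p" "\<forall>j<q. e l j \<in> carrier R" if "l < k" for l
    using e that by simp_all
  let ?v = "\<lambda>l a. \<Oplus>j\<in>{..<q}. A (r a) j \<otimes> e l j"
  have v: "?v l a = (if a = l then s l else \<zero>)" if "l < k" "a < k" for l a
    using e that r\<mu>[OF that(2)] rinj by (auto dest: inj_onD)
  have vc: "?v l a \<in> carrier R" if "l < k" "a < k" for l a
    using v[OF that] se[OF that(1)] by simp
  \<comment> \<open>Interpolates between original columns at \<open>n = 0\<close> and the diagonal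
    matrix at \<open>n = k\<close>, replacing one column per step. Columns are written as rows,
    where linearity is available, and \<open>f\<close> varies because expanding a combination brings
    in arbitrary columns.\<close>
  have claim: "ring_det R k (\<lambda>l a. if l < n then ?v l a else A (r a) (f l)) \<in> p"
    if "n \<le> k" "\<forall>l<k. n \<le> l \<longrightarrow> f l < q" for n f
    using that
  proof (induction n arbitrary: f)
    case 0
    have B: "\<forall>i<k. \<forall>j<k. A (r i) (f j) \<in> carrier R" using A 0(2) r\<mu>(1) by simp
    have "ring_det R k (\<lambda>i j. A (r i) (f j)) \<in> p"
      using ring_det_columns_in_ideal[OF A ip min r(1)] r(2) 0(2) by auto
    then show ?case using ring_det_transpose[OF B] by simp
  next
    case (Suc n)
    let ?M = "\<lambda>l a. if l < Suc n then ?v l a else A (r a) (f l)"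
    have M: "\<forall>l<k. \<forall>a<k. ?M l a \<in> carrier R" using vc A Suc.prems r\<mu>(1) by auto
    have n: "n < k" using Suc.prems(1) by simp
    have "ring_det R k (?M(n := \<lambda>c. A (r c) j)) \<in> p" if j: "j < q" for j
    proof -
      have "?M(n := \<lambda>c. A (r c) j) = (\<lambda>l a. if l < n then ?v l a else A (r a) ((f(n := j)) l))"
        by (auto simp: fun_eq_iff less_Suc_eq)
      then show ?thesis using Suc.IH[of "f(n := j)"] Suc.prems j by (simp add: Suc_le_eq)
    qed
    then have "ring_det R k (?M(n := \<lambda>c. \<Oplus>j\<in>{..<q}. A (r c) j \<otimes> e n j)) \<in> p"
      using A r\<mu>(1) se[OF n]
      by (intro ring_det_row_combination_in_ideal[OF M n ip]) auto
    moreover have "?M(n := \<lambda>c. \<Oplus>j\<in>{..<q}. A (r c) j \<otimes> e n j) = ?M"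
      by (auto simp: fun_eq_iff)
    ultimately show ?case by simp
  qed
  \<comment> \<open>At \<open>n = k\<close> no original column remains, so the range condition on
    \<open>f\<close> is vacuous and the constant 0 serves even if \<open>q = 0\<close>.\<close>
  have "ring_det R k (\<lambda>l a. if l < k then ?v l a else A (r a) 0) \<in> p"
    using claim[of k "\<lambda>_. 0"] by simp
  also have "ring_det R k (\<lambda>l a. if l < k then ?v l a else A (r a) 0)
      = ring_det R k (\<lambda>l a. if a = l then s l else \<zero>)"
    using v se by (intro ring_det_cong) auto
  also have "\<dots> = (\<Otimes>l\<in>{..<k}. s l)"
    using ring_det_diagonal[of k "\<lambda>l a. if a = l then s l else \<zero>"] se by simp
  finally show False using finprod_notin_prime[OF p, of k s] se by blast
qed

end

section \<open>The local criterion for the Fitting ideal\<close>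

context noetherian_cring
begin

lemma fitting_ideal_ideal:
  assumes I: "ideal I R"
  shows "ideal (fitting_ideal R (ideal_module R I) c) R"
proof -
  obtain \<mu> q A g where pres: "ideal_presentation I \<mu> q A g"
    and F: "fitting_ideal R (ideal_module R I) c = (if \<mu> \<le> c then carrier R else Idl (minors R \<mu> q A (\<mu> - c)))"
    by (rule fitting_ideal_cases[OF I])
  have "minors R \<mu> q A (\<mu> - c) \<subseteq> carrier R"
    using pres unfolding ideal_presentation_def by (intro minors_closed) blast
  then show ?thesis using F oneideal genideal_ideal by simp
qed

text \<open>Either the presentation has at most \<open>c\<close> generators, or some minor of size
  \<open>\<mu> - c\<close> is a unit at \<open>p\<close> and leaves
  \<open>\<mu> - (\<mu> - c) = c\<close> of them.\<close>

lemma generators_if_fitting_not_subset: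
  assumes p: "primeideal p R" and I: "ideal I R"
    and F: "\<not> fitting_ideal R (ideal_module R I) c \<subseteq> p"
  shows "\<exists>es. set es \<subseteq> I \<and> length es \<le> c \<and> I \<subseteq> sat R p (adjs R {\<zero>} es)"
proof -
  obtain \<mu> q A g where pres: "ideal_presentation I \<mu> q A g"
    and F': "fitting_ideal R (ideal_module R I) c = (if \<mu> \<le> c then carrier R else Idl (minors R \<mu> q A (\<mu> - c)))"
    by (rule fitting_ideal_cases[OF I])
  have g: "\<forall>i<\<mu>. g i \<in> carrier R" and I_eq: "I = Idl (g ` {..<\<mu>})"
    using pres unfolding ideal_presentation_def by auto
  have gc: "g ` {..<\<mu>} \<subseteq> carrier R" using g by auto
  have gI: "g ` {..<\<mu>} \<subseteq> I" using genideal_self[OF gc] I_eq by simp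
  have "\<exists>T\<subseteq>{..<\<mu>}. card T \<le> c \<and> I \<subseteq> sat R p (Idl (g ` T))"
  proof (cases "\<mu> \<le> c")
    case True
    have "I \<subseteq> sat R p (Idl (g ` {..<\<mu>}))"
      using subset_sat[OF p ideal_basic(1)[OF I]] I_eq by simp
    then show ?thesis using True by (intro exI[of _ "{..<\<mu>}"]) simp
  next
    case False
    then have "\<not> minors R \<mu> q A (\<mu> - c) \<subseteq> p"
      using F F' genideal_minimal[OF primeideal_basic(1)[OF p]] by auto
    then obtain x where "x \<in> minors R \<mu> q A (\<mu> - c)" "x \<notin> p" by blast
    from minor_generates[OF p pres this] show ?thesis using False by auto
  qed
  then obtain T where T: "T \<subseteq> {..<\<mu>}" "card T \<le> c" "I \<subseteq> sat R p (Idl (g ` T))" by blast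
  have fin: "finite T" using T(1) finite_subset by blast
  let ?es = "map g (sorted_list_of_set T)"
  have set: "set ?es = g ` T" using fin by simp
  then have "adjs R {\<zero>} ?es = Idl (g ` T)" using adjs_zero_eq_genideal[of ?es] T(1) g by auto
  moreover have "set ?es \<subseteq> I" using set gI T(1) by auto
  ultimately show ?thesis using T by (intro exI[of _ ?es]) simp
qed

text \<open>The local generators \<open>es\<close> may be absent from the chosen presentation, so
  they are traded for generators of it, indexed by \<open>T\<close>. The minors have the fixed size
  \<open>\<mu> - c\<close>, hence \<open>T\<close> is enlarged to exactly \<open>c\<close>
  indices.\<close>

lemma fitting_not_subset_if_generators:
  assumes p: "primeideal p R" and I: "ideal I R"
    and es: "set es \<subseteq> I" "length es \<le> c" "I \<subseteq> sat R p (adjs R {\<zero>} es)"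
  shows "\<not> fitting_ideal R (ideal_module R I) c \<subseteq> p"
proof -
  obtain \<mu> q A g where pres: "ideal_presentation I \<mu> q A g"
    and F: "fitting_ideal R (ideal_module R I) c = (if \<mu> \<le> c then carrier R else Idl (minors R \<mu> q A (\<mu> - c)))"
    by (rule fitting_ideal_cases[OF I])
  have g: "\<forall>i<\<mu>. g i \<in> carrier R" and I_eq: "I = Idl (g ` {..<\<mu>})"
    and A: "\<forall>i<\<mu>. \<forall>j<q. A i j \<in> carrier R"
    using pres unfolding ideal_presentation_def by auto
  show ?thesis
  proof (cases "\<mu> \<le> c")
    case True
    then show ?thesis using F primeideal_basic(2)[OF p] by auto
  next
    case False
    obtain T where T: "T \<subseteq> {..<\<mu>}" "card T \<le> length es" "I \<subseteq> sat R p (Idl (g ` T))"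
      using ex_generating_subset[OF p g es(1)[unfolded I_eq] es(3)[unfolded I_eq]] unfolding I_eq by blast
    have "card T \<le> c" "c \<le> card {..<\<mu>}" using T(2) es(2) False by auto
    then obtain T' where T': "T \<subseteq> T'" "T' \<subseteq> {..<\<mu>}" "card T' = c"
      using exists_subset_between[of T c "{..<\<mu>}"] T(1) by auto
    have "Idl (g ` T) \<subseteq> Idl (g ` T')" using T'(1,2) g by (intro subset_Idl_subset) auto
    then have "I \<subseteq> sat R p (Idl (g ` T'))" using T(3) sat_mono by blast
    then have "\<not> minors R \<mu> q A (\<mu> - c) \<subseteq> p"
      using minors_not_subset[OF p pres T'(2)] T'(3) False by simp
    then show ?thesis using F False genideal_self[OF minors_closed[OF A]] by auto
  qed
qed

end

section \<open>Quotients and localizations\<close>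

context cring
begin

lemma quot_module_basic:
  assumes J: "ideal J R"
  shows "carrier (quot_module R J) = (\<lambda>a. J +> a) ` carrier R"
    "\<zero>\<^bsub>quot_module R J\<^esub> = J"
    "\<And>r a. \<lbrakk>r \<in> carrier R; a \<in> carrier R\<rbrakk> \<Longrightarrow> r \<odot>\<^bsub>quot_module R J\<^esub> (J +> a) = J +> (r \<otimes> a)"
    "\<And>a. a \<in> carrier R \<Longrightarrow> J +> a = J \<longleftrightarrow> a \<in> J"
proof -
  interpret ideal J R by fact
  show "carrier (quot_module R J) = (\<lambda>a. J +> a) ` carrier R"
    by (auto simp: quot_module_def FactRing_def A_RCOSETS_def' a_r_coset_def')
  show "\<zero>\<^bsub>quot_module R J\<^esub> = J" by (simp add: quot_module_def FactRing_def)
  show "\<And>r a. \<lbrakk>r \<in> carrier R; a \<in> carrier R\<rbrakk> \<Longrightarrow> r \<odot>\<^bsub>quot_module R J\<^esub> (J +> a) = J +> (r \<otimes> a)"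
    by (simp add: quot_module_def FactRing_def rcoset_mult_add)
  show "\<And>a. a \<in> carrier R \<Longrightarrow> J +> a = J \<longleftrightarrow> a \<in> J"
    using rcos_const_imp_mem a_rcos_zero[OF J] by blast
qed

lemma nonzerodivisor_on_quot_module_iff:
  assumes J: "ideal J R" and x: "x \<in> carrier R"
  shows "nonzerodivisor_on (quot_module R J) x \<longleftrightarrow> (\<forall>a\<in>carrier R. x \<otimes> a \<in> J \<longrightarrow> a \<in> J)"
  using x by (simp add: nonzerodivisor_on_def quot_module_basic[OF J])

lemma annihilator_quot_module:
  assumes J: "ideal J R" and a: "a \<in> carrier R"
  shows "annihilator R (quot_module R J) (J +> a) = colon R J a"
proof -
  have "r \<odot>\<^bsub>quot_module R J\<^esub> (J +> a) = \<zero>\<^bsub>quot_module R J\<^esub> \<longleftrightarrow> r \<otimes> a \<in> J" if "r \<in> carrier R" for r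
    using that a by (simp add: quot_module_basic[OF J])
  then show ?thesis by (auto simp: annihilator_def colon_def)
qed

lemma Ass_quot_module: "ideal J R \<Longrightarrow> Ass R (quot_module R J) = assprimes R J"
  by (simp add: Ass_def assprimes_def quot_module_basic(1) annihilator_quot_module cong: conj_cong)

end

section \<open>The localization at a prime as a ring of fractions\<close>

locale cring_prime = cring R for R (structure) + fixes P
  assumes P: "primeideal P R"
begin

abbreviation W :: "'a set" where "W \<equiv> carrier R - P"

abbreviation fr :: "'a \<Rightarrow> 'a \<Rightarrow> ('a \<times> 'a) set" where "fr \<equiv> loc_frac R W"

abbreviation L :: "('a \<times> 'a) set ring" where "L \<equiv> loc_at R P"

lemma W_closed: "\<one> \<in> W" "\<lbrakk>s \<in> W; t \<in> W\<rbrakk> \<Longrightarrow> s \<otimes> t \<in> W" "s \<in> W \<Longrightarrow> s \<in> carrier R"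
  using primeideal_basic(2,5)[OF P] by auto

lemma loc_rel_iff:
  "((a, s), (b, t)) \<in> loc_rel R W \<longleftrightarrow> a \<in> carrier R \<and> s \<in> W \<and> b \<in> carrier R \<and> t \<in> W \<and>
    (\<exists>u\<in>W. u \<otimes> (a \<otimes> t) = u \<otimes> (b \<otimes> s))"
  by (simp add: loc_rel_def)

lemma equiv_loc_rel: "equiv (carrier R \<times> W) (loc_rel R W)"
proof (rule equivI)
  show "loc_rel R W \<subseteq> (carrier R \<times> W) \<times> (carrier R \<times> W)"
    by (auto simp: loc_rel_def)
  show "refl_on (carrier R \<times> W) (loc_rel R W)"
    using W_closed(1) by (auto simp: refl_on_def loc_rel_iff)
  show "sym (loc_rel R W)"
    by (rule symI) (auto simp: loc_rel_def dest: sym)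
  show "trans (loc_rel R W)"
  proof (rule transI)
    fix x y z assume xyz: "(x, y) \<in> loc_rel R W" "(y, z) \<in> loc_rel R W"
    obtain a s b t c r where eq: "x = (a, s)" "y = (b, t)" "z = (c, r)" by (metis surj_pair)
    obtain u v where *: "a \<in> carrier R" "s \<in> W" "b \<in> carrier R" "t \<in> W" "c \<in> carrier R" "r \<in> W"
      "u \<in> W" "v \<in> W" "u \<otimes> (a \<otimes> t) = u \<otimes> (b \<otimes> s)" "v \<otimes> (b \<otimes> r) = v \<otimes> (c \<otimes> t)"
      using xyz unfolding eq loc_rel_iff by blast
    note c = *(1,3,5) W_closed(3)[OF *(2)] W_closed(3)[OF *(4)] W_closed(3)[OF *(6)]
      W_closed(3)[OF *(7)] W_closed(3)[OF *(8)]
    \<comment> \<open>The middle denominator \<open>t\<close> has to be part of the multiplier,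
      because each given equation contains it as a factor that cannot be cancelled.\<close>
    have "(u \<otimes> v \<otimes> t) \<otimes> (a \<otimes> r) = (v \<otimes> r) \<otimes> (u \<otimes> (a \<otimes> t))" using c by algebra
    also have "\<dots> = (u \<otimes> s) \<otimes> (v \<otimes> (b \<otimes> r))" unfolding *(9) using c by algebra
    also have "\<dots> = (u \<otimes> v \<otimes> t) \<otimes> (c \<otimes> s)" unfolding *(10) using c by algebra
    finally show "(x, z) \<in> loc_rel R W"
      unfolding eq loc_rel_iff using * W_closed(2) by blast
  qed
qed

lemma fr_eq_iff:
  assumes "a \<in> carrier R" "s \<in> W" "b \<in> carrier R" "t \<in> W"
  shows "fr a s = fr b t \<longleftrightarrow> (\<exists>u\<in>W. u \<otimes> (a \<otimes> t) = u \<otimes> (b \<otimes> s))"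
  unfolding loc_frac_def
  using assms eq_equiv_class_iff[OF equiv_loc_rel, of "(a, s)" "(b, t)"] by (simp add: loc_rel_iff)

lemma fr_eqI:
  assumes "a \<in> carrier R" "s \<in> W" "b \<in> carrier R" "t \<in> W" "a \<otimes> t = b \<otimes> s"
  shows "fr a s = fr b t"
  unfolding fr_eq_iff[OF assms(1-4)] using assms(5) W_closed(1) by metis

lemma carrier_L: "carrier L = {fr a s | a s. a \<in> carrier R \<and> s \<in> W}"
  by (auto simp: loc_at_def localization_def quotient_def loc_frac_def)

lemma L_E:
  assumes "x \<in> carrier L"
  obtains a s where "a \<in> carrier R" "s \<in> W" "x = fr a s"
  using assms unfolding carrier_L by blast

lemma fr_closed: "\<lbrakk>a \<in> carrier R; s \<in> W\<rbrakk> \<Longrightarrow> fr a s \<in> carrier L"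
  unfolding carrier_L by blast

text \<open>Operations on fractions are defined as unions over all representatives; when
  \<open>F\<close> does not depend on them, all members agree and the union collapses to one
  value.\<close>

lemma fr_UN:
  assumes a: "a \<in> carrier R" "s \<in> W" and b: "b \<in> carrier R" "t \<in> W"
    and F: "\<And>a' s' b' t'. \<lbrakk>a' \<in> carrier R; s' \<in> W; b' \<in> carrier R; t' \<in> W;
      fr a' s' = fr a s; fr b' t' = fr b t\<rbrakk> \<Longrightarrow> F a' s' b' t' = F a s b t"
  shows "(\<Union>(a, s)\<in>fr a s. \<Union>(b, t)\<in>fr b t. F a s b t) = F a s b t"
proof -
  have mem: "x \<in> fr a s \<longleftrightarrow> (\<exists>a' s'. x = (a', s') \<and> a' \<in> carrier R \<and> s' \<in> W \<and> fr a' s' = fr a s)"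
    if "a \<in> carrier R" "s \<in> W" for x a s
  proof -
    have "x \<in> fr a s \<longleftrightarrow> ((a, s), x) \<in> loc_rel R W" by (simp add: loc_frac_def)
    then show ?thesis
      using equiv_class_eq_iff[OF equiv_loc_rel, of "(a, s)" x] that
      by (cases x) (auto simp: loc_frac_def)
  qed
  show ?thesis
  proof (rule UN_constant_eq[of "(a, s)", OF _ ballI])
    show "(a, s) \<in> fr a s" using mem[OF a] a by auto
    fix y assume "y \<in> fr a s"
    then obtain a' s' where y: "y = (a', s')" "a' \<in> carrier R" "s' \<in> W" "fr a' s' = fr a s"
      unfolding mem[OF a] by blast
    have "(\<Union>(b, t)\<in>fr b t. F a' s' b t) = F a s b t"
    proof (rule UN_constant_eq[of "(b, t)", OF _ ballI])
      show "(b, t) \<in> fr b t" using mem[OF b] b by auto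
      fix z assume "z \<in> fr b t"
      then obtain b' t' where "z = (b', t')" "b' \<in> carrier R" "t' \<in> W" "fr b' t' = fr b t"
        unfolding mem[OF b] by blast
      then show "(case z of (b, t) \<Rightarrow> F a' s' b t) = F a s b t" using F y by simp
    qed
    then show "(case y of (a, s) \<Rightarrow> \<Union>(b, t)\<in>fr b t. F a s b t) = F a s b t" using y by simp
  qed
qed

lemma fr_mult:
  assumes a: "a \<in> carrier R" "s \<in> W" and b: "b \<in> carrier R" "t \<in> W"
  shows "fr a s \<otimes>\<^bsub>L\<^esub> fr b t = fr (a \<otimes> b) (s \<otimes> t)"
proof -
  have "(\<Union>(a, s)\<in>fr a s. \<Union>(b, t)\<in>fr b t. fr (a \<otimes> b) (s \<otimes> t)) = fr (a \<otimes> b) (s \<otimes> t)"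
  proof (rule fr_UN[OF assms, of "\<lambda>a s b t. fr (a \<otimes> b) (s \<otimes> t)"])
    fix a' s' b' t' assume *: "a' \<in> carrier R" "s' \<in> W" "b' \<in> carrier R" "t' \<in> W"
      and "fr a' s' = fr a s" "fr b' t' = fr b t"
    then obtain u v where uv: "u \<in> W" "v \<in> W" "u \<otimes> (a' \<otimes> s) = u \<otimes> (a \<otimes> s')" "v \<otimes> (b' \<otimes> t) = v \<otimes> (b \<otimes> t')"
      using fr_eq_iff a b by meson
    note c = *(1,3) a(1) b(1) W_closed(3)[OF *(2)] W_closed(3)[OF *(4)] W_closed(3)[OF a(2)]
      W_closed(3)[OF b(2)] W_closed(3)[OF uv(1)] W_closed(3)[OF uv(2)]
    have "(u \<otimes> v) \<otimes> ((a' \<otimes> b') \<otimes> (s \<otimes> t)) = (u \<otimes> (a' \<otimes> s)) \<otimes> (v \<otimes> (b' \<otimes> t))" using c by algebra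
    also have "\<dots> = (u \<otimes> v) \<otimes> ((a \<otimes> b) \<otimes> (s' \<otimes> t'))" unfolding uv(3,4) using c by algebra
    finally show "fr (a' \<otimes> b') (s' \<otimes> t') = fr (a \<otimes> b) (s \<otimes> t)"
      using * a b W_closed(2) uv(1,2) by (subst fr_eq_iff) auto
  qed
  then show ?thesis by (simp add: loc_at_def localization_def)
qed

lemma fr_add:
  assumes a: "a \<in> carrier R" "s \<in> W" and b: "b \<in> carrier R" "t \<in> W"
  shows "fr a s \<oplus>\<^bsub>L\<^esub> fr b t = fr (a \<otimes> t \<oplus> b \<otimes> s) (s \<otimes> t)"
proof -
  have "(\<Union>(a, s)\<in>fr a s. \<Union>(b, t)\<in>fr b t. fr (a \<otimes> t \<oplus> b \<otimes> s) (s \<otimes> t)) = fr (a \<otimes> t \<oplus> b \<otimes> s) (s \<otimes> t)"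
  proof (rule fr_UN[OF assms, of "\<lambda>a s b t. fr (a \<otimes> t \<oplus> b \<otimes> s) (s \<otimes> t)"])
    fix a' s' b' t' assume *: "a' \<in> carrier R" "s' \<in> W" "b' \<in> carrier R" "t' \<in> W"
      and "fr a' s' = fr a s" "fr b' t' = fr b t"
    then obtain u v where uv: "u \<in> W" "v \<in> W" "u \<otimes> (a' \<otimes> s) = u \<otimes> (a \<otimes> s')" "v \<otimes> (b' \<otimes> t) = v \<otimes> (b \<otimes> t')"
      using fr_eq_iff a b by meson
    note c = *(1,3) a(1) b(1) W_closed(3)[OF *(2)] W_closed(3)[OF *(4)] W_closed(3)[OF a(2)]
      W_closed(3)[OF b(2)] W_closed(3)[OF uv(1)] W_closed(3)[OF uv(2)]
    have "(u \<otimes> v) \<otimes> ((a' \<otimes> t' \<oplus> b' \<otimes> s') \<otimes> (s \<otimes> t))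
        = (u \<otimes> (a' \<otimes> s)) \<otimes> (v \<otimes> t' \<otimes> t) \<oplus> (v \<otimes> (b' \<otimes> t)) \<otimes> (u \<otimes> s' \<otimes> s)" using c by algebra
    also have "\<dots> = (u \<otimes> v) \<otimes> ((a \<otimes> t \<oplus> b \<otimes> s) \<otimes> (s' \<otimes> t'))" unfolding uv(3,4) using c by algebra
    finally show "fr (a' \<otimes> t' \<oplus> b' \<otimes> s') (s' \<otimes> t') = fr (a \<otimes> t \<oplus> b \<otimes> s) (s \<otimes> t)"
      using * a b W_closed(2) uv(1,2) by (subst fr_eq_iff) auto
  qed
  then show ?thesis by (simp add: loc_at_def localization_def)
qed

lemma fr_one: "\<one>\<^bsub>L\<^esub> = fr \<one> \<one>" and fr_zero: "\<zero>\<^bsub>L\<^esub> = fr \<zero> \<one>"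
  by (simp_all add: loc_at_def localization_def)

lemma cring_L: "cring L"
proof (rule cringI)
  note fc = fr_closed and m = W_closed(2)
  show "abelian_group L"
  proof (rule abelian_groupI)
    fix x y assume "x \<in> carrier L" "y \<in> carrier L"
    then obtain a s b t where *: "a \<in> carrier R" "s \<in> W" "x = fr a s" "b \<in> carrier R" "t \<in> W" "y = fr b t"
      by (metis L_E)
    note c = *(1,4) W_closed(3)[OF *(2)] W_closed(3)[OF *(5)]
    show "x \<oplus>\<^bsub>L\<^esub> y \<in> carrier L" unfolding *(3,6) fr_add[OF *(1,2,4,5)] using c m[OF *(2,5)] by (intro fc) auto
    show "x \<oplus>\<^bsub>L\<^esub> y = y \<oplus>\<^bsub>L\<^esub> x"
      unfolding *(3,6) fr_add[OF *(1,2,4,5)] fr_add[OF *(4,5,1,2)]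
    proof (rule fr_eqI[OF _ m[OF *(2,5)] _ m[OF *(5,2)]])
      show "(a \<otimes> t \<oplus> b \<otimes> s) \<otimes> (t \<otimes> s) = (b \<otimes> s \<oplus> a \<otimes> t) \<otimes> (s \<otimes> t)" using c by algebra
    qed (use c in auto)
    fix z assume "z \<in> carrier L"
    then obtain d r where z: "d \<in> carrier R" "r \<in> W" "z = fr d r" by (metis L_E)
    note c' = c z(1) W_closed(3)[OF z(2)]
    have c1: "a \<otimes> t \<oplus> b \<otimes> s \<in> carrier R" "b \<otimes> r \<oplus> d \<otimes> t \<in> carrier R" using c' by auto
    show "x \<oplus>\<^bsub>L\<^esub> y \<oplus>\<^bsub>L\<^esub> z = x \<oplus>\<^bsub>L\<^esub> (y \<oplus>\<^bsub>L\<^esub> z)"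
      unfolding *(3,6) z(3) fr_add[OF *(1,2,4,5)] fr_add[OF *(4,5) z(1,2)]
        fr_add[OF c1(1) m[OF *(2,5)] z(1,2)] fr_add[OF *(1,2) c1(2) m[OF *(5) z(2)]]
    proof (rule fr_eqI[OF _ m[OF m[OF *(2,5)] z(2)] _ m[OF *(2) m[OF *(5) z(2)]]])
      show "((a \<otimes> t \<oplus> b \<otimes> s) \<otimes> r \<oplus> d \<otimes> (s \<otimes> t)) \<otimes> (s \<otimes> (t \<otimes> r)) =
          (a \<otimes> (t \<otimes> r) \<oplus> (b \<otimes> r \<oplus> d \<otimes> t) \<otimes> s) \<otimes> (s \<otimes> t \<otimes> r)" using c' by algebra
    qed (use c' in auto)
  next
    show "\<zero>\<^bsub>L\<^esub> \<in> carrier L" unfolding fr_zero using W_closed(1) by (intro fc) auto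
  next
    fix x assume "x \<in> carrier L"
    then obtain a s where *: "a \<in> carrier R" "s \<in> W" "x = fr a s" by (metis L_E)
    note c = *(1) W_closed(3)[OF *(2)]
    show "\<zero>\<^bsub>L\<^esub> \<oplus>\<^bsub>L\<^esub> x = x"
      unfolding fr_zero *(3) fr_add[OF zero_closed W_closed(1) *(1,2)] using c by simp
    have "fr (\<ominus> a) s \<oplus>\<^bsub>L\<^esub> x = \<zero>\<^bsub>L\<^esub>"
      unfolding fr_zero *(3) fr_add[OF a_inv_closed[OF *(1)] *(2,1,2)]
    proof (rule fr_eqI[OF _ m[OF *(2,2)] zero_closed W_closed(1)])
      show "(\<ominus> a \<otimes> s \<oplus> a \<otimes> s) \<otimes> \<one> = \<zero> \<otimes> (s \<otimes> s)" using c by algebra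
    qed (use c in auto)
    then show "\<exists>y\<in>carrier L. y \<oplus>\<^bsub>L\<^esub> x = \<zero>\<^bsub>L\<^esub>" using fc[OF a_inv_closed[OF *(1)] *(2)] by blast
  qed
  show "comm_monoid L"
  proof (rule comm_monoidI)
    fix x y assume "x \<in> carrier L" "y \<in> carrier L"
    then obtain a s b t where *: "a \<in> carrier R" "s \<in> W" "x = fr a s" "b \<in> carrier R" "t \<in> W" "y = fr b t"
      by (metis L_E)
    note c = *(1,4) W_closed(3)[OF *(2)] W_closed(3)[OF *(5)]
    show "x \<otimes>\<^bsub>L\<^esub> y \<in> carrier L" unfolding *(3,6) fr_mult[OF *(1,2,4,5)] using c m[OF *(2,5)] by (intro fc) auto
    show "x \<otimes>\<^bsub>L\<^esub> y = y \<otimes>\<^bsub>L\<^esub> x"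
      unfolding *(3,6) fr_mult[OF *(1,2,4,5)] fr_mult[OF *(4,5,1,2)] using c by (simp add: m_comm)
    fix z assume "z \<in> carrier L"
    then obtain d r where z: "d \<in> carrier R" "r \<in> W" "z = fr d r" by (metis L_E)
    show "x \<otimes>\<^bsub>L\<^esub> y \<otimes>\<^bsub>L\<^esub> z = x \<otimes>\<^bsub>L\<^esub> (y \<otimes>\<^bsub>L\<^esub> z)"
      unfolding *(3,6) z(3) fr_mult[OF *(1,2,4,5)] fr_mult[OF *(4,5) z(1,2)]
        fr_mult[OF m_closed[OF *(1,4)] m[OF *(2,5)] z(1,2)] fr_mult[OF *(1,2) m_closed[OF *(4) z(1)] m[OF *(5) z(2)]]
      using c z(1) W_closed(3)[OF z(2)] by (simp add: m_assoc)
  next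
    show "\<one>\<^bsub>L\<^esub> \<in> carrier L" unfolding fr_one using W_closed(1) by (intro fc) auto
    fix x assume "x \<in> carrier L"
    then obtain a s where *: "a \<in> carrier R" "s \<in> W" "x = fr a s" by (metis L_E)
    show "\<one>\<^bsub>L\<^esub> \<otimes>\<^bsub>L\<^esub> x = x"
      unfolding fr_one *(3) fr_mult[OF one_closed W_closed(1) *(1,2)] using *(1) W_closed(3)[OF *(2)] by simp
  qed
  fix x y z assume "x \<in> carrier L" "y \<in> carrier L" "z \<in> carrier L"
  then obtain a s b t d r where *: "a \<in> carrier R" "s \<in> W" "x = fr a s" "b \<in> carrier R" "t \<in> W" "y = fr b t"
    and z: "d \<in> carrier R" "r \<in> W" "z = fr d r" by (metis L_E)
  note c = *(1,4) W_closed(3)[OF *(2)] W_closed(3)[OF *(5)] z(1) W_closed(3)[OF z(2)]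
  have c1: "a \<otimes> t \<oplus> b \<otimes> s \<in> carrier R" using c by auto
  show "(x \<oplus>\<^bsub>L\<^esub> y) \<otimes>\<^bsub>L\<^esub> z = x \<otimes>\<^bsub>L\<^esub> z \<oplus>\<^bsub>L\<^esub> y \<otimes>\<^bsub>L\<^esub> z"
    unfolding *(3,6) z(3) fr_add[OF *(1,2,4,5)] fr_mult[OF *(1,2) z(1,2)] fr_mult[OF *(4,5) z(1,2)]
      fr_mult[OF c1 m[OF *(2,5)] z(1,2)]
      fr_add[OF m_closed[OF *(1) z(1)] m[OF *(2) z(2)] m_closed[OF *(4) z(1)] m[OF *(5) z(2)]]
  proof (rule fr_eqI[OF _ m[OF m[OF *(2,5)] z(2)] _ m[OF m[OF *(2) z(2)] m[OF *(5) z(2)]]])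
    show "(a \<otimes> t \<oplus> b \<otimes> s) \<otimes> d \<otimes> (s \<otimes> r \<otimes> (t \<otimes> r)) =
        (a \<otimes> d \<otimes> (t \<otimes> r) \<oplus> b \<otimes> d \<otimes> (s \<otimes> r)) \<otimes> (s \<otimes> t \<otimes> r)" using c by algebra
  qed (use c in auto)
qed

section \<open>Ideals of the localization and saturations in the ring\<close>

interpretation L: cring L by (rule cring_L)

definition ext :: "'a set \<Rightarrow> ('a \<times> 'a) set set"
  where "ext A = {fr a s | a s. a \<in> A \<and> s \<in> W}"

text \<open>The set \<open>ext A\<close> asks for one representative with numerator in
  \<open>A\<close>; equality of fractions multiplies any other numerator into \<open>A\<close> by an
  element outside \<open>P\<close>, which is membership in the saturation.\<close>

lemma fr_in_ext_iff:
  assumes A: "ideal A R" and a: "a \<in> carrier R" "s \<in> W"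
  shows "fr a s \<in> ext A \<longleftrightarrow> a \<in> sat R P A"
proof
  note iA = ideal_basic[OF A]
  assume "fr a s \<in> ext A"
  then obtain b t where b: "b \<in> A" "t \<in> W" "fr a s = fr b t" unfolding ext_def by blast
  then obtain u where u: "u \<in> W" "u \<otimes> (a \<otimes> t) = u \<otimes> (b \<otimes> s)"
    using fr_eq_iff[OF a iA(7)[OF b(1)] b(2)] by blast
  note c = a(1) iA(7)[OF b(1)] W_closed(3)[OF a(2)] W_closed(3)[OF b(2)] W_closed(3)[OF u(1)]
  have "(u \<otimes> t) \<otimes> a = u \<otimes> (b \<otimes> s)" unfolding u(2)[symmetric] using c by algebra
  also have "\<dots> \<in> A" using iA(5,6) b(1) c by simp
  finally show "a \<in> sat R P A" using satI[OF a(1), of "u \<otimes> t"] W_closed(2)[OF u(1) b(2)] by blast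
next
  assume "a \<in> sat R P A"
  then obtain v where v: "v \<in> carrier R" "v \<notin> P" "v \<otimes> a \<in> A" by (metis satE)
  have vW: "v \<in> W" using v by simp
  note c = a(1) v(1) W_closed(3)[OF a(2)]
  have "fr a s = fr (v \<otimes> a) (v \<otimes> s)"
  proof (rule fr_eqI[OF a _ W_closed(2)[OF vW a(2)]])
    show "a \<otimes> (v \<otimes> s) = v \<otimes> a \<otimes> s" using c by algebra
  qed (use c in simp)
  then show "fr a s \<in> ext A" unfolding ext_def using v(3) W_closed(2)[OF vW a(2)] by blast
qed

lemma ext_ideal:
  assumes A: "ideal A R"
  shows "ideal (ext A) L"
proof (rule L.ideal_of_closed)
  note iA = ideal_basic[OF A]
  show "ext A \<subseteq> carrier L" unfolding ext_def using iA(7) fr_closed by blast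
  show "\<zero>\<^bsub>L\<^esub> \<in> ext A" unfolding ext_def fr_zero using iA(2) W_closed(1) by blast
  fix x y assume "x \<in> ext A"
  then obtain a s where a: "a \<in> A" "s \<in> W" "x = fr a s" unfolding ext_def by blast
  {
    assume "y \<in> ext A"
    then obtain b t where b: "b \<in> A" "t \<in> W" "y = fr b t" unfolding ext_def by blast
    have "a \<otimes> t \<oplus> b \<otimes> s \<in> A" using iA(3,6) a b W_closed(3) by simp
    then show "x \<oplus>\<^bsub>L\<^esub> y \<in> ext A"
      unfolding a(3) b(3) fr_add[OF iA(7)[OF a(1)] a(2) iA(7)[OF b(1)] b(2)] ext_def
      using W_closed(2)[OF a(2) b(2)] by blast
  next
    assume "y \<in> carrier L"
    then obtain b t where b: "b \<in> carrier R" "t \<in> W" "y = fr b t" by (rule L_E)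
    show "y \<otimes>\<^bsub>L\<^esub> x \<in> ext A"
      unfolding a(3) b(3) fr_mult[OF b(1,2) iA(7)[OF a(1)] a(2)] ext_def
      using W_closed(2)[OF b(2) a(2)] iA(5)[OF a(1) b(1)] by blast
  }
qed

lemma fr_in_ideal:
  assumes K: "ideal K L" and a: "a \<in> carrier R" "s \<in> W" "t \<in> W" and "fr a s \<in> K"
  shows "fr a t \<in> K"
proof -
  note c = a(1) W_closed(3)[OF a(2)] W_closed(3)[OF a(3)]
  have "fr a t = fr (s \<otimes> a) (t \<otimes> s)"
  proof (rule fr_eqI[OF a(1,3) _ W_closed(2)[OF a(3,2)]])
    show "a \<otimes> (t \<otimes> s) = s \<otimes> a \<otimes> t" using c by algebra
  qed (use c in simp)
  also have "\<dots> = fr s t \<otimes>\<^bsub>L\<^esub> fr a s" by (rule fr_mult[symmetric]) (use c a in auto)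
  also have "\<dots> \<in> K" using L.ideal_basic(5)[OF K assms(5) fr_closed[OF c(2) a(3)]] .
  finally show ?thesis .
qed

text \<open>Denominators are units, so fractions and their numerators generate the same ideal. For
  the second inclusion, the elements \<open>a\<close> of \<open>R\<close> with \<open>a / 1\<close>
  in the ideal of \<open>Y\<close> form an ideal, and it contains \<open>X\<close>.\<close>

lemma genideal_eq_ext:
  assumes X: "X \<subseteq> carrier R" and Y: "Y \<subseteq> carrier L"
    and XY: "\<And>x. x \<in> X \<Longrightarrow> \<exists>s\<in>W. fr x s \<in> Y" and YX: "\<And>y. y \<in> Y \<Longrightarrow> \<exists>x\<in>X. \<exists>s\<in>W. y = fr x s"
  shows "Idl\<^bsub>L\<^esub> Y = ext (Idl X)"
proof (rule antisym)
  show "Idl\<^bsub>L\<^esub> Y \<subseteq> ext (Idl X)"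
  proof (rule L.genideal_minimal[OF ext_ideal[OF genideal_ideal[OF X]]])
    show "Y \<subseteq> ext (Idl X)" using YX genideal_self[OF X] unfolding ext_def by blast
  qed
  let ?K = "Idl\<^bsub>L\<^esub> Y"
  note K = L.genideal_ideal[OF Y]
  let ?A = "{a \<in> carrier R. fr a \<one> \<in> ?K}"
  have "ideal ?A R"
  proof (rule ideal_of_closed)
    show "\<zero> \<in> ?A" using L.ideal_basic(2)[OF K] fr_zero by simp
  next
    fix a b assume ab: "a \<in> ?A" "b \<in> ?A"
    then have "fr a \<one> \<oplus>\<^bsub>L\<^esub> fr b \<one> \<in> ?K" using L.ideal_basic(3)[OF K] by simp
    then show "a \<oplus> b \<in> ?A" using ab fr_add[of a \<one> b \<one>] W_closed(1) by simp
  next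
    fix a r assume a: "a \<in> ?A" and r: "r \<in> carrier R"
    then have "fr r \<one> \<otimes>\<^bsub>L\<^esub> fr a \<one> \<in> ?K"
      using L.ideal_basic(5)[OF K] fr_closed[OF r W_closed(1)] by simp
    then show "r \<otimes> a \<in> ?A" using a r fr_mult[of r \<one> a \<one>] W_closed(1) by simp
  qed auto
  moreover have "X \<subseteq> ?A"
  proof
    fix x assume x: "x \<in> X"
    then obtain s where s: "s \<in> W" "fr x s \<in> ?K" using XY L.genideal_self[OF Y] by blast
    then show "x \<in> ?A" using fr_in_ideal[OF K _ s(1) W_closed(1) s(2)] X x by auto
  qed
  ultimately have "Idl X \<subseteq> ?A" by (rule genideal_minimal)
  then show "ext (Idl X) \<subseteq> ?K"
    unfolding ext_def using fr_in_ideal[OF K _ W_closed(1)] by blast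
qed

lemma ext_at_eq_ext:
  assumes A: "ideal A R"
  shows "ext_at R P A = ext A"
proof -
  have "Idl\<^bsub>L\<^esub> (to_loc_at R P ` A) = ext (Idl A)"
    using ideal_basic(1,7)[OF A] W_closed(1)
    by (intro genideal_eq_ext) (auto simp: to_loc_at_def intro!: fr_closed)
  moreover have "Idl A = A"
    using genideal_minimal[OF A subset_refl] genideal_self[OF ideal_basic(1)[OF A]] by blast
  ultimately show ?thesis by (simp add: ext_at_def)
qed

lemma to_loc_at_in_ext_at_iff:
  assumes "ideal A R" "a \<in> carrier R"
  shows "to_loc_at R P a \<in> ext_at R P A \<longleftrightarrow> a \<in> sat R P A"
  using fr_in_ext_iff[OF assms W_closed(1)] ext_at_eq_ext[OF assms(1)] by (simp add: to_loc_at_def)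

text \<open>The relation \<open>list_all2\<close> pairs each fraction with a numerator in order and
  is inherited by prefixes, as regular sequences require.\<close>

lemma genideal_list_eq_ext:
  assumes "list_all2 (\<lambda>x a. a \<in> carrier R \<and> (\<exists>s\<in>W. x = fr a s)) xs as"
  shows "Idl\<^bsub>L\<^esub> (set xs) = ext (adjs R {\<zero>} as)"
proof -
  have as: "set as \<subseteq> carrier R" using assms by (auto simp: list_all2_conv_all_nth in_set_conv_nth)
  have "Idl\<^bsub>L\<^esub> (set xs) = ext (Idl (set as))"
  proof (rule genideal_eq_ext[OF as])
    show "set xs \<subseteq> carrier L"
      using assms fr_closed by (force simp: list_all2_conv_all_nth in_set_conv_nth)
    show "\<exists>s\<in>W. fr x s \<in> set xs" if "x \<in> set as" for x
      using that assms by (auto simp: list_all2_conv_all_nth in_set_conv_nth) metis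
    show "\<exists>x\<in>set as. \<exists>s\<in>W. y = fr x s" if "y \<in> set xs" for y
    proof -
      obtain i where i: "i < length xs" "y = xs ! i" using \<open>y \<in> set xs\<close> by (auto simp: in_set_conv_nth)
      then have "as ! i \<in> set as" "\<exists>s\<in>W. xs ! i = fr (as ! i) s"
        using assms by (auto simp: list_all2_conv_all_nth)
      then show ?thesis using i(2) by blast
    qed
  qed
  then show ?thesis using adjs_zero_eq_genideal[OF as] by simp
qed

text \<open>Regularity is transferred prefix by prefix. The numerators lie in \<open>P\<close>
  because the sequence generates a proper ideal, and a numerator outside \<open>P\<close> would make
  it contain a unit.\<close>

lemma regular_sequence_imp_regs:
  assumes reg: "regular_sequence L xs"
    and xs: "list_all2 (\<lambda>x a. a \<in> carrier R \<and> (\<exists>s\<in>W. x = fr a s)) xs as"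
  shows "regular_seq_at R P {\<zero>} as" "set as \<subseteq> P"
proof -
  have as: "set as \<subseteq> carrier R" using xs by (auto simp: list_all2_conv_all_nth in_set_conv_nth)
  have len: "length xs = length as" by (rule list_all2_lengthD[OF xs])
  show "regular_seq_at R P {\<zero>} as"
    unfolding regs_iff_nth
  proof (intro allI impI)
    fix i assume i: "i < length as"
    let ?A = "adjs R {\<zero>} (take i as)" and ?K = "Idl\<^bsub>L\<^esub> (set (take i xs))"
    have A: "ideal ?A R" using as by (intro adjs_ideal[OF zeroideal]) (auto dest: in_set_takeD)
    have K: "?K = ext ?A" by (rule genideal_list_eq_ext[OF list_all2_takeI[OF xs]])
    obtain s where s: "as ! i \<in> carrier R" "s \<in> W" "xs ! i = fr (as ! i) s"
      using xs i len by (auto simp: list_all2_conv_all_nth)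
    have "nonzerodivisor_on (quot_module L ?K) (xs ! i)"
      using reg i len unfolding regular_sequence_def by simp
    then have nzd: "\<And>v. \<lbrakk>v \<in> carrier L; xs ! i \<otimes>\<^bsub>L\<^esub> v \<in> ?K\<rbrakk> \<Longrightarrow> v \<in> ?K"
      using L.nonzerodivisor_on_quot_module_iff[of ?K "xs ! i"] K ext_ideal[OF A] fr_closed[OF s(1,2)] s(3)
      by simp
    show "regular_at R P ?A (as ! i)"
      unfolding regular_at_def
    proof (intro ballI impI)
      fix a assume a: "a \<in> carrier R" "as ! i \<otimes> a \<in> sat R P ?A"
      have "xs ! i \<otimes>\<^bsub>L\<^esub> fr a \<one> = fr (as ! i \<otimes> a) (s \<otimes> \<one>)"
        unfolding s(3) using fr_mult[OF s(1,2) a(1) W_closed(1)] .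
      then have "xs ! i \<otimes>\<^bsub>L\<^esub> fr a \<one> \<in> ?K"
        unfolding K using fr_in_ext_iff[OF A m_closed[OF s(1) a(1)] W_closed(2)[OF s(2) W_closed(1)]] a(2) by simp
      then have "fr a \<one> \<in> ?K" using nzd fr_closed[OF a(1) W_closed(1)] by blast
      then show "a \<in> sat R P ?A" unfolding K using fr_in_ext_iff[OF A a(1) W_closed(1)] by simp
    qed
  qed
  note A = adjs_ideal[OF zeroideal as]
  have K: "Idl\<^bsub>L\<^esub> (set xs) = ext (adjs R {\<zero>} as)" by (rule genideal_list_eq_ext[OF xs])
  show "set as \<subseteq> P"
  proof
    fix a assume a: "a \<in> set as"
    show "a \<in> P"
    proof (rule ccontr)
      assume "a \<notin> P"
      moreover have ac: "a \<in> carrier R" using a as by blast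
      moreover have "a \<in> adjs R {\<zero>} as" using adjs_basic(2)[OF zeroideal as] a by blast
      ultimately have "\<one> \<in> sat R P (adjs R {\<zero>} as)" using satI[OF one_closed ac] by simp
      then have "\<one>\<^bsub>L\<^esub> \<in> Idl\<^bsub>L\<^esub> (set xs)"
        unfolding K fr_one using fr_in_ext_iff[OF A one_closed W_closed(1)] by simp
      then have "Idl\<^bsub>L\<^esub> (set xs) = carrier L"
        using ideal.one_imp_carrier ext_ideal[OF A] K by metis
      then show False using reg unfolding regular_sequence_def by blast
    qed
  qed
qed

lemma ex_numerators:
  assumes "\<And>x. x \<in> set xs \<Longrightarrow> \<exists>a\<in>A. \<exists>s\<in>W. x = fr a s" "A \<subseteq> carrier R"
  shows "\<exists>as. set as \<subseteq> A \<and> list_all2 (\<lambda>x a. a \<in> carrier R \<and> (\<exists>s\<in>W. x = fr a s)) xs as"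
  using assms(1)
proof (induction xs)
  case (Cons x xs)
  then obtain as where "set as \<subseteq> A" "list_all2 (\<lambda>x a. a \<in> carrier R \<and> (\<exists>s\<in>W. x = fr a s)) xs as"
    by auto
  moreover obtain a s where "a \<in> A" "s \<in> W" "x = fr a s" using Cons.prems[of x] by auto
  ultimately show ?case using assms(2) by (intro exI[of _ "a # as"]) auto
qed auto

text \<open>A prime inside \<open>P\<close> is its own saturation, so whether a fraction lies in
  \<open>ext Q\<close> can be read off from any of its numerators.\<close>

lemma ext_prime:
  assumes Q: "primeideal Q R" "Q \<subseteq> P"
  shows "primeideal (ext Q) L"
proof (rule L.primeideal_of_basic[OF ext_ideal[OF primeideal_basic(1)[OF Q(1)]]])
  note iff = fr_in_ext_iff[OF primeideal_basic(1)[OF Q(1)]]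
  have sat: "sat R P Q = Q"
    using sat_subset_prime[OF Q subset_refl] subset_sat[OF P primeideal_basic(4)[OF Q(1)]] by blast
  show "\<one>\<^bsub>L\<^esub> \<notin> ext Q"
    unfolding fr_one iff[OF one_closed W_closed(1)] sat by (rule primeideal_basic(2)[OF Q(1)])
  fix x y assume *: "x \<in> carrier L" "y \<in> carrier L" "x \<otimes>\<^bsub>L\<^esub> y \<in> ext Q" "x \<notin> ext Q"
  obtain a s where a: "a \<in> carrier R" "s \<in> W" "x = fr a s" using *(1) by (rule L_E)
  obtain b t where b: "b \<in> carrier R" "t \<in> W" "y = fr b t" using *(2) by (rule L_E)
  have "a \<otimes> b \<in> Q"
    using *(3) unfolding a(3) b(3) fr_mult[OF a(1,2) b(1,2)]
      iff[OF m_closed[OF a(1) b(1)] W_closed(2)[OF a(2) b(2)]] sat .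
  moreover have "a \<notin> Q" using *(4) unfolding a(3) iff[OF a(1,2)] sat .
  ultimately have "b \<in> Q" using primeideal_basic(5)[OF Q(1) a(1) b(1)] by blast
  then show "y \<in> ext Q" unfolding b(3) iff[OF b(1,2)] sat .
qed

lemma ext_psubset:
  assumes Q: "primeideal Q R" "Q' \<subseteq> P" "primeideal Q' R" "Q \<subset> Q'"
  shows "ext Q \<subset> ext Q'"
proof -
  obtain a where a: "a \<in> Q'" "a \<notin> Q" using Q(4) by blast
  have ac: "a \<in> carrier R" using a primeideal_basic(4)[OF Q(3)] by blast
  have "fr a \<one> \<in> ext Q'" unfolding ext_def using a(1) W_closed(1) by blast
  moreover have "fr a \<one> \<notin> ext Q"
    using fr_in_ext_iff[OF primeideal_basic(1)[OF Q(1)] ac W_closed(1)] a(2)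
      sat_subset_prime[OF Q(1) _ subset_refl, of P] Q(2,4) by blast
  moreover have "ext Q \<subseteq> ext Q'" unfolding ext_def using Q(4) by blast
  ultimately show ?thesis by blast
qed

end

section \<open>Heights and dimensions as suprema over chains\<close>

lemma enat_le_SupE:
  assumes "enat n \<le> Sup {enat k | k. Q k}" "Q 0"
  obtains k where "Q k" "n \<le> k"
proof -
  have "\<exists>k. Q k \<and> n \<le> k"
  proof (rule ccontr)
    assume "\<not> ?thesis"
    then have less: "\<And>k. Q k \<Longrightarrow> k < n" by (meson leI)
    \<comment> \<open>The witness \<open>Q 0\<close> excludes \<open>n = 0\<close>, where an empty
      supremum would satisfy the bound as well; it also makes \<open>n - 1\<close> a proper
      predecessor.\<close>
    then have "n > 0" using assms(2) by blast
    have "Sup {enat k | k. Q k} \<le> enat (n - 1)"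
      using less by (fastforce intro!: Sup_least)
    then have "enat n \<le> enat (n - 1)" using assms(1) by (rule order_trans[rotated])
    then show False using \<open>n > 0\<close> by simp
  qed
  then show thesis using that by blast
qed

lemma prime_chain_imp_height_at_least: "prime_chain R P n \<Longrightarrow> i \<le> n \<Longrightarrow> height_at_least R i (P i)"
proof (induction i)
  case (Suc i)
  then have "height_at_least R i (P i)" "P i \<subset> P (Suc i)" "primeideal (P (Suc i)) R"
    by (auto simp: prime_chain_def)
  then show ?case unfolding height_at_least.simps(2) by blast
qed (simp add: prime_chain_def)

lemma height_at_least_imp_prime_chain: "height_at_least R n Q \<Longrightarrow> \<exists>P. prime_chain R P n \<and> P n = Q"
proof (induction n arbitrary: Q)
  case 0
  then show ?case by (intro exI[of _ "\<lambda>_. Q"]) (auto simp: prime_chain_def)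
next
  case (Suc n)
  from Suc.prems obtain Q' where Q': "height_at_least R n Q'" "Q' \<subset> Q" unfolding height_at_least.simps(2) by blast
  obtain P where P: "prime_chain R P n" "P n = Q'" using Suc.IH[OF Q'(1)] by blast
  show ?case
    using P Q'(2) height_at_least_primeideal[OF Suc.prems]
    by (intro exI[of _ "P(Suc n := Q)"]) (simp add: prime_chain_def le_Suc_eq less_Suc_eq)
qed

text \<open>The prime \<open>p\<close> alone is a chain of length 0, which keeps the supremum in
  \<open>prime_height\<close> nonempty.\<close>

lemma height_at_least_if_le_prime_height:
  assumes "primeideal p R" "enat n \<le> prime_height R p"
  shows "height_at_least R n p"
proof -
  have "\<exists>P. prime_chain R P 0 \<and> P 0 = p"
    using assms(1) by (intro exI[of _ "\<lambda>_. p"]) (simp add: prime_chain_def)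
  then obtain k P where "prime_chain R P k" "P k = p" "n \<le> k"
    using assms(2) unfolding prime_height_def by (auto elim!: enat_le_SupE)
  then show ?thesis using prime_chain_imp_height_at_least[of R P k k] height_at_least_le by auto
qed

lemma height_at_least_imp_le_prime_height: "height_at_least R n p \<Longrightarrow> enat n \<le> prime_height R p"
  unfolding prime_height_def using height_at_least_imp_prime_chain by (intro Sup_upper) blast

section \<open>The Cohen-Macaulay property of a localization, read in the ring\<close>

context cring_prime
begin

text \<open>Primes inside \<open>P\<close> extend to primes of the localization and strict
  inclusions stay strict, so chains below \<open>P\<close> are carried over.\<close>

lemma height_at_least_le_krull_dim_L:
  assumes "height_at_least R n P"
  shows "enat n \<le> krull_dim L"
proof -
  have "height_at_least L n (ext Q)" if "height_at_least R n Q" "Q \<subseteq> P" for n Q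
    using that
  proof (induction n arbitrary: Q)
    case 0
    then show ?case using ext_prime by simp
  next
    case (Suc n)
    then obtain Q' where Q': "height_at_least R n Q'" "Q' \<subset> Q" by (auto simp: height_at_least.simps(2))
    have "height_at_least L n (ext Q')" using Suc.IH[OF Q'(1)] Q'(2) Suc.prems(2) by blast
    moreover have "ext Q' \<subset> ext Q"
      using ext_psubset[OF height_at_least_primeideal[OF Q'(1)] Suc.prems(2) height_at_least_primeideal[OF Suc.prems(1)] Q'(2)] .
    moreover have "primeideal (ext Q) L"
      using ext_prime[OF height_at_least_primeideal[OF Suc.prems(1)] Suc.prems(2)] .
    ultimately show ?case by (auto simp: height_at_least.simps(2))
  qed
  then have "height_at_least L n (ext P)" using assms by blast
  then show ?thesis
    unfolding krull_dim_def using height_at_least_imp_prime_chain by (intro Sup_upper) blast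
qed

text \<open>Depth equals dimension, which is at least \<open>n\<close>, so some regular sequence of
  the localization has length at least \<open>n\<close>; its numerators, cut down to
  \<open>n\<close>, form the sequence in \<open>R\<close>.\<close>

lemma cm_at_if_local_cohen_macaulay:
  assumes "local_cohen_macaulay L"
  shows "cm_at R P"
  unfolding cm_at_def
proof (intro allI impI)
  fix n assume n: "height_at_least R n P"
  obtain M where M: "depth L M = krull_dim L" using assms unfolding local_cohen_macaulay_def by blast
  let ?Q = "\<lambda>k. \<exists>xs. length xs = k \<and> regular_sequence L xs \<and> set xs \<subseteq> M"
  have depth: "depth L M = Sup {enat k | k. ?Q k}" unfolding depth_def by metis
  \<comment> \<open>The localization is not the zero ring, so the empty sequence is regular and the
    supremum defining the depth is nonempty.\<close>
  have "\<one>\<^bsub>L\<^esub> \<notin> ext {\<zero>}"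
    unfolding fr_one fr_in_ext_iff[OF zeroideal one_closed W_closed(1)] by (rule sat_zero_proper[OF P])
  moreover have "Idl\<^bsub>L\<^esub> (set []) = ext {\<zero>}" using genideal_list_eq_ext[of "[]" "[]"] by simp
  ultimately have "regular_sequence L []"
    using fr_closed[OF one_closed W_closed(1)] fr_one by (auto simp: regular_sequence_def)
  then have "?Q 0" by auto
  then obtain k where "?Q k" "n \<le> k"
    using enat_le_SupE[of n ?Q] height_at_least_le_krull_dim_L[OF n] M depth by auto
  then have "\<exists>xs. regular_sequence L xs \<and> n \<le> length xs" by blast
  then obtain xs where xs: "regular_sequence L xs" "n \<le> length xs" by blast
  have "\<And>x. x \<in> set xs \<Longrightarrow> \<exists>a\<in>carrier R. \<exists>s\<in>W. x = fr a s"
    using xs(1) unfolding regular_sequence_def by (meson L_E subsetD)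
  then obtain as where as: "list_all2 (\<lambda>x a. a \<in> carrier R \<and> (\<exists>s\<in>W. x = fr a s)) xs as"
    using ex_numerators[of xs "carrier R"] by blast
  note r = regular_sequence_imp_regs[OF xs(1) as]
  have "set (take n as) \<subseteq> P" using r(2) set_take_subset[of n as] by blast
  moreover have "length (take n as) = n" using list_all2_lengthD[OF as] xs(2) by simp
  moreover have "regular_seq_at R P {\<zero>} (take n as)"
    using r(1) regs_append[of P "{\<zero>}" "take n as" "drop n as"] by simp
  ultimately show "\<exists>ys. set ys \<subseteq> P \<and> length ys = n \<and> regular_seq_at R P {\<zero>} ys" by blast
qed

end

section \<open>Symbolic powers and the comparison at associated primes\<close>

context noetherian_cring
begin

lemma ex_maximal_ideal:
  assumes P: "primeideal P R"
  shows "\<exists>M. maximalideal M R \<and> P \<subseteq> M"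
proof -
  let ?C = "{A. ideal A R \<and> P \<subseteq> A \<and> \<one> \<notin> A}"
  have "?C \<noteq> {}" using primeideal_basic(1,2)[OF P] by blast
  then have "\<exists>M\<in>?C. \<forall>B\<in>?C. M \<subseteq> B \<longrightarrow> B = M" by (rule exists_maximal_ideal_in) simp
  then obtain M where M: "ideal M R" "P \<subseteq> M" "\<one> \<notin> M"
    "\<And>B. \<lbrakk>ideal B R; P \<subseteq> B; \<one> \<notin> B; M \<subseteq> B\<rbrakk> \<Longrightarrow> B = M" by auto
  have "maximalideal M R"
  proof (rule maximalidealI[OF M(1)])
    show "carrier R \<noteq> M" using M(3) by blast
    fix J assume J: "ideal J R" "M \<subseteq> J" "J \<subseteq> carrier R"
    then show "J = M \<or> J = carrier R" using M(2,4) ideal.one_imp_carrier[OF J(1)] by blast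
  qed
  then show ?thesis using M(2) by blast
qed

lemma subset_prime_if_power_subset:
  assumes "primeideal p R" "ideal I R" "ideal_power R I m \<subseteq> p"
  shows "I \<subseteq> p"
  using assms(3)
proof (induction m)
  case 0
  then show ?case using primeideal_basic(2)[OF assms(1)] by (auto simp: ideal_power_0)
next
  case (Suc m)
  show ?case
  proof (rule ccontr)
    assume "\<not> I \<subseteq> p"
    then obtain i where i: "i \<in> I" "i \<notin> p" by blast
    have "a \<in> p" if a: "a \<in> ideal_power R I m" for a
    proof (rule ccontr)
      assume "a \<notin> p"
      then have "a \<otimes> i \<notin> p"
        using primeideal_basic(5)[OF assms(1)] i ideal_basic(7)[OF assms(2)]
          ideal_basic(7)[OF ideal_power_ideal[OF assms(2)] a] by blast
      moreover have "a \<otimes> i \<in> ideal_power R I (Suc m)"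
        unfolding ideal_power_Suc using a i(1) by (rule mem_ideal_prodI)
      ultimately show False using Suc.prems by blast
    qed
    then show False using Suc.IH \<open>\<not> I \<subseteq> p\<close> by blast
  qed
qed

text \<open>The witness for \<open>p\<close> modulo \<open>A\<close> works in the localization too,
  as every element that multiplies it into \<open>A\<close> lies in \<open>p\<close>.\<close>

lemma assprime_sat_if_assprime:
  assumes A: "ideal A R" and p: "p \<in> assprimes R A"
  shows "p \<in> assprimes R (sat R p A)"
proof -
  obtain b where b: "primeideal p R" "b \<in> carrier R" "p = colon R A b"
    using p unfolding assprimes_def by blast
  note m = mem_if_eq_colon[OF b(3)]
  show ?thesis
  proof (rule assprime_satI[OF b(1,2)])
    show "b \<notin> sat R p A" using m by (auto elim!: satE)
    show "r \<otimes> b \<in> sat R p A" if "r \<in> p" for r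
      using that m subset_sat[OF b(1) ideal_basic(1)[OF A]] by blast
  qed
qed

lemma fitting_not_subset_assprime:
  assumes I: "ideal I R" and gci: "generically_complete_intersection R I"
    and unmixed: "unmixed_of_height R I c" and p: "p \<in> assprimes R I"
  shows "\<not> fitting_ideal R (ideal_module R I) c \<subseteq> p"
proof -
  have pp: "primeideal p R" using p unfolding assprimes_def by blast
  interpret cring_prime R p by (intro cring_prime.intro is_cring cring_prime_axioms.intro pp)
  have pA: "p \<in> Ass R (quot_module R I)" unfolding Ass_quot_module[OF I] by (rule p)
  obtain xs where xs: "regular_sequence L xs" "ext_at R p I = Idl\<^bsub>L\<^esub> (set xs)"
    using gci pA unfolding generically_complete_intersection_def by blast
  have ext_I: "Idl\<^bsub>L\<^esub> (set xs) = ext I" using xs(2) ext_at_eq_ext[OF I] by simp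
  have "set xs \<subseteq> ext I"
    using ring.genideal_self[OF cring.axioms(1)[OF cring_L]] xs(1) ext_I
    unfolding regular_sequence_def by blast
  \<comment> \<open>The numerators are picked in \<open>I\<close>, not merely in the ring, since the
    criterion for the Fitting ideal asks for generators in \<open>I\<close>.\<close>
  then have "\<And>x. x \<in> set xs \<Longrightarrow> \<exists>a\<in>I. \<exists>s\<in>W. x = fr a s" unfolding ext_def by blast
  then obtain as where as: "set as \<subseteq> I" "list_all2 (\<lambda>x a. a \<in> carrier R \<and> (\<exists>s\<in>W. x = fr a s)) xs as"
    using ex_numerators[of xs I] ideal_basic(1)[OF I] by blast
  note r = regular_sequence_imp_regs[OF xs(1) as(2)]
  have asc: "set as \<subseteq> carrier R" using as(1) ideal_basic(1)[OF I] by blast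
  note A = adjs_ideal[OF zeroideal asc]
  have ext_eq: "ext I = ext (adjs R {\<zero>} as)" using genideal_list_eq_ext[OF as(2)] ext_I by simp
  have "I \<subseteq> sat R p (adjs R {\<zero>} as)"
  proof
    fix a assume a: "a \<in> I"
    have ac: "a \<in> carrier R" using a ideal_basic(7)[OF I] by blast
    have "fr a \<one> \<in> ext I" unfolding ext_def using a W_closed(1) by blast
    then show "a \<in> sat R p (adjs R {\<zero>} as)"
      unfolding ext_eq fr_in_ext_iff[OF A ac W_closed(1)] .
  qed
  moreover have "length as \<le> c"
    using height_at_least_imp_le_prime_height[OF height_at_least_length_regs[OF pp r(2,1)]] unmixed pA
    unfolding unmixed_of_height_def by simp
  ultimately show ?thesis using fitting_not_subset_if_generators[OF pp I as(1)] by blast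
qed

text \<open>Removes the localizations from the definition; afterwards symbolic and ordinary powers
  are compared through multipliers in \<open>R\<close>.\<close>

lemma mem_symbolic_power_iff:
  assumes I: "ideal I R"
  shows "a \<in> symbolic_power R I m \<longleftrightarrow>
    a \<in> carrier R \<and> (\<forall>p\<in>assprimes R I. a \<in> sat R p (ideal_power R I m))"
proof -
  have "to_loc_at R p a \<in> ext_at R p (ideal_power R I m) \<longleftrightarrow> a \<in> sat R p (ideal_power R I m)"
    if "p \<in> assprimes R I" "a \<in> carrier R" for p
  proof -
    have pp: "primeideal p R" using that(1) unfolding assprimes_def by blast
    interpret cring_prime R p by (intro cring_prime.intro is_cring cring_prime_axioms.intro pp)
    show ?thesis by (rule to_loc_at_in_ext_at_iff[OF ideal_power_ideal[OF I] that(2)])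
  qed
  then show ?thesis unfolding symbolic_power_def Ass_quot_module[OF I] by blast
qed

end

theorem corollary4p6:
  fixes S :: "('a, 'b) ring_scheme" (structure) and I :: "'a set" and c m :: nat
  assumes "cohen_macaulay S"
    and "ideal I S" and "I \<noteq> carrier S"
    and "unmixed_of_height S I c" and "ideal_height S I = enat c"
    and "generically_complete_intersection S I"
    and "m > 0"
  shows "symbolic_power S I m = ideal_power S I m \<longleftrightarrow>
    (\<exists>x\<in>fitting_ideal S (ideal_module S I) c.
       nonzerodivisor_on (quot_module S (ideal_power S I m)) x)"
proof -
  interpret noetherian_cring S
    using assms(1) unfolding cohen_macaulay_def noetherian_cring_def by blast
  note I = assms(2)
  let ?F = "fitting_ideal S (ideal_module S I) c" and ?Im = "ideal_power S I m"
  note Im = ideal_power_ideal[OF I, of m] and F = fitting_ideal_ideal[OF I, of c]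
  have prime: "primeideal p S" if "p \<in> assprimes S A" for p A
    using that unfolding assprimes_def by blast
  have sub: "?Im \<subseteq> symbolic_power S I m"
  proof
    fix a assume a: "a \<in> ?Im"
    then have "a \<in> sat S p ?Im" if "p \<in> assprimes S I" for p
      using subset_sat[OF prime[OF that] ideal_basic(1)[OF Im]] by blast
    then show "a \<in> symbolic_power S I m"
      unfolding mem_symbolic_power_iff[OF I] using a ideal_basic(7)[OF Im] by blast
  qed
  show ?thesis
  proof
    assume eq: "symbolic_power S I m = ?Im"
    have "\<exists>x\<in>?F. \<forall>p\<in>assprimes S I. x \<notin> p"
      by (rule prime_avoidance[OF finite_assprimes[OF I] _ F])
        (erule prime, rule fitting_not_subset_assprime[OF I assms(6,4)])
    then obtain x where x: "x \<in> ?F" "\<And>p. p \<in> assprimes S I \<Longrightarrow> x \<notin> p" by auto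
    have xc: "x \<in> carrier S" using x(1) ideal_basic(7)[OF F] by blast
    have "a \<in> ?Im" if a: "a \<in> carrier S" "x \<otimes> a \<in> ?Im" for a
    proof -
      have "a \<in> sat S p ?Im" if "p \<in> assprimes S I" for p
        by (rule satI[OF a(1) xc x(2)[OF that] a(2)])
      then have "a \<in> symbolic_power S I m" unfolding mem_symbolic_power_iff[OF I] using a(1) by blast
      then show ?thesis using eq by simp
    qed
    then show "\<exists>x\<in>?F. nonzerodivisor_on (quot_module S ?Im) x"
      using x(1) nonzerodivisor_on_quot_module_iff[OF Im xc] by blast
  next
    assume "\<exists>x\<in>?F. nonzerodivisor_on (quot_module S ?Im) x"
    then obtain x where x: "x \<in> ?F" "nonzerodivisor_on (quot_module S ?Im) x" by blast
    have xc: "x \<in> carrier S" using x(1) ideal_basic(7)[OF F] by blast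
    have "a \<in> ?Im" if a: "a \<in> symbolic_power S I m" for a
    proof (rule ccontr)
      assume nin: "a \<notin> ?Im"
      have ac: "a \<in> carrier S" using a mem_symbolic_power_iff[OF I] by blast
      \<comment> \<open>Every multiplier of \<open>a\<close> into the power lies in
        \<open>p\<close>. Once \<open>p\<close> is known to be associated to \<open>I\<close>,
        membership of \<open>a\<close> in the symbolic power supplies a multiplier outside
        \<open>p\<close>, which is the contradiction.\<close>
      obtain p where p: "p \<in> assprimes S ?Im" "colon S ?Im a \<subseteq> p"
        using ex_assprime[OF Im ac nin] by blast
      note pp = prime[OF p(1)]
      obtain b where b: "b \<in> carrier S" "p = colon S ?Im b"
        using p(1) unfolding assprimes_def by blast
      note pm = mem_if_eq_colon[OF b(2)]
      have "b \<notin> ?Im" using pm[of \<one>] primeideal_basic(2)[OF pp] b(1) by simp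
      then have "x \<notin> p"
        using x(2) nonzerodivisor_on_quot_module_iff[OF Im xc] pm b(1) by blast
      then obtain es where es: "set es \<subseteq> I" "length es \<le> c" "I \<subseteq> sat S p (adjs S {\<zero>} es)"
        using generators_if_fitting_not_subset[OF pp I, of c] x(1) by blast
      \<comment> \<open>The Cohen-Macaulay hypothesis is available at maximal ideals, so
        \<open>p\<close> is placed below one.\<close>
      obtain M where M: "maximalideal M S" "p \<subseteq> M" using ex_maximal_ideal[OF pp] by blast
      note Mp = maximalideal_prime[OF M(1)]
      interpret M: cring_prime S M by (intro cring_prime.intro is_cring cring_prime_axioms.intro Mp)
      have cm: "cm_at S M"
        using M.cm_at_if_local_cohen_macaulay assms(1) M(1) unfolding cohen_macaulay_def by blast
      have Ip: "I \<subseteq> p" by (rule subset_prime_if_power_subset[OF pp I subset_assprime[OF Im p(1)]])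
      have ht: "height_at_least S c q" if "primeideal q S" "I \<subseteq> q" for q
      proof (rule height_at_least_if_le_prime_height[OF that(1)])
        show "enat c \<le> prime_height S q"
          unfolding assms(5)[symmetric] ideal_height_def using that by (intro Inf_lower) blast
      qed
      obtain xs where xs: "set xs \<subseteq> I" "regular_seq_at S p {\<zero>} xs" "I \<subseteq> sat S p (adjs S {\<zero>} xs)"
        using cm_at_regular_generators[OF Mp cm pp M(2) I Ip ht es] by blast
      have "p \<in> assprimes S I"
        by (rule assprime_if_assprime_power[OF pp I xs assprime_sat_if_assprime[OF Im p(1)]])
      then have "a \<in> sat S p ?Im" using a mem_symbolic_power_iff[OF I] by blast
      then obtain s where "s \<in> carrier S" "s \<notin> p" "s \<otimes> a \<in> ?Im" by (metis satE)
      then show False using p(2) by (auto simp: colon_def)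
    qed
    then show "symbolic_power S I m = ?Im" using sub by blast
  qed
qed

end
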